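(* The $C^\infty$ regularity of the source and target densities does not imply the $W^{1,3}$ regularity of the transport density. That is, there exist an integer $d\ge 1$, a compact convex set $\Omega\subset\mathbb{R}^d$ with nonempty interior, and nonnegative functions $f^+,f^-\in C^\infty(\overline{\Omega})$ with $\int_\Omega f^+\,\mathrm{d}x=\int_\Omega f^-\,\mathrm{d}x$, such that the transport density $\sigma$ between $f^+$ and $f^-$ does not belong to $W^{1,3}(\Omega)$.
   Context: Let $\Omega\subset\mathbb{R}^d$ be compact and convex with nonempty interior; Sobolev spaces on $\Omega$ are understood on its interior, and $C^\infty(\overline{\Omega})$ denotes functions smooth up to the boundary. Let $f^\pm$ be nonnegative functions in $L^1(\Omega)$ of equal total mass, identified with the measures $f^\pm\,\mathrm{d}x$. An optimal transport plan (for the Monge–Kantorovich problem with Euclidean cost) is a nonnegative Borel measure $\lambda$ on $\Omega\times\Omega$ with first marginal $f^+$ and second marginal $f^-$ that minimizes $\int_{\Omega\times\Omega}|x-y|\,\mathrm{d}\lambda(x,y)$ among all nonnegative Borel measures with these marginals. The transport density $\sigma$ between $f^+$ and $f^-$ is the nonnegative measure on $\Omega$ defined by $$\langle\sigma,\varphi\rangle=\int_{\Omega\times\Omega}\mathrm{d}\lambda(x,y)\int_0^1\varphi((1-t)x+ty)\,|x-y|\,\mathrm{d}t\qquad\text{for all }\varphi\in C(\Omega).$$ It is a known fact that, since $f^\pm$ are absolutely continuous with respect to Lebesgue measure, $\sigma$ does not depend on the choice of the optimal plan $\lambda$ and is absolutely continuous with respect to Lebesgue measure; $\sigma$ is identified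 with its Lebesgue density. *)

theory Defs
  imports "HOL-Analysis.Analysis"
begin

text \<open>
  The dimension \<open>d\<close> is quantified inside the statement, so a point of \<open>\<real>\<^sup>d\<close> is a function
  \<open>x :: nat \<Rightarrow> real\<close> with coordinates \<open>x i\<close> for \<open>i < d\<close> and \<open>x i = undefined\<close> otherwise. With this
  convention the carrier \<open>{..<d} \<rightarrow>\<^sub>E UNIV\<close> is both the underlying set of the library's product
  topology and the space of the library's product of Lebesgue-Borel measures.
\<close>

type_synonym point = "nat \<Rightarrow> real"

abbreviation Rtop :: "nat \<Rightarrow> point topology" where
  "Rtop d \<equiv> powertop_real {..<d}"

abbreviation Rleb :: "nat \<Rightarrow> point measure" where
  "Rleb d \<equiv> Pi\<^sub>M {..<d} (\<lambda>_. lborel)"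

definition edist :: "nat \<Rightarrow> point \<Rightarrow> point \<Rightarrow> real" where
  "edist d x y = L2_set (\<lambda>i. x i - y i) {..<d}"

definition segment_point :: "nat \<Rightarrow> point \<Rightarrow> point \<Rightarrow> real \<Rightarrow> point" where
  "segment_point d x y t = (\<lambda>i\<in>{..<d}. (1 - t) * x i + t * y i)"

definition convex_Rd :: "nat \<Rightarrow> point set \<Rightarrow> bool" where
  "convex_Rd d S \<longleftrightarrow> (\<forall>x\<in>S. \<forall>y\<in>S. \<forall>t\<in>{0..1}. segment_point d x y t \<in> S)"

definition continuous_in :: "nat \<Rightarrow> point set \<Rightarrow> (point \<Rightarrow> real) \<Rightarrow> bool" where
  "continuous_in d S f \<longleftrightarrow> continuous_map (subtopology (Rtop d) S) euclideanreal f"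


section \<open>Smooth functions\<close>

definition partial_deriv :: "nat \<Rightarrow> (point \<Rightarrow> real) \<Rightarrow> point \<Rightarrow> real" where
  "partial_deriv i f x = deriv (\<lambda>t. f (x(i := t))) (x i)"

fun iter_partial :: "nat list \<Rightarrow> (point \<Rightarrow> real) \<Rightarrow> point \<Rightarrow> real" where
  "iter_partial [] f = f"
| "iter_partial (i # is) f = partial_deriv i (iter_partial is f)"

text \<open>
  \<open>C\<^sup>\<infinity>(U)\<close> for open \<open>U\<close>: all iterated partial derivatives exist and are continuous. Existence has
  to be required separately because \<open>deriv\<close> is total.
\<close>

definition smooth_in :: "nat \<Rightarrow> point set \<Rightarrow> (point \<Rightarrow> real) \<Rightarrow> bool" where
  "smooth_in d U f \<longleftrightarrow>
     (\<forall>is\<in>lists {..<d}.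
        continuous_in d U (iter_partial is f) \<and>
        (\<forall>i<d. \<forall>x\<in>U. (\<lambda>t. iter_partial is f (x(i := t))) field_differentiable at (x i)))"

text \<open>
  Smooth up to the boundary: smooth in the interior, and every iterated partial derivative extends
  continuously to the closed set \<open>S\<close>. The values of \<open>f\<close> on the boundary are the ones given by the
  extension.
\<close>

definition smooth_up_to_boundary :: "nat \<Rightarrow> point set \<Rightarrow> (point \<Rightarrow> real) \<Rightarrow> bool" where
  "smooth_up_to_boundary d S f \<longleftrightarrow>
     continuous_in d S f \<and>
     smooth_in d (Rtop d interior_of S) f \<and>
     (\<forall>is\<in>lists {..<d}. \<exists>g. continuous_in d S g \<and>
        (\<forall>x \<in> Rtop d interior_of S. g x = iter_partial is f x))"


section \<open>Sobolev spaces\<close>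

definition test_function :: "nat \<Rightarrow> point set \<Rightarrow> (point \<Rightarrow> real) \<Rightarrow> bool" where
  "test_function d U \<phi> \<longleftrightarrow>
     smooth_in d (topspace (Rtop d)) \<phi> \<and>
     (\<exists>K. compactin (Rtop d) K \<and> K \<subseteq> U \<and> (\<forall>x \<in> topspace (Rtop d) - K. \<phi> x = 0))"

definition in_Lp :: "nat \<Rightarrow> real \<Rightarrow> point set \<Rightarrow> (point \<Rightarrow> real) \<Rightarrow> bool" where
  "in_Lp d p U u \<longleftrightarrow>
     u \<in> borel_measurable (restrict_space (Rleb d) U) \<and>
     set_integrable (Rleb d) U (\<lambda>x. \<bar>u x\<bar> powr p)"

definition weak_partial :: "nat \<Rightarrow> point set \<Rightarrow> nat \<Rightarrow> (point \<Rightarrow> real) \<Rightarrow> (point \<Rightarrow> real) \<Rightarrow> bool" where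
  "weak_partial d U i u g \<longleftrightarrow>
     (\<forall>\<phi>. test_function d U \<phi> \<longrightarrow>
        (LINT x:U|Rleb d. u x * partial_deriv i \<phi> x) = - (LINT x:U|Rleb d. g x * \<phi> x))"

definition in_W1p :: "nat \<Rightarrow> real \<Rightarrow> point set \<Rightarrow> (point \<Rightarrow> real) \<Rightarrow> bool" where
  "in_W1p d p U u \<longleftrightarrow>
     in_Lp d p U u \<and> (\<forall>i<d. \<exists>g. in_Lp d p U g \<and> weak_partial d U i u g)"


section \<open>Optimal transport plans and transport densities\<close>

definition transport_plan ::
  "nat \<Rightarrow> point set \<Rightarrow> (point \<Rightarrow> real) \<Rightarrow> (point \<Rightarrow> real) \<Rightarrow> (point \<times> point) measure \<Rightarrow> bool" where
  "transport_plan d \<Omega> fp fm \<gamma> \<longleftrightarrow>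
     sets \<gamma> = sets (restrict_space (Rleb d) \<Omega> \<Otimes>\<^sub>M restrict_space (Rleb d) \<Omega>) \<and>
     distr \<gamma> (restrict_space (Rleb d) \<Omega>) fst =
       density (restrict_space (Rleb d) \<Omega>) (\<lambda>x. ennreal (fp x)) \<and>
     distr \<gamma> (restrict_space (Rleb d) \<Omega>) snd =
       density (restrict_space (Rleb d) \<Omega>) (\<lambda>x. ennreal (fm x))"

definition transport_cost :: "nat \<Rightarrow> (point \<times> point) measure \<Rightarrow> ennreal" where
  "transport_cost d \<gamma> = (\<integral>\<^sup>+ (x, y). ennreal (edist d x y) \<partial>\<gamma>)"

definition optimal_plan ::
  "nat \<Rightarrow> point set \<Rightarrow> (point \<Rightarrow> real) \<Rightarrow> (point \<Rightarrow> real) \<Rightarrow> (point \<times> point) measure \<Rightarrow> bool" where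
  "optimal_plan d \<Omega> fp fm \<gamma> \<longleftrightarrow>
     transport_plan d \<Omega> fp fm \<gamma> \<and>
     (\<forall>\<gamma>'. transport_plan d \<Omega> fp fm \<gamma>' \<longrightarrow> transport_cost d \<gamma> \<le> transport_cost d \<gamma>')"

text \<open>
  Finiteness of the measure is spelled out because the Bochner integral of a non-integrable
  function is \<open>0\<close>; it is what makes \<open>\<langle>\<mu>, \<phi>\<rangle>\<close> meaningful for all \<open>\<phi> \<in> C(\<Omega>)\<close>.
\<close>

definition transport_density_measure ::
  "nat \<Rightarrow> point set \<Rightarrow> (point \<Rightarrow> real) \<Rightarrow> (point \<Rightarrow> real) \<Rightarrow> point measure \<Rightarrow> bool" where
  "transport_density_measure d \<Omega> fp fm \<mu> \<longleftrightarrow>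
     sets \<mu> = sets (restrict_space (Rleb d) \<Omega>) \<and> finite_measure \<mu> \<and>
     (\<exists>\<gamma>. optimal_plan d \<Omega> fp fm \<gamma> \<and>
        (\<forall>\<phi>. continuous_in d \<Omega> \<phi> \<longrightarrow>
           (LINT x|\<mu>. \<phi> x) =
           (LINT (x, y)|\<gamma>. (LINT t:{0..1}|lborel. \<phi> (segment_point d x y t) * edist d x y))))"

text \<open>
  The Lebesgue density of the transport density measure; it is unique up to null sets, since the
  measure does not depend on the optimal plan.
\<close>

definition is_transport_density ::
  "nat \<Rightarrow> point set \<Rightarrow> (point \<Rightarrow> real) \<Rightarrow> (point \<Rightarrow> real) \<Rightarrow> (point \<Rightarrow> real) \<Rightarrow> bool" where
  "is_transport_density d \<Omega> fp fm \<sigma> \<longleftrightarrow>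
     \<sigma> \<in> borel_measurable (restrict_space (Rleb d) \<Omega>) \<and> (\<forall>x\<in>\<Omega>. 0 \<le> \<sigma> x) \<and>
     transport_density_measure d \<Omega> fp fm
       (density (restrict_space (Rleb d) \<Omega>) (\<lambda>x. ennreal (\<sigma> x)))"

end

theory Submission
  imports Defs
begin

text \<open>
  Write \<open>w = sqrt (x\<^sup>2 + 4 y)\<close>. The lines \<open>y = b x + b\<^sup>2\<close> with \<open>0 \<le> b \<le> 1/2\<close>, on which \<open>w = 2 b + x\<close>,
  foliate the convex region \<open>x, y \<ge> 0\<close>, \<open>w \<le> 1\<close>, and \<open>w\<close> is also the Jacobian \<open>dy/db\<close>. Their direction
  field has a square-root singularity at the origin, yet a polynomial in \<open>x\<close> and \<open>w\<^sup>2\<close> is smooth.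
  For \<open>\<psi> = x\<^sup>2 (1 - w\<^sup>2)\<^sup>2 w\<close> the function \<open>\<Phi> = \<psi>\<^sub>x - \<psi>\<^sub>w\<close> is nonnegative, vanishes at both ends of every
  line, and its derivative along the line is \<open>w F\<close> with \<open>F = (\<psi>\<^sub>x\<^sub>x - \<psi>\<^sub>w\<^sub>w) / w\<close>; as \<open>\<psi>\<close> is odd in \<open>w\<close>, \<open>F\<close> is a
  polynomial in \<open>x\<close> and \<open>y\<close>. So the densities \<open>8 + F\<close> and \<open>8\<close> are transported into each other along
  the lines, with transport density \<open>sqrt (1 + b\<^sup>2) \<Phi> / w\<close> (\<open>F\<close> is \<open>excess\<close>, \<open>\<Phi>\<close> is \<open>flux\<close>).
  Near the origin this is \<open>2 x - x\<^sup>2 / w\<close> up to higher order, which is homogeneous of degree 1 under \<open>(x, y) \<mapsto> (h x, h\<^sup>2 y)\<close>; hence the cube of its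
  \<open>y\<close>-derivative has the same positive integral over all boxes \<open>[h, 2 h] \<times> [h\<^sup>2, 2 h\<^sup>2]\<close>.
\<close>

section \<open>An algebra of smooth functions\<close>

text \<open>The rays are the tangents of the parabola y = -x^2/4, touching it at x = -2b. This
  caustic meets the region only at the origin, so the direction field is singular at a single
  boundary point. With b fixed, d/ds acts as d_x + d_w because w = 2b + s. Applied to psi_x - psi_w
  it gives psi_xx - psi_ww, so any psi that is odd in w yields a polynomial excess; the double zeros
  of psi at x = 0 and w = 1 become the simple zeros of the flux at the two ends of a ray. Vanishing
  at the ends only balances mass on each ray. For the product coupling to move all mass forward, the
  excess must also change sign just once along a ray, from plus to minus. Optimality then follows by
  duality with a 1-Lipschitz potential that grows at unit rate along the rays. A weak derivative is
  only known as some L^3 function g. The blow-up is therefore detected by duality: bumps on the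
  boxes, bounded in L^(3/2), pair with sigma to a nonzero limit, whereas their pairings with g tend
  to 0 because the boxes carry a vanishing part of the integral of |g|^3.\<close>

definition flat_exp :: "nat \<Rightarrow> real \<Rightarrow> real" where
  "flat_exp k t = (if t \<le> 0 then 0 else exp (- (1 / t)) / t ^ k)"

lemma flat_exp_tendsto_0: "((\<lambda>t. flat_exp k t) \<longlongrightarrow> 0) (at 0)"
proof -
  have "((\<lambda>t::real. (1 / t) ^ k / exp (1 / t)) \<longlongrightarrow> 0) (at_right 0)"
    using filterlim_compose[OF tendsto_power_div_exp_0 filterlim_inverse_at_top_right]
    by (simp add: inverse_eq_divide)
  moreover have "\<forall>\<^sub>F t in at_right 0. (1 / t) ^ k / exp (1 / t) = flat_exp k t"
    using eventually_at_right_less[of "0::real"]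
    by eventually_elim (simp add: flat_exp_def exp_minus field_simps)
  ultimately have right: "((\<lambda>t. flat_exp k t) \<longlongrightarrow> 0) (at_right 0)"
    by (rule Lim_transform_eventually)
  have "\<forall>\<^sub>F t in at_left (0::real). t < 0"
    by (simp add: eventually_at_filter)
  then have "\<forall>\<^sub>F t in at_left (0::real). flat_exp k t = 0"
    by eventually_elim (simp add: flat_exp_def)
  then have "((\<lambda>t. flat_exp k t) \<longlongrightarrow> 0) (at_left 0)"
    by (rule tendsto_eventually)
  with right show ?thesis
    by (simp add: filterlim_split_at)
qed

text \<open>The powers \<open>t ^ k\<close> in the denominator are there for this formula: the
  family is closed under differentiation up to linear combinations, which a single exp(-1/t) is
  not.\<close>

lemma flat_exp_has_derivative:
  "(flat_exp k has_real_derivative (flat_exp (k + 2) t - real k * flat_exp (k + 1) t)) (at t)"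
proof -
  consider "t < 0" | "t > 0" | "t = 0" by linarith
  then show ?thesis
  proof cases
    case 1
    have "((\<lambda>_. 0) has_real_derivative 0) (at t)" by simp
    moreover have "\<forall>\<^sub>F x in nhds t. x < 0"
      using 1 by (intro eventually_nhds_in_open[of "{..<0}", simplified]) auto
    then have "\<forall>\<^sub>F x in nhds t. flat_exp k x = 0"
      by eventually_elim (simp add: flat_exp_def)
    ultimately have "(flat_exp k has_real_derivative 0) (at t)"
      by (subst DERIV_cong_ev[OF refl _ refl]) auto
    with 1 show ?thesis by (simp add: flat_exp_def)
  next
    case 2
    have *: "((\<lambda>t. exp (- (1 / t)) / t ^ k) has_real_derivative
        (flat_exp (k + 2) t - real k * flat_exp (k + 1) t)) (at t)"
    proof -
      have "((\<lambda>t. exp (- (1 / t)) / t ^ k) has_real_derivative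
          (exp (- (1 / t)) * (1 / t\<^sup>2) * t ^ k - exp (- (1 / t)) * (real k * t ^ (k - 1))) / (t ^ k * t ^ k))
          (at t)"
        using 2 by (auto intro!: derivative_eq_intros simp: power2_eq_square)
      moreover have "(exp (- (1 / t)) * (1 / t\<^sup>2) * t ^ k - exp (- (1 / t)) * (real k * t ^ (k - 1))) / (t ^ k * t ^ k) =
          flat_exp (k + 2) t - real k * flat_exp (k + 1) t"
        using 2 by (cases k) (simp_all add: flat_exp_def divide_simps, simp_all add: algebra_simps power2_eq_square)
      ultimately show ?thesis by simp
    qed
    have "\<forall>\<^sub>F x in nhds t. x > 0"
      using 2 by (intro eventually_nhds_in_open[of "{0<..}", simplified]) auto
    then have "\<forall>\<^sub>F x in nhds t. flat_exp k x = exp (- (1 / x)) / x ^ k"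
      by eventually_elim (simp add: flat_exp_def)
    with * show ?thesis
      by (subst DERIV_cong_ev[OF refl _ refl]) auto
  next
    case 3
    \<comment> \<open>Valid for every \<open>h\<close>, including \<open>h = 0\<close>, where
      division by zero returns 0 and so does \<open>flat_exp\<close>.\<close>
    have "(flat_exp k h - flat_exp k 0) / (h - 0) = flat_exp (k + 1) h" for h
      by (simp add: flat_exp_def)
    then have "((\<lambda>h. (flat_exp k h - flat_exp k 0) / (h - 0)) \<longlongrightarrow> 0) (at 0)"
      using flat_exp_tendsto_0[of "k + 1"] by presburger
    with 3 show ?thesis
      by (simp add: has_field_derivative_iff flat_exp_def)
  qed
qed

lemma continuous_on_flat_exp: "continuous_on A (flat_exp k)"
  by (meson DERIV_isCont continuous_at_imp_continuous_on flat_exp_has_derivative)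

text \<open>Chosen to contain the polynomial densities and the rescaled bumps (hence the affine
  argument of \<open>flat_exp\<close>) and to be stable under partial derivatives, so that
  smoothness of its members reduces to their continuity.\<close>

inductive_set smooth_algebra :: "nat \<Rightarrow> (point \<Rightarrow> real) set" for d :: nat where
  const: "(\<lambda>x. c) \<in> smooth_algebra d"
| coord: "i < d \<Longrightarrow> (\<lambda>x. x i) \<in> smooth_algebra d"
| flat: "i < d \<Longrightarrow> (\<lambda>x. flat_exp k (a * x i + c)) \<in> smooth_algebra d"
| add: "f \<in> smooth_algebra d \<Longrightarrow> g \<in> smooth_algebra d \<Longrightarrow> (\<lambda>x. f x + g x) \<in> smooth_algebra d"
| mult: "f \<in> smooth_algebra d \<Longrightarrow> g \<in> smooth_algebra d \<Longrightarrow> (\<lambda>x. f x * g x) \<in> smooth_algebra d"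

lemma smooth_algebra_diff:
  assumes "f \<in> smooth_algebra d" "g \<in> smooth_algebra d"
  shows "(\<lambda>x. f x - g x) \<in> smooth_algebra d"
proof -
  have "(\<lambda>x. f x + (-1) * g x) \<in> smooth_algebra d"
    by (intro smooth_algebra.add assms smooth_algebra.mult smooth_algebra.const)
  then show ?thesis by simp
qed

lemma smooth_algebra_power:
  assumes "f \<in> smooth_algebra d"
  shows "(\<lambda>x. f x ^ n) \<in> smooth_algebra d"
  by (induction n) (auto intro: smooth_algebra.intros assms)

text \<open>Induction over the generators; the derivative is produced as a member of the algebra so
  that the argument can be iterated along any list of indices.\<close>

lemma smooth_algebra_has_derivative:
  assumes "f \<in> smooth_algebra d"
  shows "\<exists>g\<in>smooth_algebra d. \<forall>x. ((\<lambda>t. f (x(i := t))) has_real_derivative g x) (at (x i))"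
  using assms
proof induction
  case (const c)
  show ?case by (rule bexI[of _ "\<lambda>_. 0"]) (auto intro: smooth_algebra.const)
next
  case (coord j)
  show ?case
    by (rule bexI[of _ "\<lambda>_. if i = j then 1 else 0"]) (auto intro: smooth_algebra.const)
next
  case (flat j k a c)
  define g where "g = (\<lambda>x::point. (if i = j then a else 0) *
      (flat_exp (k + 2) (a * x j + c) - real k * flat_exp (k + 1) (a * x j + c)))"
  have "g \<in> smooth_algebra d"
    unfolding g_def
    by (intro smooth_algebra.mult smooth_algebra.const smooth_algebra_diff smooth_algebra.flat flat)
  moreover have "((\<lambda>t. flat_exp k (a * (x(i := t)) j + c)) has_real_derivative g x) (at (x i))" for x
  proof (cases "i = j")
    case True
    have "((\<lambda>t. flat_exp k (a * t + c)) has_real_derivative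
        (flat_exp (k + 2) (a * x i + c) - real k * flat_exp (k + 1) (a * x i + c)) * a) (at (x i))"
      by (rule DERIV_chain2[OF flat_exp_has_derivative]) (auto intro!: derivative_eq_intros)
    with True show ?thesis by (simp add: g_def mult.commute)
  qed (simp add: g_def)
  ultimately show ?case by blast
next
  case (add f1 f2)
  then obtain g1 g2 where g: "g1 \<in> smooth_algebra d" "g2 \<in> smooth_algebra d"
    "\<And>x. ((\<lambda>t. f1 (x(i := t))) has_real_derivative g1 x) (at (x i))"
    "\<And>x. ((\<lambda>t. f2 (x(i := t))) has_real_derivative g2 x) (at (x i))" by blast
  show ?case
    by (rule bexI[of _ "\<lambda>x. g1 x + g2 x"]) (intro allI DERIV_add g smooth_algebra.add)+
next
  case (mult f1 f2)
  then obtain g1 g2 where g: "g1 \<in> smooth_algebra d" "g2 \<in> smooth_algebra d"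
    "\<And>x. ((\<lambda>t. f1 (x(i := t))) has_real_derivative g1 x) (at (x i))"
    "\<And>x. ((\<lambda>t. f2 (x(i := t))) has_real_derivative g2 x) (at (x i))" by blast
  have "((\<lambda>t. f1 (x(i := t)) * f2 (x(i := t))) has_real_derivative g1 x * f2 x + g2 x * f1 x)
      (at (x i))" for x
    using DERIV_mult[OF g(3)[of x] g(4)[of x]] by simp
  moreover have "(\<lambda>x. g1 x * f2 x + g2 x * f1 x) \<in> smooth_algebra d"
    by (intro smooth_algebra.add smooth_algebra.mult g mult)
  ultimately show ?case by (intro bexI allI)
qed

lemma partial_deriv_smooth_algebra:
  assumes "f \<in> smooth_algebra d"
  shows "partial_deriv i f \<in> smooth_algebra d"
    and "((\<lambda>t. f (x(i := t))) has_real_derivative partial_deriv i f x) (at (x i))"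
proof -
  obtain g where g: "g \<in> smooth_algebra d"
    "\<And>x. ((\<lambda>t. f (x(i := t))) has_real_derivative g x) (at (x i))"
    using smooth_algebra_has_derivative[OF assms] by blast
  have "partial_deriv i f = g"
    using g(2) by (auto simp: partial_deriv_def fun_eq_iff intro!: DERIV_imp_deriv)
  with g show "partial_deriv i f \<in> smooth_algebra d"
    "((\<lambda>t. f (x(i := t))) has_real_derivative partial_deriv i f x) (at (x i))" by auto
qed

lemma iter_partial_smooth_algebra:
  "f \<in> smooth_algebra d \<Longrightarrow> iter_partial is f \<in> smooth_algebra d"
  by (induction "is") (auto intro: partial_deriv_smooth_algebra)

lemma smooth_algebra_continuous:
  "f \<in> smooth_algebra d \<Longrightarrow> continuous_in d S f"
proof (induction rule: smooth_algebra.induct)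
  case (coord i)
  then show ?case
    unfolding continuous_in_def
    by (intro continuous_map_from_subtopology continuous_map_product_projection) auto
next
  case (flat i k a c)
  have "continuous_map (Rtop d) euclideanreal (\<lambda>x. a * x i + c)"
    using flat by (intro continuous_intros continuous_map_product_projection) auto
  moreover have "continuous_map euclideanreal euclideanreal (flat_exp k)"
    by (simp add: continuous_on_flat_exp)
  ultimately have "continuous_map (Rtop d) euclideanreal (flat_exp k \<circ> (\<lambda>x. a * x i + c))"
    by (rule continuous_map_compose)
  then show ?case
    unfolding continuous_in_def
    by (intro continuous_map_from_subtopology) (simp add: o_def)
qed (auto simp: continuous_in_def intro!: continuous_intros)

lemma smooth_algebra_smooth_in:
  assumes "f \<in> smooth_algebra d"
  shows "smooth_in d U f"
  unfolding smooth_in_def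
  using iter_partial_smooth_algebra[OF assms] partial_deriv_smooth_algebra(2)
  unfolding field_differentiable_def by (blast intro: smooth_algebra_continuous)

lemma smooth_algebra_smooth_up_to_boundary:
  assumes "f \<in> smooth_algebra d"
  shows "smooth_up_to_boundary d S f"
  unfolding smooth_up_to_boundary_def
  using iter_partial_smooth_algebra[OF assms] assms
  by (blast intro: smooth_algebra_continuous smooth_algebra_smooth_in)

section \<open>Rays\<close>

text \<open>This is (psi_xx - psi_ww) / w with w^2 replaced by x^2 + 4y: here psi_xx = 2 w (1 -
  w^2)^2 and psi_ww = x^2 (20 w^3 - 12 w).\<close>

definition excess :: "real \<Rightarrow> real \<Rightarrow> real" where
  "excess x y = 2 * (1 - (x\<^sup>2 + 4 * y))\<^sup>2 + 4 * x\<^sup>2 * (3 - 5 * (x\<^sup>2 + 4 * y))"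

definition ray :: "real \<Rightarrow> real \<Rightarrow> real \<times> real" where
  "ray b s = (s, b * s + b\<^sup>2)"

text \<open>The larger root b of b^2 + x b - y = 0, that is, the parameter of the ray through the
  point.\<close>

definition slope :: "real \<Rightarrow> real \<Rightarrow> real" where
  "slope x y = (sqrt (x\<^sup>2 + 4 * y) - x) / 2"

text \<open>psi_x - psi_w at x = s and w = 2b + s, with the common factor s (1 - w^2) pulled out to
  display both zeros.\<close>

definition flux :: "real \<Rightarrow> real \<Rightarrow> real" where
  "flux b s = s * (1 - (2 * b + s)\<^sup>2) *
     ((1 - (2 * b + s)\<^sup>2) * (2 * (2 * b + s) - s) + 4 * s * (2 * b + s)\<^sup>2)"

definition density_fun :: "real \<Rightarrow> real \<Rightarrow> real" where
  "density_fun x y = sqrt (1 + (slope x y)\<^sup>2) * flux (slope x y) x / sqrt (x\<^sup>2 + 4 * y)"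

definition region :: "(real \<times> real) set" where
  "region = {(x, y). 0 \<le> x \<and> 0 \<le> y \<and> x\<^sup>2 + 4 * y \<le> 1}"

definition ray_domain :: "(real \<times> real) set" where
  "ray_domain = {(b, s). 0 \<le> b \<and> 0 \<le> s \<and> 2 * b + s \<le> 1}"

lemma ray_discriminant: "s\<^sup>2 + 4 * (b * s + b\<^sup>2) = (2 * b + s)\<^sup>2" for b s :: real
  by (simp add: power2_eq_square algebra_simps)

lemma sqrt_ray: "0 \<le> b \<Longrightarrow> 0 \<le> s \<Longrightarrow> sqrt (s\<^sup>2 + 4 * (b * s + b\<^sup>2)) = 2 * b + s" for b s :: real
  unfolding ray_discriminant by simp

lemma slope_ray: "0 \<le> b \<Longrightarrow> 0 \<le> s \<Longrightarrow> slope s (b * s + b\<^sup>2) = b"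
  unfolding slope_def by (simp only: sqrt_ray) simp

lemma ray_in_region:
  assumes "(b, s) \<in> ray_domain"
  shows "ray b s \<in> region"
proof -
  have "(2 * b + s)\<^sup>2 \<le> 1"
    using assms by (auto simp: ray_domain_def abs_square_le_1)
  with assms show ?thesis
    by (simp add: region_def ray_def ray_domain_def flip: ray_discriminant)
qed

lemma excess_ray:
  "excess s (b * s + b\<^sup>2) = 2 * (1 - (2 * b + s)\<^sup>2)\<^sup>2 + 4 * s\<^sup>2 * (3 - 5 * (2 * b + s)\<^sup>2)"
  by (simp only: excess_def ray_discriminant)

text \<open>Along a ray d/ds is d_x + d_w, and (d_x + d_w)(psi_x - psi_w) = psi_xx - psi_ww.\<close>

lemma flux_has_derivative:
  "(flux b has_real_derivative excess s (b * s + b\<^sup>2) * (2 * b + s)) (at s)"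
  unfolding excess_ray flux_def
  by (auto intro!: derivative_eq_intros) algebra

lemma flux_0 [simp]: "flux b 0 = 0" by (simp add: flux_def)

lemma flux_end [simp]: "flux b (1 - 2 * b) = 0" by (simp add: flux_def)

lemma flux_nonneg: "(b, s) \<in> ray_domain \<Longrightarrow> 0 \<le> flux b s"
  by (auto simp: flux_def ray_domain_def abs_square_le_1 intro!: mult_nonneg_nonneg add_nonneg_nonneg)

lemma flux_pos:
  assumes "0 \<le> b" "0 < s" "2 * b + s < 1"
  shows "0 < flux b s"
proof -
  have "(2 * b + s)\<^sup>2 < 1"
    using assms by (simp add: abs_square_less_1)
  with assms show ?thesis
    unfolding flux_def by (intro mult_pos_pos add_pos_nonneg) auto
qed

text \<open>The number 3/5 is the zero of 3 - 5 w^2. Beyond it (1 - w^2)^2 decreases, while s^2 (5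
  w^2 - 3) is a product of nonnegative increasing factors, so the excess decreases along the rest of
  the ray.\<close>

lemma excess_le_end:
  assumes b: "0 \<le> b" and st: "0 \<le> s" "s \<le> t" "2 * b + t \<le> 1" and w: "3 / 5 \<le> (2 * b + s)\<^sup>2"
  shows "excess t (b * t + b\<^sup>2) \<le> excess s (b * s + b\<^sup>2)"
proof -
  have 1: "(2 * b + s)\<^sup>2 \<le> (2 * b + t)\<^sup>2" "(2 * b + t)\<^sup>2 \<le> 1"
    using assms by (auto simp: abs_square_le_1 intro!: power_mono)
  then have "(1 - (2 * b + t)\<^sup>2)\<^sup>2 \<le> (1 - (2 * b + s)\<^sup>2)\<^sup>2"
    by (intro power_mono) auto
  moreover have "s\<^sup>2 * (5 * (2 * b + s)\<^sup>2 - 3) \<le> t\<^sup>2 * (5 * (2 * b + t)\<^sup>2 - 3)"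
    using 1 st w by (intro mult_mono power_mono) auto
  ultimately show ?thesis
    unfolding excess_ray by (simp add: algebra_simps)
qed

text \<open>The excess is positive while w^2 < 3/5, decreasing afterwards, and negative at w = 1.
  Hence surplus precedes deficit on every nondegenerate ray.\<close>

lemma excess_sign_change:
  assumes b: "0 \<le> b" "b < 1 / 2"
  obtains s0 where "0 < s0" "s0 < 1 - 2 * b"
    "\<And>s. 0 \<le> s \<Longrightarrow> s \<le> s0 \<Longrightarrow> 0 \<le> excess s (b * s + b\<^sup>2)"
    "\<And>s. s0 \<le> s \<Longrightarrow> s \<le> 1 - 2 * b \<Longrightarrow> excess s (b * s + b\<^sup>2) \<le> 0"
proof -
  define E where "E s = excess s (b * s + b\<^sup>2)" for s
  have E: "E s = 2 * (1 - (2 * b + s)\<^sup>2)\<^sup>2 + 4 * s\<^sup>2 * (3 - 5 * (2 * b + s)\<^sup>2)" for s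
    unfolding E_def excess_ray ..
  have small: "0 < E s" if "0 \<le> s" "s \<le> 1 - 2 * b" "(2 * b + s)\<^sup>2 < 3 / 5" for s
    unfolding E using that by (intro add_pos_nonneg) auto
  have "(2 * b)\<^sup>2 < 1"
    using b by (subst abs_square_less_1) auto
  then have E0: "0 < E 0" by (simp add: E)
  have E1: "E (1 - 2 * b) < 0" using b by (simp add: E)
  have "continuous_on {0..1 - 2 * b} E"
    unfolding E by (intro continuous_intros)
  then obtain s0 where s0: "0 \<le> s0" "s0 \<le> 1 - 2 * b" "E s0 = 0"
    using IVT2'[of E "1 - 2 * b" 0 0] E0 E1 b by auto
  \<comment> \<open>A zero cannot lie in the range of \<open>small\<close>, so monotonicity is
    available both from \<open>s0\<close> on and just before it.\<close>
  have w0: "3 / 5 \<le> (2 * b + s0)\<^sup>2"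
    using small[of s0] s0 by force
  show ?thesis
  proof (rule that[of s0])
    show "0 < s0" "s0 < 1 - 2 * b" using s0 E0 E1 by (metis order_less_le less_irrefl)+
    show "0 \<le> excess s (b * s + b\<^sup>2)" if "0 \<le> s" "s \<le> s0" for s
    proof (cases "(2 * b + s)\<^sup>2 < 3 / 5")
      case True
      with small[of s] that s0 show ?thesis by (simp add: E_def)
    next
      case False
      with excess_le_end[of b s s0] that s0 b show ?thesis by (simp add: E_def)
    qed
    show "excess s (b * s + b\<^sup>2) \<le> 0" if "s0 \<le> s" "s \<le> 1 - 2 * b" for s
      using excess_le_end[of b s0 s] that s0 b w0 by (simp add: E_def)
  qed
qed

section \<open>Mass balance on a single ray\<close>

definition ray_source :: "real \<Rightarrow> real \<Rightarrow> real" where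
  "ray_source b s = (if (b, s) \<in> ray_domain then max 0 (excess s (b * s + b\<^sup>2)) * (2 * b + s) else 0)"

definition ray_target :: "real \<Rightarrow> real \<Rightarrow> real" where
  "ray_target b s = (if (b, s) \<in> ray_domain then max 0 (- excess s (b * s + b\<^sup>2)) * (2 * b + s) else 0)"

definition ray_mass :: "real \<Rightarrow> ennreal" where
  "ray_mass b = (\<integral>\<^sup>+s. ennreal (ray_source b s) \<partial>lborel)"

text \<open>The last identity is the amount of mass that the normalised product coupling carries
  across \<open>z\<close>: mass starting before \<open>z\<close> times mass ending after
  \<open>z\<close>, over the total. One of the two factors is always the full mass
  \<open>flux b s0\<close>, and the other is \<open>flux b z\<close> by the fundamental theorem of
  calculus.\<close>

lemma ray_rearrangement:
  assumes b: "0 \<le> b" "b < 1 / 2"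
  obtains s0 where
    "\<And>s. ray_source b s \<noteq> 0 \<Longrightarrow> s \<le> s0" "\<And>t. ray_target b t \<noteq> 0 \<Longrightarrow> s0 \<le> t"
    "ray_mass b \<noteq> 0" "ray_mass b \<noteq> top" "(\<integral>\<^sup>+t. ennreal (ray_target b t) \<partial>lborel) = ray_mass b"
    "\<And>z. 0 \<le> z \<Longrightarrow> z \<le> 1 - 2 * b \<Longrightarrow>
       (\<integral>\<^sup>+s. ennreal (ray_source b s) * indicator {..z} s \<partial>lborel) * (\<integral>\<^sup>+t. ennreal (ray_target b t) * indicator {z..} t \<partial>lborel)
         / ray_mass b = flux b z"
proof -
  obtain s0 where s0: "0 < s0" "s0 < 1 - 2 * b"
    and pos: "\<And>s. 0 \<le> s \<Longrightarrow> s \<le> s0 \<Longrightarrow> 0 \<le> excess s (b * s + b\<^sup>2)"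
    and neg: "\<And>s. s0 \<le> s \<Longrightarrow> s \<le> 1 - 2 * b \<Longrightarrow> excess s (b * s + b\<^sup>2) \<le> 0"
    using excess_sign_change[OF b] by metis
  define e where "e s = excess s (b * s + b\<^sup>2) * (2 * b + s)" for s
  have [measurable]: "e \<in> borel_measurable borel"
    unfolding e_def excess_def by measurable
  have der: "(flux b has_real_derivative e s) (at s)" for s
    unfolding e_def by (rule flux_has_derivative)
  have epos: "0 \<le> e s" if "0 \<le> s" "s \<le> s0" for s
    unfolding e_def using pos[OF that] that b by simp
  have eneg: "e s \<le> 0" if "s0 \<le> s" "s \<le> 1 - 2 * b" for s
    unfolding e_def using neg[OF that] that b s0 by (intro mult_nonpos_nonneg) auto
  \<comment> \<open>Nothing is emitted beyond \<open>s0\<close>, hence the minimum; up to there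
    \<open>flux b\<close> is an antiderivative starting at 0.\<close>
  have ray_source: "(\<integral>\<^sup>+s. ennreal (ray_source b s) * indicator {..z} s \<partial>lborel) = flux b (min z s0)"
    if "0 \<le> z" "z \<le> 1 - 2 * b" for z
  proof -
    have "(\<integral>\<^sup>+s. ennreal (ray_source b s) * indicator {..z} s \<partial>lborel) =
        (\<integral>\<^sup>+s. ennreal (e s) * indicator {0..min z s0} s \<partial>lborel)"
    proof (intro nn_integral_cong)
      fix s
      have "ray_source b s = e s" if "s \<le> s0" "0 \<le> s"
        using that pos[of s] s0 b by (auto simp: ray_source_def e_def ray_domain_def)
      moreover have "ray_source b s = 0" if "s > s0 \<or> s < 0"
        using that neg[of s] s0 b by (auto simp: ray_source_def e_def ray_domain_def max_def)
      ultimately show "ennreal (ray_source b s) * indicator {..z} s = ennreal (e s) * indicator {0..min z s0} s"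
        by (auto simp: indicator_def not_le)
    qed
    also have "\<dots> = flux b (min z s0) - flux b 0"
      using that s0 by (intro nn_integral_FTC_Icc) (auto intro!: has_field_derivative_at_within[OF der] epos)
    finally show ?thesis by simp
  qed
  \<comment> \<open>Here \<open>- flux b\<close> is the antiderivative, and its value at the far end
    of the ray is 0.\<close>
  have ray_target: "(\<integral>\<^sup>+t. ennreal (ray_target b t) * indicator {z..} t \<partial>lborel) = flux b (max z s0)"
    if "0 \<le> z" "z \<le> 1 - 2 * b" for z
  proof -
    have "(\<integral>\<^sup>+t. ennreal (ray_target b t) * indicator {z..} t \<partial>lborel) =
        (\<integral>\<^sup>+t. ennreal (- e t) * indicator {max z s0..1 - 2 * b} t \<partial>lborel)"
    proof (intro nn_integral_cong)
      fix t
      have "ray_target b t = - e t" if "s0 \<le> t" "t \<le> 1 - 2 * b"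
        using that neg[of t] s0 b by (auto simp: ray_target_def e_def ray_domain_def)
      moreover have "ray_target b t = 0" if "t < s0 \<or> t > 1 - 2 * b"
        using that pos[of t] s0 b by (auto simp: ray_target_def e_def ray_domain_def max_def)
      ultimately show "ennreal (ray_target b t) * indicator {z..} t = ennreal (- e t) * indicator {max z s0..1 - 2 * b} t"
        by (auto simp: indicator_def not_le)
    qed
    also have "\<dots> = (- flux b (1 - 2 * b)) - (- flux b (max z s0))"
      using that s0
      by (intro nn_integral_FTC_Icc)
        (auto intro!: has_field_derivative_at_within[OF der] DERIV_minus eneg)
    finally show ?thesis by simp
  qed
  have mass: "ray_mass b = flux b s0"
  proof -
    have "ray_mass b = (\<integral>\<^sup>+s. ennreal (ray_source b s) * indicator {..1 - 2 * b} s \<partial>lborel)"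
      unfolding ray_mass_def by (intro nn_integral_cong) (auto simp: ray_source_def ray_domain_def indicator_def)
    with ray_source[of "1 - 2 * b"] s0 b show ?thesis by simp
  qed
  have dem: "(\<integral>\<^sup>+t. ennreal (ray_target b t) \<partial>lborel) = flux b s0"
  proof -
    have "(\<integral>\<^sup>+t. ennreal (ray_target b t) \<partial>lborel) = (\<integral>\<^sup>+t. ennreal (ray_target b t) * indicator {0..} t \<partial>lborel)"
      by (intro nn_integral_cong) (auto simp: ray_target_def ray_domain_def indicator_def)
    with ray_target[of 0] s0 b show ?thesis by simp
  qed
  have fpos: "0 < flux b s0"
    using flux_pos[of b s0] s0 b by auto
  show ?thesis
  proof (rule that[of s0])
    show "s \<le> s0" if "ray_source b s \<noteq> 0" for s
      using that neg[of s] by (rule_tac ccontr) (auto simp: ray_source_def ray_domain_def max_def split: if_splits)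
    show "s0 \<le> t" if "ray_target b t \<noteq> 0" for t
      using that pos[of t] by (rule_tac ccontr) (auto simp: ray_target_def ray_domain_def max_def split: if_splits)
    show "ray_mass b \<noteq> 0" "ray_mass b \<noteq> top"
      using fpos by (auto simp: mass)
    show "(\<integral>\<^sup>+t. ennreal (ray_target b t) \<partial>lborel) = ray_mass b"
      by (simp add: mass dem)
    fix z assume z: "0 \<le> z" "z \<le> 1 - 2 * b"
    have fz: "0 \<le> flux b z" using z b by (intro flux_nonneg) (auto simp: ray_domain_def)
    \<comment> \<open>Of \<open>min z s0\<close> and \<open>max z s0\<close> one is
      \<open>s0\<close> and the other \<open>z\<close>, so \<open>flux b s0\<close> cancels.\<close>
    have "ennreal (flux b (min z s0)) * flux b (max z s0) / flux b s0 = flux b z"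
    proof (cases "z \<le> s0")
      case True
      with fpos fz show ?thesis
        by (simp add: min_def max_def divide_ennreal flip: ennreal_mult)
    next
      case False
      with fpos fz show ?thesis
        by (simp add: min_def max_def divide_ennreal flip: ennreal_mult)
    qed
    then show "(\<integral>\<^sup>+s. ennreal (ray_source b s) * indicator {..z} s \<partial>lborel) *
        (\<integral>\<^sup>+t. ennreal (ray_target b t) * indicator {z..} t \<partial>lborel) / ray_mass b = flux b z"
      by (simp only: ray_source[OF z] ray_target[OF z] mass)
  qed
qed

section \<open>The Kantorovich potential\<close>

text \<open>The length of the tangent from its contact point at x = -2b, which is sqrt(1 + b^2) (x +
  2b), minus the arc length b sqrt(1 + b^2) + arsinh b of the parabola y = -x^2/4 from its vertex to
  that point. The level curves are involutes of the caustic, orthogonal to the rays.\<close>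

definition potential :: "real \<Rightarrow> real \<Rightarrow> real" where
  "potential x y =
     sqrt (1 + (slope x y)\<^sup>2) * (x + slope x y) - arsinh (slope x y)"

text \<open>The slope is constant on a ray, so only the linear term changes. This is the equality
  case of the Lipschitz bound and makes transport along rays optimal.\<close>

lemma potential_ray_diff:
  assumes "0 \<le> b" "0 \<le> s" "0 \<le> t"
  shows "potential t (b * t + b\<^sup>2) - potential s (b * s + b\<^sup>2) = sqrt (1 + b\<^sup>2) * (t - s)"
  using assms by (simp add: potential_def slope_ray algebra_simps)

text \<open>The gradient of the potential is the unit vector \<open>(1, b) / sqrt (1 + b\<^sup>2)\<close> with \<open>b = slope x y\<close>.\<close>

lemma potential_segment_derivative:
  fixes x0 y0 dx dy t :: real
  defines "x \<equiv> x0 + t * dx" and "y \<equiv> y0 + t * dy"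
  assumes pos: "0 < x\<^sup>2 + 4 * y"
  shows "((\<lambda>t. potential (x0 + t * dx) (y0 + t * dy)) has_real_derivative
    (dx + slope x y * dy) / sqrt (1 + (slope x y)\<^sup>2)) (at t)"
proof -
  define W where "W = sqrt (x\<^sup>2 + 4 * y)"
  define b where "b = slope x y"
  define W' where "W' = (x * dx + 2 * dy) / W"
  define b' where "b' = (W' - dx) / 2"
  define R where "R = sqrt (1 + b\<^sup>2)"
  have W: "0 < W" "W\<^sup>2 = x\<^sup>2 + 4 * y" using pos by (auto simp: W_def)
  have b: "W = 2 * b + x" by (simp add: b_def slope_def W_def field_simps)
  have R: "0 < R" "R\<^sup>2 = 1 + b\<^sup>2"
    by (auto simp: R_def add_pos_nonneg)
  have dW: "((\<lambda>t. sqrt ((x0 + t * dx)\<^sup>2 + 4 * (y0 + t * dy))) has_real_derivative W') (at t)"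
  proof -
    have "((\<lambda>t. (x0 + t * dx)\<^sup>2 + 4 * (y0 + t * dy)) has_real_derivative 2 * x * dx + 4 * dy) (at t)"
      unfolding x_def by (auto intro!: derivative_eq_intros)
    from DERIV_chain2[OF DERIV_real_sqrt[OF pos[unfolded x_def y_def]] this]
    have "((\<lambda>t. sqrt ((x0 + t * dx)\<^sup>2 + 4 * (y0 + t * dy))) has_real_derivative
        inverse W / 2 * (2 * x * dx + 4 * dy)) (at t)"
      by (simp only: W_def x_def y_def)
    moreover have "inverse W / 2 * (2 * x * dx + 4 * dy) = W'"
      using W(1) by (simp add: W'_def field_simps)
    ultimately show ?thesis by simp
  qed
  have db: "((\<lambda>t. slope (x0 + t * dx) (y0 + t * dy)) has_real_derivative b') (at t)"
    unfolding slope_def b'_def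
    by (rule DERIV_cdivide[OF DERIV_diff[OF dW]]) (auto intro!: derivative_eq_intros)
  have beq: "slope (x0 + t * dx) (y0 + t * dy) = b" by (simp add: b_def x_def y_def)
  have "((\<lambda>t. 1 + (slope (x0 + t * dx) (y0 + t * dy))\<^sup>2) has_real_derivative 2 * b * b') (at t)"
    by (auto intro!: derivative_eq_intros db simp: beq)
  from DERIV_chain2[OF DERIV_real_sqrt this]
  have dR: "((\<lambda>t. sqrt (1 + (slope (x0 + t * dx) (y0 + t * dy))\<^sup>2)) has_real_derivative b * b' / R) (at t)"
    unfolding beq by (simp add: R_def add_pos_nonneg field_simps)
  have da: "((\<lambda>t. arsinh (slope (x0 + t * dx) (y0 + t * dy))) has_real_derivative b' / R) (at t)"
    using DERIV_chain2[OF arsinh_real_has_field_derivative db]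
    unfolding beq by (simp add: R_def add.commute)
  have "((\<lambda>t. potential (x0 + t * dx) (y0 + t * dy)) has_real_derivative
      (b * b' / R * (x + b) + (dx + b') * R - b' / R)) (at t)"
    unfolding potential_def
    by (rule derivative_eq_intros dR da db refl | simp add: beq x_def R_def)+
  moreover have "b * b' / R * (x + b) + (dx + b') * R - b' / R = (dx + b * dy) / R"
  proof -
    have "W * W' = x * dx + 2 * dy" using W by (simp add: W'_def)
    moreover have "2 * b' = W' - dx" by (simp add: b'_def)
    ultimately have "2 * (W * b') = x * dx + 2 * dy - W * dx" by algebra
    \<comment> \<open>This is y = b x + b^2 differentiated along the segment, with x + 2b =
      W.\<close>
    then have Wb': "W * b' = dy - b * dx" by (simp add: b algebra_simps)
    have "(b * b' / R * (x + b) + (dx + b') * R - b' / R) * R = b * b' * (x + b) + (dx + b') * R\<^sup>2 - b'"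
      using R(1) by (simp add: field_simps power2_eq_square)
    also have "\<dots> = b * (W * b') + dx * (1 + b\<^sup>2)"
      unfolding R b by (simp add: algebra_simps power2_eq_square)
    also have "\<dots> = dx + b * dy"
      unfolding Wb' by (simp add: algebra_simps power2_eq_square)
    finally show ?thesis using R(1) by (simp add: field_simps)
  qed
  ultimately show ?thesis by (simp add: b_def R_def)
qed

text \<open>Mean value theorem along the segment, then Cauchy-Schwarz against the unit
  gradient.\<close>

lemma potential_lipschitz:
  assumes "(x0, y0) \<in> region" "(x1, y1) \<in> region"
  shows "potential x1 y1 - potential x0 y0 \<le> sqrt ((x1 - x0)\<^sup>2 + (y1 - y0)\<^sup>2)"
proof (cases "x0 = x1 \<and> y0 = y1")
  case False
  define f where "f t = potential (x0 + t * (x1 - x0)) (y0 + t * (y1 - y0))" for t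
  note nonneg = assms[unfolded region_def, simplified]
  \<comment> \<open>The gradient formula fails only where x^2 + 4y = 0, in the quadrant only at the
    origin; an interior point of a segment with distinct endpoints in the quadrant is never the
    origin.\<close>
  have pos: "0 < (x0 + t * (x1 - x0))\<^sup>2 + 4 * (y0 + t * (y1 - y0))" if t: "0 < t" "t < 1" for t
  proof -
    have x: "x0 + t * (x1 - x0) = (1 - t) * x0 + t * x1" and y: "y0 + t * (y1 - y0) = (1 - t) * y0 + t * y1"
      by (auto simp: algebra_simps)
    consider "x0 > 0 \<or> x1 > 0" | "y0 > 0 \<or> y1 > 0" using False nonneg by force
    then show ?thesis
    proof cases
      case 1
      then have "0 < (1 - t) * x0 + t * x1"
        using t nonneg by (auto intro: add_pos_nonneg add_nonneg_pos)
      with t nonneg show ?thesis unfolding x y by (intro add_pos_nonneg) auto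
    next
      case 2
      then have "0 < (1 - t) * y0 + t * y1"
        using t nonneg by (auto intro: add_pos_nonneg add_nonneg_pos)
      with t nonneg show ?thesis unfolding x y by (intro add_nonneg_pos) auto
    qed
  qed
  note der = potential_segment_derivative[OF pos]
  have "continuous_on {0..1} f"
    unfolding f_def potential_def slope_def by (intro continuous_intros) auto
  moreover have "f differentiable (at t)" if "0 < t" "t < 1" for t
    using der[OF that] unfolding f_def real_differentiable_def by blast
  ultimately obtain l t where t: "0 < t" "t < 1" and l: "DERIV f t :> l" "f 1 - f 0 = (1 - 0) * l"
    using MVT[of 0 1 f] by auto
  define b where "b = slope (x0 + t * (x1 - x0)) (y0 + t * (y1 - y0))"
  have "l = ((x1 - x0) + b * (y1 - y0)) / sqrt (1 + b\<^sup>2)"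
    using DERIV_unique[OF l(1) der[OF t, folded f_def]] by (simp add: b_def)
  moreover have "(x1 - x0) + b * (y1 - y0) \<le> sqrt ((x1 - x0)\<^sup>2 + (y1 - y0)\<^sup>2) * sqrt (1 + b\<^sup>2)"
  proof -
    have "((x1 - x0) + b * (y1 - y0))\<^sup>2 \<le> ((x1 - x0)\<^sup>2 + (y1 - y0)\<^sup>2) * (1 + b\<^sup>2)"
      \<comment> \<open>By the Lagrange identity this square is exactly the defect in the
        Cauchy-Schwarz inequality.\<close>
      using zero_le_power2[of "b * (x1 - x0) - (y1 - y0)"]
      by (simp add: power2_eq_square algebra_simps)
    then show ?thesis
      by (metis real_le_rsqrt real_sqrt_mult)
  qed
  ultimately have "l \<le> sqrt ((x1 - x0)\<^sup>2 + (y1 - y0)\<^sup>2)"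
    by (simp add: divide_le_eq add_pos_nonneg)
  with l(2) show ?thesis by (simp add: f_def)
qed simp

section \<open>The plane as a space of functions on two indices\<close>

definition pt :: "real \<Rightarrow> real \<Rightarrow> point" where
  "pt a b = (\<lambda>i\<in>{..<2}. if i = 0 then a else b)"

lemma pt_simps [simp]: "pt a b 0 = a" "pt a b (Suc 0) = b" "pt a b 1 = b"
  by (auto simp: pt_def)

lemma pt_inject [simp]: "pt a b = pt c d \<longleftrightarrow> a = c \<and> b = d"
  by (metis pt_simps(1,2))

lemma pt_in_space [simp]: "pt a b \<in> {..<2} \<rightarrow>\<^sub>E UNIV"
  by (auto simp: pt_def)

lemma lessThan_2: "{..<2} = {0, Suc 0}" by auto

lemma pt_in_PiE: "pt a b \<in> Pi\<^sub>E {..<2} A \<longleftrightarrow> a \<in> A 0 \<and> b \<in> A (Suc 0)"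
  using pt_in_space[of a b] by (simp add: PiE_iff lessThan_2)

lemma vimage_pt_PiE:
  "(\<lambda>(a, b). pt a b) -` Pi\<^sub>E {..<2} A \<inter> space (lborel \<Otimes>\<^sub>M lborel) = A 0 \<times> A (Suc 0)"
  by (simp add: set_eq_iff pt_in_PiE lborel_prod)

lemma pt_surj: "x \<in> extensional {..<2} \<Longrightarrow> pt (x 0) (x (Suc 0)) = x"
  by (auto simp: pt_def fun_eq_iff extensional_def less_2_cases_iff)

lemma measurable_pt [measurable]: "(\<lambda>(a, b). pt a b) \<in> measurable (lborel \<Otimes>\<^sub>M lborel) (Rleb 2)"
  unfolding pt_def split_beta by (rule measurable_restrict) simp

lemma measurable_pt' [measurable (raw)]:
  assumes [measurable]: "f \<in> borel_measurable M" "g \<in> borel_measurable M"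
  shows "(\<lambda>x. pt (f x) (g x)) \<in> measurable M (Rleb 2)"
  unfolding pt_def by (rule measurable_restrict) simp

lemma measurable_coord:
  "(\<lambda>x. x 0) \<in> borel_measurable (Rleb 2)" "(\<lambda>x. x (Suc 0)) \<in> borel_measurable (Rleb 2)"
  using measurable_component_singleton[of 0 "{..<2}" "\<lambda>_. lborel"]
    measurable_component_singleton[of "Suc 0" "{..<2}" "\<lambda>_. lborel"] by simp_all

text \<open>The product measure is determined by its values on boxes, and \<open>pt\<close> pulls
  boxes back to boxes. All iterated integration over \<open>Rleb 2\<close> goes through this
  transfer.\<close>

lemma distr_pt: "distr (lborel \<Otimes>\<^sub>M lborel) (Rleb 2) (\<lambda>(a, b). pt a b) = Rleb 2"
proof -
  interpret product_sigma_finite "\<lambda>_::nat. lborel :: real measure"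
    by standard
  show ?thesis
  proof (rule PiM_eqI)
    fix A :: "nat \<Rightarrow> real set" assume A: "\<And>i. i \<in> {..<2} \<Longrightarrow> A i \<in> sets lborel"
    have "emeasure (distr (lborel \<Otimes>\<^sub>M lborel) (Rleb 2) (\<lambda>(a, b). pt a b)) (Pi\<^sub>E {..<2} A) =
        emeasure (lborel \<Otimes>\<^sub>M lborel) ((\<lambda>(a, b). pt a b) -` Pi\<^sub>E {..<2} A \<inter> space (lborel \<Otimes>\<^sub>M lborel))"
      using A by (intro emeasure_distr measurable_pt sets_PiM_I_finite) auto
    also have "(\<lambda>(a, b). pt a b) -` Pi\<^sub>E {..<2} A \<inter> space (lborel \<Otimes>\<^sub>M lborel) = A 0 \<times> A (Suc 0)"
      by (rule vimage_pt_PiE)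
    also have "emeasure (lborel \<Otimes>\<^sub>M lborel) (A 0 \<times> A (Suc 0)) = emeasure lborel (A 0) * emeasure lborel (A (Suc 0))"
      using A by (intro lborel.emeasure_pair_measure_Times) auto
    also have "\<dots> = (\<Prod>i<2. emeasure lborel (A i))"
      by (simp add: lessThan_2)
    finally show "emeasure (distr (lborel \<Otimes>\<^sub>M lborel) (Rleb 2) (\<lambda>(a, b). pt a b)) (Pi\<^sub>E {..<2} A) =
      (\<Prod>i<2. emeasure lborel (A i))" .
  qed auto
qed

lemma continuous_map_pt: "continuous_map euclidean (Rtop 2) (\<lambda>z. pt (fst z) (snd z))"
  by (auto simp: continuous_map_componentwise pt_def less_2_cases_iff intro!: continuous_intros)

section \<open>The domain: compactness, convexity and interior\<close>

definition Omega :: "point set" where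
  "Omega = (\<lambda>z. pt (fst z) (snd z)) ` region"

lemma pt_in_Omega [simp]: "pt a b \<in> Omega \<longleftrightarrow> (a, b) \<in> region"
  by (force simp: Omega_def image_iff)

lemma Omega_iff: "x \<in> Omega \<longleftrightarrow> x \<in> extensional {..<2} \<and> (x 0, x (Suc 0)) \<in> region"
proof
  assume "x \<in> Omega"
  then show "x \<in> extensional {..<2} \<and> (x 0, x (Suc 0)) \<in> region"
    using pt_in_space by (auto simp: Omega_def PiE_def)
next
  assume "x \<in> extensional {..<2} \<and> (x 0, x (Suc 0)) \<in> region"
  then show "x \<in> Omega"
    using pt_in_Omega[of "x 0" "x (Suc 0)"] pt_surj[of x] by simp
qed

lemma Omega_subset_space: "Omega \<subseteq> space (Rleb 2)"
  by (auto simp: Omega_iff space_PiM PiE_def)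

lemma closed_region: "closed region"
proof -
  have eq: "region = {z. 0 \<le> fst z} \<inter> {z. 0 \<le> snd z} \<inter> {z. (fst z)\<^sup>2 + 4 * snd z \<le> 1}"
    by (auto simp: region_def)
  show ?thesis
    unfolding eq by (intro closed_Collect_le closed_Int continuous_intros)
qed

lemma region_bounds: "(x, y) \<in> region \<Longrightarrow> 0 \<le> x \<and> x \<le> 1 \<and> 0 \<le> y \<and> y \<le> 1 / 4"
  using abs_square_le_1[of x] zero_le_power2[of x]
  unfolding region_def mem_Collect_eq prod.case by linarith

lemma compact_region: "compact region"
proof -
  have "region \<subseteq> cbox (0, 0) (1, 1)"
    using region_bounds by (force simp: cbox_Pair_eq)
  with closed_region show ?thesis
    by (meson bounded_cbox bounded_subset compact_eq_bounded_closed)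
qed

lemma region_sets [measurable]: "region \<in> sets borel"
  by (rule borel_closed[OF closed_region])

lemma compactin_Omega: "compactin (Rtop 2) Omega"
  unfolding Omega_def
  by (rule image_compactin[OF _ continuous_map_pt]) (simp add: compactin_euclidean_iff compact_region)

text \<open>The region is cut out of the quadrant by a sublevel set of the convex function x^2 +
  4y.\<close>

lemma region_segment:
  assumes "(x0, y0) \<in> region" "(x1, y1) \<in> region" "0 \<le> t" "t \<le> 1"
  shows "((1 - t) * x0 + t * x1, (1 - t) * y0 + t * y1) \<in> region"
proof -
  have "((1 - t) * x0 + t * x1)\<^sup>2 \<le> (1 - t) * x0\<^sup>2 + t * x1\<^sup>2"
  proof -
    have "(1 - t) * x0\<^sup>2 + t * x1\<^sup>2 - ((1 - t) * x0 + t * x1)\<^sup>2 = (1 - t) * t * (x0 - x1)\<^sup>2"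
      by (simp add: power2_eq_square algebra_simps)
    moreover have "\<dots> \<ge> 0" using assms by simp
    ultimately show ?thesis by linarith
  qed
  moreover have "(1 - t) * (x0\<^sup>2 + 4 * y0) + t * (x1\<^sup>2 + 4 * y1) \<le> (1 - t) * 1 + t * 1"
    using assms by (intro add_mono mult_left_mono) (auto simp: region_def)
  ultimately have "((1 - t) * x0 + t * x1)\<^sup>2 + 4 * ((1 - t) * y0 + t * y1) \<le> 1"
    by (simp add: algebra_simps)
  moreover have "0 \<le> (1 - t) * x0 + t * x1" "0 \<le> (1 - t) * y0 + t * y1"
    using assms by (auto simp: region_def intro!: add_nonneg_nonneg mult_nonneg_nonneg)
  ultimately show ?thesis
    by (simp add: region_def)
qed

lemma segment_point_pt:
  "segment_point 2 x y t = pt ((1 - t) * x 0 + t * y 0) ((1 - t) * x (Suc 0) + t * y (Suc 0))"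
  by (auto simp: segment_point_def pt_def fun_eq_iff less_2_cases_iff)

lemma convex_Omega: "convex_Rd 2 Omega"
  unfolding convex_Rd_def segment_point_pt pt_in_Omega
  by (auto simp: Omega_iff intro!: region_segment)

definition inner_region :: "(real \<times> real) set" where
  "inner_region = {(x, y). 0 < x \<and> 0 < y \<and> x\<^sup>2 + 4 * y < 1}"

text \<open>The strict inequalities describe an open subset of \<open>Omega\<close>. This supplies
  both the nonempty interior and room for the supports of the test functions.\<close>

lemma pt_in_interior:
  assumes "(a, b) \<in> inner_region"
  shows "pt a b \<in> Rtop 2 interior_of Omega"
proof -
  have c: "continuous_map (Rtop 2) euclideanreal (\<lambda>x. x 0)"
    "continuous_map (Rtop 2) euclideanreal (\<lambda>x. x (Suc 0))"
    by (auto intro!: continuous_map_product_projection)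
  then have c3: "continuous_map (Rtop 2) euclideanreal (\<lambda>x. (x 0)\<^sup>2 + 4 * x (Suc 0))"
    by (intro continuous_intros) auto
  define V where "V = {x \<in> topspace (Rtop 2). x 0 \<in> {0<..}} \<inter> {x \<in> topspace (Rtop 2). x (Suc 0) \<in> {0<..}} \<inter>
    {x \<in> topspace (Rtop 2). (x 0)\<^sup>2 + 4 * x (Suc 0) \<in> {..<1}}"
  have "openin (Rtop 2) V"
    unfolding V_def
    by (intro openin_Int openin_continuous_map_preimage[OF c(1)] openin_continuous_map_preimage[OF c(2)]
        openin_continuous_map_preimage[OF c3]) auto
  moreover have "V \<subseteq> Omega"
    by (auto simp: V_def Omega_iff region_def PiE_def)
  moreover have "pt a b \<in> V"
    using assms by (auto simp: V_def inner_region_def)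
  ultimately show ?thesis
    by (auto simp: interior_of_def)
qed

abbreviation ROm :: "point measure" where "ROm \<equiv> restrict_space (Rleb 2) Omega"

lemma space_ROm [simp]: "space ROm = Omega"
  using Omega_subset_space by (auto simp: space_restrict_space)

lemma measurable_coord_pair: "(\<lambda>x. (x 0, x (Suc 0))) \<in> measurable (Rleb 2) borel"
  by (intro borel_measurable_Pair measurable_coord)

lemma Omega_sets [measurable]: "Omega \<in> sets (Rleb 2)"
proof -
  have "Omega = (\<lambda>x. (x 0, x (Suc 0))) -` region \<inter> space (Rleb 2)"
    by (auto simp: Omega_iff space_PiM PiE_def)
  then show ?thesis using measurable_sets[OF measurable_coord_pair region_sets] by simp
qed

lemma measurable_coord_ROm:
  "(\<lambda>x. x 0) \<in> borel_measurable ROm" "(\<lambda>x. x (Suc 0)) \<in> borel_measurable ROm"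
  by (intro measurable_restrict_space1 measurable_coord)+

lemma nn_integral_Rleb:
  assumes [measurable]: "h \<in> borel_measurable (Rleb 2)"
  shows "(\<integral>\<^sup>+x. h x \<partial>Rleb 2) = (\<integral>\<^sup>+x. \<integral>\<^sup>+y. h (pt x y) \<partial>lborel \<partial>lborel)"
proof -
  have "(\<integral>\<^sup>+x. h x \<partial>Rleb 2) = (\<integral>\<^sup>+z. h ((\<lambda>(a, b). pt a b) z) \<partial>(lborel \<Otimes>\<^sub>M lborel))"
    by (subst distr_pt[symmetric]) (rule nn_integral_distr, simp_all)
  also have "\<dots> = (\<integral>\<^sup>+x. \<integral>\<^sup>+y. h (pt x y) \<partial>lborel \<partial>lborel)"
    using lborel.nn_integral_fst[of "\<lambda>z. h (case z of (a, b) \<Rightarrow> pt a b)" lborel]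
    by (simp add: split_beta)
  finally show ?thesis .
qed

section \<open>Change of variables to ray coordinates\<close>

lemma ray_domain_sets [measurable]: "ray_domain \<in> sets borel"
proof -
  have eq: "ray_domain = {z. 0 \<le> fst z} \<inter> {z. 0 \<le> snd z} \<inter> {z. 2 * fst z + snd z \<le> 1}"
    by (auto simp: ray_domain_def)
  have "closed ray_domain"
    unfolding eq by (intro closed_Collect_le closed_Int continuous_intros)
  then show ?thesis by (rule borel_closed)
qed

text \<open>For fixed abscissa s, substitute y = b s + b^2 with dy = (2b + s) db; then exchange the
  order so that the inner integral runs along one ray.\<close>

lemma nn_integral_ROm:
  assumes [measurable]: "h \<in> borel_measurable (borel :: (real \<times> real) measure)"
  shows "(\<integral>\<^sup>+x. h (x 0, x (Suc 0)) \<partial>ROm) =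
    (\<integral>\<^sup>+b. \<integral>\<^sup>+s. h (ray b s) * indicator ray_domain (b, s) * ennreal (2 * b + s) \<partial>lborel \<partial>lborel)"
proof -
  have "(\<integral>\<^sup>+x. h (x 0, x (Suc 0)) \<partial>ROm) =
      (\<integral>\<^sup>+x. h (x 0, x (Suc 0)) * indicator Omega x \<partial>Rleb 2)"
    using Omega_subset_space by (intro nn_integral_restrict_space) (auto simp: Int_absorb2)
  also have "\<dots> = (\<integral>\<^sup>+x. \<integral>\<^sup>+y. h (x, y) * indicator region (x, y) \<partial>lborel \<partial>lborel)"
    by (subst nn_integral_Rleb) (auto simp: indicator_def intro!: nn_integral_cong)
  also have "\<dots> = (\<integral>\<^sup>+s. \<integral>\<^sup>+b. h (ray b s) * indicator ray_domain (b, s) * ennreal (2 * b + s) \<partial>lborel \<partial>lborel)"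
  proof (rule nn_integral_cong)
    fix s :: real
    show "(\<integral>\<^sup>+y. h (s, y) * indicator region (s, y) \<partial>lborel) =
      (\<integral>\<^sup>+b. h (ray b s) * indicator ray_domain (b, s) * ennreal (2 * b + s) \<partial>lborel)"
    proof (cases "0 \<le> s \<and> s < 1")
      \<comment> \<open>The abscissa 1 is treated here because the interval of slopes shrinks to a
        point; only \<open>y = 0\<close>, respectively \<open>b = 0\<close>, remains, a null
        set.\<close>
      case False
      have "AE y in lborel. y \<noteq> (0::real)" by (rule AE_lborel_singleton)
      then have "AE y in lborel. h (s, y) * indicator region (s, y) = 0"
      proof eventually_elim
        case (elim y)
        have "(s, y) \<notin> region"
        proof
          assume y: "(s, y) \<in> region"
          with False region_bounds[OF y] have "s = 1" by linarith
          with y elim show False by (simp add: region_def)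
        qed
        then show ?case by simp
      qed
      then have 1: "(\<integral>\<^sup>+y. h (s, y) * indicator region (s, y) \<partial>lborel) = 0"
        by (subst nn_integral_0_iff_AE) auto
      have "AE b in lborel. b \<noteq> (0::real)" by (rule AE_lborel_singleton)
      then have "AE b in lborel. h (ray b s) * indicator ray_domain (b, s) * ennreal (2 * b + s) = 0"
      proof eventually_elim
        case (elim b)
        with False have "(b, s) \<notin> ray_domain"
          by (auto simp: ray_domain_def)
        then show ?case by simp
      qed
      then have 2: "(\<integral>\<^sup>+b. h (ray b s) * indicator ray_domain (b, s) * ennreal (2 * b + s) \<partial>lborel) = 0"
        by (subst nn_integral_0_iff_AE) (auto simp: ray_def)
      from 1 2 show ?thesis by simp
    next
      case True
      define g where "g b = b * s + b\<^sup>2" for b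
      have g: "g 0 = 0" "g ((1 - s) / 2) = (1 - s\<^sup>2) / 4"
        by (auto simp: g_def power2_eq_square field_simps)
      have "(\<integral>\<^sup>+y. h (s, y) * indicator region (s, y) \<partial>lborel) =
          (\<integral>\<^sup>+y. h (s, y) * indicator {g 0..g ((1 - s) / 2)} y \<partial>lborel)"
        using True unfolding g
        by (intro nn_integral_cong) (auto simp: indicator_def region_def field_simps)
      also have "\<dots> = (\<integral>\<^sup>+b. h (s, g b) * ennreal (2 * b + s) * indicator {0..(1 - s) / 2} b \<partial>lborel)"
        unfolding g_def using True
        by (intro nn_integral_substitution_aux)
          (auto intro!: derivative_eq_intros continuous_intros)
      also have "\<dots> = (\<integral>\<^sup>+b. h (ray b s) * indicator ray_domain (b, s) * ennreal (2 * b + s) \<partial>lborel)"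
        using True
        by (intro nn_integral_cong) (auto simp: indicator_def ray_domain_def ray_def g_def field_simps)
      finally show ?thesis .
    qed
  qed
  also have "\<dots> = (\<integral>\<^sup>+b. \<integral>\<^sup>+s. h (ray b s) * indicator ray_domain (b, s) * ennreal (2 * b + s) \<partial>lborel \<partial>lborel)"
  proof (rule lborel_pair.Fubini')
    show "(\<lambda>(b, s). h (ray b s) * indicator ray_domain (b, s) * ennreal (2 * b + s))
      \<in> borel_measurable (lborel \<Otimes>\<^sub>M lborel)"
      unfolding ray_def by measurable
  qed
  finally show ?thesis .
qed

section \<open>The transport plan\<close>

text \<open>
  Mass common to both densities stays in place; on each ray the excess part of the source is
  coupled to the excess part of the target by the normalised product measure. Both parts are encoded in one
  density on triples \<open>(b, s, t)\<close>: \<open>t \<in> {0..1}\<close> is the target parameter on the ray \<open>b\<close>, while \<open>t \<in> {2..3}\<close>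
  marks the mass that stays.
\<close>

definition ray_common :: "real \<Rightarrow> real \<Rightarrow> real" where
  "ray_common b s =
     (if (b, s) \<in> ray_domain then (8 - max 0 (- excess s (b * s + b\<^sup>2))) * (2 * b + s) else 0)"

definition plan_weight :: "real \<Rightarrow> real \<Rightarrow> real \<Rightarrow> ennreal" where
  "plan_weight b s t =
     ennreal (ray_source b s) * ennreal (ray_target b t) / ray_mass b + indicator {2..3} t * ennreal (ray_common b s)"

text \<open>The default value off \<open>ray_domain\<close> is a point of \<open>Omega\<close>, so
  that the map is measurable into \<open>ROm\<close> on the whole parameter space.\<close>

definition ray_pt :: "real \<Rightarrow> real \<Rightarrow> point" where
  "ray_pt b s = (if (b, s) \<in> ray_domain then pt s (b * s + b\<^sup>2) else pt 0 0)"

definition plan :: "(point \<times> point) measure" where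
  "plan = distr (density (lborel \<Otimes>\<^sub>M (lborel \<Otimes>\<^sub>M lborel)) (\<lambda>(b, s, t). plan_weight b s t)) (ROm \<Otimes>\<^sub>M ROm)
     (\<lambda>(b, s, t). (ray_pt b s, if t \<le> 1 then ray_pt b t else ray_pt b s))"

lemma measurable_excess [measurable (raw)]:
  assumes [measurable]: "f \<in> borel_measurable M" "g \<in> borel_measurable M"
  shows "(\<lambda>x. excess (f x) (g x)) \<in> borel_measurable M"
  unfolding excess_def by measurable

lemma measurable_ray_source [measurable (raw)]:
  assumes [measurable]: "f \<in> borel_measurable M" "g \<in> borel_measurable M"
  shows "(\<lambda>x. ray_source (f x) (g x)) \<in> borel_measurable M"
  unfolding ray_source_def by measurable

lemma measurable_ray_target [measurable (raw)]:
  assumes [measurable]: "f \<in> borel_measurable M" "g \<in> borel_measurable M"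
  shows "(\<lambda>x. ray_target (f x) (g x)) \<in> borel_measurable M"
  unfolding ray_target_def by measurable

lemma measurable_ray_common [measurable (raw)]:
  assumes [measurable]: "f \<in> borel_measurable M" "g \<in> borel_measurable M"
  shows "(\<lambda>x. ray_common (f x) (g x)) \<in> borel_measurable M"
  unfolding ray_common_def by measurable

lemma measurable_ray_mass [measurable]: "ray_mass \<in> borel_measurable borel"
  unfolding ray_mass_def by measurable

lemma ray_pt_in_Omega: "ray_pt b s \<in> Omega"
  using ray_in_region[of b s] by (auto simp: ray_pt_def ray_def region_def)

lemma measurable_ray_pt [measurable (raw)]:
  assumes [measurable]: "f \<in> borel_measurable M" "g \<in> borel_measurable M"
  shows "(\<lambda>x. ray_pt (f x) (g x)) \<in> measurable M ROm"
proof (rule measurable_restrict_space2)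
  show "(\<lambda>x. ray_pt (f x) (g x)) \<in> measurable M (Rleb 2)"
    unfolding ray_pt_def by measurable
qed (auto simp: ray_pt_in_Omega)

text \<open>This is the origin of the constant 8 in both densities: with q = x^2 + 4y, the bound
  comes from x^2 (5q - 3) <= 2 and is attained at (1, 0).\<close>

lemma excess_ge: "(x, y) \<in> region \<Longrightarrow> - 8 \<le> excess x y"
proof -
  assume r: "(x, y) \<in> region"
  define q where "q = x\<^sup>2 + 4 * y"
  have q: "q \<le> 1" "x\<^sup>2 \<le> 1"
    using r zero_le_power2[of x] by (auto simp: region_def q_def)
  have "x\<^sup>2 * (5 * q - 3) \<le> 1 * 2"
    using q mult_left_mono[of "5 * q - 3" 2 "x\<^sup>2"] by simp
  moreover have "0 \<le> (1 - q)\<^sup>2" by simp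
  moreover have "excess x y = 2 * (1 - q)\<^sup>2 - 4 * (x\<^sup>2 * (5 * q - 3))"
    unfolding excess_def q_def[symmetric] by (simp add: algebra_simps)
  ultimately show ?thesis by linarith
qed

lemma ray_parts_nonneg: "0 \<le> ray_source b s" "0 \<le> ray_target b s" "0 \<le> ray_common b s"
  using excess_ge[of s "b * s + b\<^sup>2"] ray_in_region[of b s]
  by (auto simp: ray_source_def ray_target_def ray_common_def ray_def ray_domain_def intro!: mult_nonneg_nonneg)

text \<open>The ray of slope 1/2 degenerates to the point (0, 1/4) and carries no mass, so
  normalising by \<open>ray_mass\<close> would divide by zero there; one slope is
  negligible.\<close>

lemma AE_ray_slope: "AE b in lborel. 0 \<le> b \<and> b < 1 / 2 \<or> (\<forall>s. (b, s) \<notin> ray_domain)"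
proof -
  have "AE b in lborel. b \<noteq> (1 / 2 :: real)" by (rule AE_lborel_singleton)
  then show ?thesis by eventually_elim (auto simp: ray_domain_def)
qed

lemma nn_integral_triple:
  fixes k :: "real \<times> real \<times> real \<Rightarrow> ennreal"
  assumes k: "k \<in> borel_measurable (lborel \<Otimes>\<^sub>M (lborel \<Otimes>\<^sub>M lborel))"
  shows "(\<integral>\<^sup>+z. k z \<partial>(lborel \<Otimes>\<^sub>M (lborel \<Otimes>\<^sub>M lborel))) =
    (\<integral>\<^sup>+b. \<integral>\<^sup>+s. \<integral>\<^sup>+t. k (b, s, t) \<partial>lborel \<partial>lborel \<partial>(lborel :: real measure))"
proof -
  have "(\<integral>\<^sup>+z. k z \<partial>(lborel \<Otimes>\<^sub>M (lborel \<Otimes>\<^sub>M lborel))) =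
      (\<integral>\<^sup>+b. \<integral>\<^sup>+y. k (b, y) \<partial>(lborel \<Otimes>\<^sub>M lborel) \<partial>lborel)"
    by (rule sigma_finite_measure.nn_integral_fst[OF sigma_finite_pair_measure[OF sigma_finite_lborel sigma_finite_lborel] k, symmetric])
  also have "\<dots> = (\<integral>\<^sup>+b. \<integral>\<^sup>+s. \<integral>\<^sup>+t. k (b, s, t) \<partial>lborel \<partial>lborel \<partial>lborel)"
    by (intro nn_integral_cong lborel.nn_integral_fst[symmetric] measurable_Pair2[OF k]) simp
  finally show ?thesis .
qed

text \<open>Every later statement about \<open>plan\<close> is read off from this formula, which
  splits the moved mass from the resting mass ray by ray. The tag interval \<open>{2..3}\<close> has
  length 1, so the resting mass is counted once.\<close>

lemma nn_integral_plan:
  assumes [measurable]: "H \<in> borel_measurable (ROm \<Otimes>\<^sub>M ROm)"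
  shows "(\<integral>\<^sup>+z. H z \<partial>plan) = (\<integral>\<^sup>+b.
      (\<integral>\<^sup>+s. \<integral>\<^sup>+t. ennreal (ray_source b s) * ennreal (ray_target b t) / ray_mass b * H (ray_pt b s, ray_pt b t) \<partial>lborel \<partial>lborel)
      + (\<integral>\<^sup>+s. ennreal (ray_common b s) * H (ray_pt b s, ray_pt b s) \<partial>lborel) \<partial>lborel)"
proof -
  let ?N = "lborel \<Otimes>\<^sub>M (lborel \<Otimes>\<^sub>M lborel) :: (real \<times> real \<times> real) measure"
  let ?c = "\<lambda>(b, s, t). (ray_pt b s, if t \<le> 1 then ray_pt b t else ray_pt b s)"
  have [measurable]: "(\<lambda>(b, s, t). plan_weight b s t) \<in> borel_measurable ?N"
    unfolding plan_weight_def by measurable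
  have [measurable]: "?c \<in> measurable ?N (ROm \<Otimes>\<^sub>M ROm)"
    by measurable
  have "(\<integral>\<^sup>+z. H z \<partial>plan) = (\<integral>\<^sup>+z. (case z of (b, s, t) \<Rightarrow> plan_weight b s t) * H (?c z) \<partial>?N)"
    unfolding plan_def
    by (subst nn_integral_distr) (simp_all add: nn_integral_density)
  also have "\<dots> = (\<integral>\<^sup>+b. \<integral>\<^sup>+s. \<integral>\<^sup>+t. plan_weight b s t * H (?c (b, s, t)) \<partial>lborel \<partial>lborel \<partial>lborel)"
  proof -
    have "(\<lambda>z. (case z of (b, s, t) \<Rightarrow> plan_weight b s t) * H (?c z)) \<in> borel_measurable ?N"
      by measurable
    from nn_integral_triple[OF this] show ?thesis by simp
  qed
  also have "\<dots> = (\<integral>\<^sup>+b. \<integral>\<^sup>+s.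
      (\<integral>\<^sup>+t. ennreal (ray_source b s) * ennreal (ray_target b t) / ray_mass b * H (ray_pt b s, ray_pt b t) \<partial>lborel)
      + ennreal (ray_common b s) * H (ray_pt b s, ray_pt b s) \<partial>lborel \<partial>lborel)"
  proof (rule nn_integral_cong, rule nn_integral_cong)
    fix b s :: real
    have "(\<integral>\<^sup>+t. plan_weight b s t * H (?c (b, s, t)) \<partial>lborel) =
        (\<integral>\<^sup>+t. ennreal (ray_source b s) * ennreal (ray_target b t) / ray_mass b * H (ray_pt b s, ray_pt b t)
          + ennreal (ray_common b s) * H (ray_pt b s, ray_pt b s) * indicator {2..3} t \<partial>lborel)"
    proof (rule nn_integral_cong)
      fix t
      \<comment> \<open>Target parameters never exceed 1, so the moved mass does not reach the tag
        interval.\<close>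
      have "ray_target b t = 0" if "t > 1"
        using that by (auto simp: ray_target_def ray_domain_def)
      then show "plan_weight b s t * H (?c (b, s, t)) =
        ennreal (ray_source b s) * ennreal (ray_target b t) / ray_mass b * H (ray_pt b s, ray_pt b t)
          + ennreal (ray_common b s) * H (ray_pt b s, ray_pt b s) * indicator {2..3} t"
        by (cases "t \<le> 1") (auto simp: plan_weight_def indicator_def)
    qed
    also have "\<dots> = (\<integral>\<^sup>+t. ennreal (ray_source b s) * ennreal (ray_target b t) / ray_mass b * H (ray_pt b s, ray_pt b t) \<partial>lborel)
      + ennreal (ray_common b s) * H (ray_pt b s, ray_pt b s)"
      by (subst nn_integral_add) (simp_all add: nn_integral_cmult_indicator)
    finally show "(\<integral>\<^sup>+t. plan_weight b s t * H (?c (b, s, t)) \<partial>lborel) =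
      (\<integral>\<^sup>+t. ennreal (ray_source b s) * ennreal (ray_target b t) / ray_mass b * H (ray_pt b s, ray_pt b t) \<partial>lborel)
      + ennreal (ray_common b s) * H (ray_pt b s, ray_pt b s)" .
  qed
  also have "\<dots> = (\<integral>\<^sup>+b.
      (\<integral>\<^sup>+s. \<integral>\<^sup>+t. ennreal (ray_source b s) * ennreal (ray_target b t) / ray_mass b * H (ray_pt b s, ray_pt b t) \<partial>lborel \<partial>lborel)
      + (\<integral>\<^sup>+s. ennreal (ray_common b s) * H (ray_pt b s, ray_pt b s) \<partial>lborel) \<partial>lborel)"
    by (intro nn_integral_cong nn_integral_add) simp_all
  finally show ?thesis .
qed

lemma measurable_pt_prod: "(\<lambda>z. pt (fst z) (snd z)) \<in> measurable borel (Rleb 2)"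
  by (intro measurable_pt' borel_measurable_continuous_onI continuous_intros)

lemma nn_integral_ROm_ray_pt:
  assumes [measurable]: "h \<in> borel_measurable ROm"
  shows "(\<integral>\<^sup>+x. h x \<partial>ROm) =
    (\<integral>\<^sup>+b. \<integral>\<^sup>+s. h (ray_pt b s) * indicator ray_domain (b, s) * ennreal (2 * b + s) \<partial>lborel \<partial>lborel)"
proof -
  define h' where "h' z = h (pt (fst z) (snd z)) * indicator Omega (pt (fst z) (snd z))" for z
  have "(\<lambda>x. h x * indicator Omega x) \<in> borel_measurable (Rleb 2)"
    using borel_measurable_restrict_space_iff_ennreal[of Omega "Rleb 2" h] assms Omega_subset_space
    by (simp add: Int_absorb2)
  then have [measurable]: "h' \<in> borel_measurable borel"
    unfolding h'_def by (rule measurable_compose[OF measurable_pt_prod])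
  have "(\<integral>\<^sup>+x. h x \<partial>ROm) = (\<integral>\<^sup>+x. h' (x 0, x (Suc 0)) \<partial>ROm)"
    by (rule nn_integral_cong) (simp add: h'_def pt_surj Omega_iff)
  also have "\<dots> = (\<integral>\<^sup>+b. \<integral>\<^sup>+s. h' (ray b s) * indicator ray_domain (b, s) * ennreal (2 * b + s) \<partial>lborel \<partial>lborel)"
    by (rule nn_integral_ROm) simp
  also have "\<dots> = (\<integral>\<^sup>+b. \<integral>\<^sup>+s. h (ray_pt b s) * indicator ray_domain (b, s) * ennreal (2 * b + s) \<partial>lborel \<partial>lborel)"
    using ray_in_region
    by (intro nn_integral_cong) (auto simp: h'_def ray_pt_def ray_def indicator_def)
  finally show ?thesis .
qed

definition source :: "point \<Rightarrow> real" where
  "source x = 8 + excess (x 0) (x (Suc 0))"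

definition target :: "point \<Rightarrow> real" where
  "target x = 8"

lemma measurable_source [measurable]: "source \<in> borel_measurable ROm" "target \<in> borel_measurable ROm"
  unfolding source_def target_def using measurable_coord_ROm by measurable

lemma source_nonneg: "x \<in> Omega \<Longrightarrow> 0 \<le> source x"
  using excess_ge[of "x 0" "x (Suc 0)"] by (simp add: source_def Omega_iff)

text \<open>With F the excess, max 0 F + (8 - max 0 (-F)) = 8 + F.\<close>

lemma ray_source_plus_common:
  "ennreal (ray_source b s) + ennreal (ray_common b s) =
    ennreal (source (ray_pt b s)) * indicator ray_domain (b, s) * ennreal (2 * b + s)"
proof (cases "(b, s) \<in> ray_domain")
  case True
  then have "0 \<le> 2 * b + s" by (auto simp: ray_domain_def)
  then have "ennreal (source (ray_pt b s)) * ennreal (2 * b + s) = ennreal (source (ray_pt b s) * (2 * b + s))"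
    using source_nonneg[OF ray_pt_in_Omega] by (simp add: ennreal_mult)
  also have "source (ray_pt b s) * (2 * b + s) = ray_source b s + ray_common b s"
    using True by (auto simp: source_def ray_pt_def ray_source_def ray_common_def max_def algebra_simps)
  finally show ?thesis
    using True ray_parts_nonneg by simp
qed (simp add: ray_source_def ray_common_def)

lemma ray_target_plus_common:
  "ennreal (ray_target b s) + ennreal (ray_common b s) =
    ennreal (target (ray_pt b s)) * indicator ray_domain (b, s) * ennreal (2 * b + s)"
proof (cases "(b, s) \<in> ray_domain")
  case True
  then have "0 \<le> 2 * b + s" by (auto simp: ray_domain_def)
  then have "ennreal (target (ray_pt b s)) * ennreal (2 * b + s) = ennreal (target (ray_pt b s) * (2 * b + s))"
    by (subst ennreal_mult) (simp_all add: target_def)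
  also have "target (ray_pt b s) * (2 * b + s) = ray_target b s + ray_common b s"
    using True by (auto simp: target_def ray_pt_def ray_target_def ray_common_def max_def algebra_simps)
  finally show ?thesis
    using True ray_parts_nonneg by simp
qed (simp add: ray_target_def ray_common_def)

lemma sets_plan: "sets plan = sets (ROm \<Otimes>\<^sub>M ROm)"
  by (simp add: plan_def)

text \<open>Integrating out the target parameter gives \<open>ray_mass b\<close>, which cancels the
  normalisation; what is left on each ray is source part plus common part.\<close>

lemma nn_integral_plan_fst:
  assumes [measurable]: "h \<in> borel_measurable ROm"
  shows "(\<integral>\<^sup>+z. h (fst z) \<partial>plan) = (\<integral>\<^sup>+x. ennreal (source x) * h x \<partial>ROm)"
proof -
  have "(\<integral>\<^sup>+z. h (fst z) \<partial>plan) = (\<integral>\<^sup>+b. \<integral>\<^sup>+s. (ennreal (ray_source b s) + ennreal (ray_common b s)) * h (ray_pt b s) \<partial>lborel \<partial>lborel)"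
  proof (subst nn_integral_plan, measurable, rule nn_integral_cong_AE, use AE_ray_slope in eventually_elim)
    fix b :: real
    assume b: "0 \<le> b \<and> b < 1 / 2 \<or> (\<forall>s. (b, s) \<notin> ray_domain)"
    have "(\<integral>\<^sup>+s. \<integral>\<^sup>+t. ennreal (ray_source b s) * ennreal (ray_target b t) / ray_mass b * h (fst (ray_pt b s, ray_pt b t)) \<partial>lborel \<partial>lborel)
        = (\<integral>\<^sup>+s. ennreal (ray_source b s) * h (ray_pt b s) \<partial>lborel)"
      using b
    proof
      assume "0 \<le> b \<and> b < 1 / 2"
      then have m: "ray_mass b \<noteq> 0" "ray_mass b \<noteq> top" "(\<integral>\<^sup>+t. ennreal (ray_target b t) \<partial>lborel) = ray_mass b"
        by (auto elim: ray_rearrangement)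
      have "(\<integral>\<^sup>+t. ennreal (ray_source b s) * ennreal (ray_target b t) / ray_mass b * h (fst (ray_pt b s, ray_pt b t)) \<partial>lborel) =
          ennreal (ray_source b s) * h (ray_pt b s)" for s
      proof -
        have "(\<integral>\<^sup>+t. ennreal (ray_source b s) * ennreal (ray_target b t) / ray_mass b * h (fst (ray_pt b s, ray_pt b t)) \<partial>lborel) =
          (\<integral>\<^sup>+t. ennreal (ray_source b s) * h (ray_pt b s) / ray_mass b * ennreal (ray_target b t) \<partial>lborel)"
          by (intro nn_integral_cong) (simp add: ennreal_times_divide mult_ac)
        also have "\<dots> = ennreal (ray_source b s) * h (ray_pt b s) / ray_mass b * ray_mass b"
          using m by (subst nn_integral_cmult) auto
        also have "\<dots> = ennreal (ray_source b s) * h (ray_pt b s)"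
          by (simp add: ennreal_divide_times ennreal_divide_self[OF m(1) m(2)[unfolded less_top]])
        finally show ?thesis .
      qed
      then show ?thesis by simp
    qed (simp add: ray_source_def)
    then show "(\<integral>\<^sup>+s. \<integral>\<^sup>+t. ennreal (ray_source b s) * ennreal (ray_target b t) / ray_mass b * h (fst (ray_pt b s, ray_pt b t)) \<partial>lborel \<partial>lborel)
        + (\<integral>\<^sup>+s. ennreal (ray_common b s) * h (fst (ray_pt b s, ray_pt b s)) \<partial>lborel) =
        (\<integral>\<^sup>+s. (ennreal (ray_source b s) + ennreal (ray_common b s)) * h (ray_pt b s) \<partial>lborel)"
      by (simp add: nn_integral_add distrib_right)
  qed
  also have "\<dots> = (\<integral>\<^sup>+x. ennreal (source x) * h x \<partial>ROm)"
    unfolding ray_source_plus_common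
    by (subst nn_integral_ROm_ray_pt) (auto intro!: nn_integral_cong simp: mult_ac)
  finally show ?thesis .
qed

text \<open>Here the source parameter is integrated out; its total is \<open>ray_mass b\<close> by
  definition.\<close>

lemma nn_integral_plan_snd:
  assumes [measurable]: "h \<in> borel_measurable ROm"
  shows "(\<integral>\<^sup>+z. h (snd z) \<partial>plan) = (\<integral>\<^sup>+x. ennreal (target x) * h x \<partial>ROm)"
proof -
  have "(\<integral>\<^sup>+z. h (snd z) \<partial>plan) = (\<integral>\<^sup>+b. \<integral>\<^sup>+s. (ennreal (ray_target b s) + ennreal (ray_common b s)) * h (ray_pt b s) \<partial>lborel \<partial>lborel)"
  proof (subst nn_integral_plan, measurable, rule nn_integral_cong_AE, use AE_ray_slope in eventually_elim)
    fix b :: real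
    assume b: "0 \<le> b \<and> b < 1 / 2 \<or> (\<forall>s. (b, s) \<notin> ray_domain)"
    have "(\<integral>\<^sup>+s. \<integral>\<^sup>+t. ennreal (ray_source b s) * ennreal (ray_target b t) / ray_mass b * h (snd (ray_pt b s, ray_pt b t)) \<partial>lborel \<partial>lborel)
        = (\<integral>\<^sup>+s. ennreal (ray_target b s) * h (ray_pt b s) \<partial>lborel)"
      using b
    proof
      assume "0 \<le> b \<and> b < 1 / 2"
      then have m: "ray_mass b \<noteq> 0" "ray_mass b \<noteq> top"
        by (auto elim: ray_rearrangement)
      define I where "I = (\<integral>\<^sup>+t. ennreal (ray_target b t) * h (ray_pt b t) \<partial>lborel)"
      have "(\<integral>\<^sup>+t. ennreal (ray_source b s) * ennreal (ray_target b t) / ray_mass b * h (snd (ray_pt b s, ray_pt b t)) \<partial>lborel) =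
          ennreal (ray_source b s) / ray_mass b * I" for s
      proof -
        have "(\<integral>\<^sup>+t. ennreal (ray_source b s) * ennreal (ray_target b t) / ray_mass b * h (snd (ray_pt b s, ray_pt b t)) \<partial>lborel) =
          (\<integral>\<^sup>+t. ennreal (ray_source b s) / ray_mass b * (ennreal (ray_target b t) * h (ray_pt b t)) \<partial>lborel)"
          by (intro nn_integral_cong) (simp add: ennreal_times_divide mult_ac)
        also have "\<dots> = ennreal (ray_source b s) / ray_mass b * I"
          unfolding I_def by (subst nn_integral_cmult) auto
        finally show ?thesis .
      qed
      then have "(\<integral>\<^sup>+s. \<integral>\<^sup>+t. ennreal (ray_source b s) * ennreal (ray_target b t) / ray_mass b * h (snd (ray_pt b s, ray_pt b t)) \<partial>lborel \<partial>lborel)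
         = (\<integral>\<^sup>+s. (I / ray_mass b) * ennreal (ray_source b s) \<partial>lborel)"
        by (simp add: ennreal_times_divide mult_ac)
      also have "\<dots> = (I / ray_mass b) * ray_mass b"
        unfolding ray_mass_def by (subst nn_integral_cmult) auto
      also have "\<dots> = I"
        by (simp add: ennreal_divide_times ennreal_divide_self[OF m(1) m(2)[unfolded less_top]])
      finally show ?thesis by (simp add: I_def)
    qed (simp add: ray_source_def ray_target_def)
    then show "(\<integral>\<^sup>+s. \<integral>\<^sup>+t. ennreal (ray_source b s) * ennreal (ray_target b t) / ray_mass b * h (snd (ray_pt b s, ray_pt b t)) \<partial>lborel \<partial>lborel)
        + (\<integral>\<^sup>+s. ennreal (ray_common b s) * h (snd (ray_pt b s, ray_pt b s)) \<partial>lborel) =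
        (\<integral>\<^sup>+s. (ennreal (ray_target b s) + ennreal (ray_common b s)) * h (ray_pt b s) \<partial>lborel)"
      by (simp add: nn_integral_add distrib_right)
  qed
  also have "\<dots> = (\<integral>\<^sup>+x. ennreal (target x) * h x \<partial>ROm)"
    unfolding ray_target_plus_common
    by (subst nn_integral_ROm_ray_pt) (auto intro!: nn_integral_cong simp: mult_ac)
  finally show ?thesis .
qed

lemma transport_plan_plan: "transport_plan 2 Omega source target plan"
  unfolding transport_plan_def
proof (intro conjI measure_eqI)
  show "sets plan = sets (ROm \<Otimes>\<^sub>M ROm)" by (rule sets_plan)
  have [measurable]: "fst \<in> measurable plan ROm" "snd \<in> measurable plan ROm"
    by (simp_all add: measurable_cong_sets[OF sets_plan refl])
  {
    fix A assume "A \<in> sets (distr plan ROm fst)"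
    then have [measurable]: "A \<in> sets ROm" by simp
    have "(\<integral>\<^sup>+z. indicator A (fst z) \<partial>plan) = (\<integral>\<^sup>+x. indicator A x \<partial>distr plan ROm fst)"
      by (subst nn_integral_distr) simp_all
    then have "emeasure (distr plan ROm fst) A = (\<integral>\<^sup>+z. indicator A (fst z) \<partial>plan)"
      by simp
    also have "\<dots> = emeasure (density ROm (\<lambda>x. ennreal (source x))) A"
      by (subst nn_integral_plan_fst) (simp_all add: emeasure_density)
    finally show "emeasure (distr plan ROm fst) A = emeasure (density ROm (\<lambda>x. ennreal (source x))) A" .
  }
  {
    fix A assume "A \<in> sets (distr plan ROm snd)"
    then have [measurable]: "A \<in> sets ROm" by simp
    have "(\<integral>\<^sup>+z. indicator A (snd z) \<partial>plan) = (\<integral>\<^sup>+x. indicator A x \<partial>distr plan ROm snd)"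
      by (subst nn_integral_distr) simp_all
    then have "emeasure (distr plan ROm snd) A = (\<integral>\<^sup>+z. indicator A (snd z) \<partial>plan)"
      by simp
    also have "\<dots> = emeasure (density ROm (\<lambda>x. ennreal (target x))) A"
      by (subst nn_integral_plan_snd) (simp_all add: emeasure_density)
    finally show "emeasure (distr plan ROm snd) A = emeasure (density ROm (\<lambda>x. ennreal (target x))) A" .
  }
qed auto

section \<open>Optimality\<close>

lemma edist_2: "edist 2 x y = sqrt ((x 0 - y 0)\<^sup>2 + (x (Suc 0) - y (Suc 0))\<^sup>2)"
  by (simp add: edist_def L2_set_def lessThan_2)

lemma measurable_pair_coord:
  "(\<lambda>z. fst z 0) \<in> borel_measurable (ROm \<Otimes>\<^sub>M ROm)" "(\<lambda>z. fst z (Suc 0)) \<in> borel_measurable (ROm \<Otimes>\<^sub>M ROm)"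
  "(\<lambda>z. snd z 0) \<in> borel_measurable (ROm \<Otimes>\<^sub>M ROm)" "(\<lambda>z. snd z (Suc 0)) \<in> borel_measurable (ROm \<Otimes>\<^sub>M ROm)"
  by (rule measurable_compose[OF measurable_fst measurable_coord_ROm(1)]
      measurable_compose[OF measurable_fst measurable_coord_ROm(2)]
      measurable_compose[OF measurable_snd measurable_coord_ROm(1)]
      measurable_compose[OF measurable_snd measurable_coord_ROm(2)])+

lemma measurable_edist [measurable]:
  "(\<lambda>z. edist 2 (fst z) (snd z)) \<in> borel_measurable (ROm \<Otimes>\<^sub>M ROm)"
  unfolding edist_2 using measurable_pair_coord by measurable

lemma edist_nonneg: "0 \<le> edist 2 x y" by (simp add: edist_2)

lemma edist_self: "edist 2 x x = 0" by (simp add: edist_2)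

lemma edist_ray:
  assumes "s \<le> t"
  shows "edist 2 (pt s (b * s + b\<^sup>2)) (pt t (b * t + b\<^sup>2)) = sqrt (1 + b\<^sup>2) * (t - s)"
proof -
  have "(s - t)\<^sup>2 + (b * s + b\<^sup>2 - (b * t + b\<^sup>2))\<^sup>2 = (1 + b\<^sup>2) * (t - s)\<^sup>2"
    by (simp add: power2_eq_square algebra_simps)
  with assms show ?thesis
    by (simp add: edist_2 real_sqrt_mult)
qed

text \<open>The shift by 10 makes the potential nonnegative on \<open>Omega\<close>.\<close>

definition shifted_potential :: "point \<Rightarrow> real" where
  "shifted_potential x = 10 + potential (x 0) (x (Suc 0))"

lemma measurable_slope [measurable (raw)]:
  assumes [measurable]: "f \<in> borel_measurable M" "g \<in> borel_measurable M"
  shows "(\<lambda>x. slope (f x) (g x)) \<in> borel_measurable M"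
  unfolding slope_def by measurable

lemma measurable_arsinh [measurable]: "arsinh \<in> borel_measurable (borel :: real measure)"
  by (intro borel_measurable_continuous_onI continuous_intros)

lemma measurable_shifted_potential [measurable]: "shifted_potential \<in> borel_measurable ROm"
  unfolding shifted_potential_def potential_def using measurable_coord_ROm by measurable

lemma shifted_potential_lipschitz:
  assumes "x \<in> Omega" "y \<in> Omega"
  shows "shifted_potential y - shifted_potential x \<le> edist 2 x y"
  using potential_lipschitz[of "x 0" "x (Suc 0)" "y 0" "y (Suc 0)"] assms
  by (simp add: Omega_iff shifted_potential_def edist_2 power2_commute)

lemma Omega_coord_le:
  assumes "x \<in> Omega"
  shows "0 \<le> x 0" "x 0 \<le> 1" "0 \<le> x (Suc 0)" "x (Suc 0) \<le> 1"
  using region_bounds[of "x 0" "x (Suc 0)"] assms by (auto simp: Omega_iff)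

lemma edist_le_2:
  assumes "x \<in> Omega" "y \<in> Omega"
  shows "edist 2 x y \<le> 2"
proof -
  have "\<bar>x 0 - y 0\<bar> \<le> 1" "\<bar>x (Suc 0) - y (Suc 0)\<bar> \<le> 1"
    using Omega_coord_le[OF assms(1)] Omega_coord_le[OF assms(2)] by linarith+
  moreover have "edist 2 x y \<le> \<bar>x 0 - y 0\<bar> + \<bar>x (Suc 0) - y (Suc 0)\<bar>"
    unfolding edist_2 by (rule sqrt_sum_squares_le_sum_abs)
  ultimately show ?thesis by linarith
qed

text \<open>The unshifted potential vanishes at the origin and is 1-Lipschitz, and distances in
  \<open>Omega\<close> are at most 2.\<close>

lemma shifted_potential_bounds:
  assumes "x \<in> Omega"
  shows "0 \<le> shifted_potential x" "shifted_potential x \<le> 12"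
proof -
  have 0: "pt 0 0 \<in> Omega" by (simp add: region_def)
  have "shifted_potential (pt 0 0) = 10"
    by (simp add: shifted_potential_def potential_def slope_def)
  then show "0 \<le> shifted_potential x" "shifted_potential x \<le> 12"
    using shifted_potential_lipschitz[OF 0 assms] shifted_potential_lipschitz[OF assms 0]
      edist_le_2[OF 0 assms] edist_le_2[OF assms 0] by linarith+
qed

lemma transport_plan_integrals:
  assumes "transport_plan 2 Omega source target \<gamma>" and h [measurable]: "h \<in> borel_measurable ROm"
  shows "(\<integral>\<^sup>+z. h (fst z) \<partial>\<gamma>) = (\<integral>\<^sup>+x. ennreal (source x) * h x \<partial>ROm)"
    and "(\<integral>\<^sup>+z. h (snd z) \<partial>\<gamma>) = (\<integral>\<^sup>+x. ennreal (target x) * h x \<partial>ROm)"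
proof -
  have s: "sets \<gamma> = sets (ROm \<Otimes>\<^sub>M ROm)"
    and d: "distr \<gamma> ROm fst = density ROm (\<lambda>x. ennreal (source x))"
      "distr \<gamma> ROm snd = density ROm (\<lambda>x. ennreal (target x))"
    using assms(1) by (auto simp: transport_plan_def)
  have m: "fst \<in> measurable \<gamma> ROm" "snd \<in> measurable \<gamma> ROm"
    by (simp_all add: measurable_cong_sets[OF s refl])
  have "(\<integral>\<^sup>+z. h (fst z) \<partial>\<gamma>) = (\<integral>\<^sup>+x. h x \<partial>distr \<gamma> ROm fst)"
    using m by (subst nn_integral_distr) simp_all
  then show "(\<integral>\<^sup>+z. h (fst z) \<partial>\<gamma>) = (\<integral>\<^sup>+x. ennreal (source x) * h x \<partial>ROm)"
    unfolding d by (simp add: nn_integral_density)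
  have "(\<integral>\<^sup>+z. h (snd z) \<partial>\<gamma>) = (\<integral>\<^sup>+x. h x \<partial>distr \<gamma> ROm snd)"
    using m by (subst nn_integral_distr) simp_all
  then show "(\<integral>\<^sup>+z. h (snd z) \<partial>\<gamma>) = (\<integral>\<^sup>+x. ennreal (target x) * h x \<partial>ROm)"
    unfolding d by (simp add: nn_integral_density)
qed

lemma emeasure_ROm_finite: "emeasure ROm Omega < top"
proof -
  have "emeasure ROm Omega = emeasure (Rleb 2) Omega"
    using Omega_subset_space by (intro emeasure_restrict_space) (auto simp: Int_absorb2)
  also have "\<dots> \<le> emeasure (Rleb 2) (Pi\<^sub>E {..<2} (\<lambda>_. {0..1}))"
  proof (intro emeasure_mono sets_PiM_I_finite subsetI)
    fix x assume "x \<in> Omega"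
    then show "x \<in> Pi\<^sub>E {..<2} (\<lambda>_. {0..1})"
      using Omega_coord_le[of x] by (auto simp: PiE_iff Omega_iff less_2_cases_iff)
  qed auto
  also have "\<dots> = 1"
  proof -
    interpret finite_product_sigma_finite "\<lambda>_::nat. lborel :: real measure" "{..<2::nat}"
      by standard auto
    show ?thesis
      by (subst measure_times) (auto simp: lessThan_2)
  qed
  finally show ?thesis
    by (metis ennreal_one_less_top le_less_trans)
qed

text \<open>22 = 8 + 2 + 12, from (1 - q)^2 <= 1 and x^2 (3 - 5q) <= 3. The bound gives the
  finiteness of mass and of the dual integral.\<close>

lemma source_le: "x \<in> Omega \<Longrightarrow> source x \<le> 22"
proof -
  assume x: "x \<in> Omega"
  define q where "q = (x 0)\<^sup>2 + 4 * x (Suc 0)"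
  have q: "0 \<le> q" "q \<le> 1" "(x 0)\<^sup>2 \<le> 1"
    using x Omega_coord_le[OF x] by (auto simp: Omega_iff region_def q_def abs_square_le_1)
  have "(1 - q)\<^sup>2 \<le> 1" using q by (simp add: abs_square_le_1)
  moreover have "(x 0)\<^sup>2 * (3 - 5 * q) \<le> (x 0)\<^sup>2 * 3"
    using q by (intro mult_left_mono) auto
  moreover have "source x = 8 + 2 * (1 - q)\<^sup>2 + 4 * ((x 0)\<^sup>2 * (3 - 5 * q))"
    unfolding source_def excess_def q_def[symmetric] by simp
  ultimately show ?thesis using q by linarith
qed

lemma nn_integral_source_potential_finite:
  "(\<integral>\<^sup>+x. ennreal (source x) * ennreal (shifted_potential x) \<partial>ROm) < top"
proof -
  have "(\<integral>\<^sup>+x. ennreal (source x) * ennreal (shifted_potential x) \<partial>ROm) \<le> (\<integral>\<^sup>+x. ennreal 22 * ennreal 12 \<partial>ROm)"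
    using source_le shifted_potential_bounds
    by (intro nn_integral_mono mult_mono ennreal_leI) auto
  also have "\<dots> < top"
    using emeasure_ROm_finite by (simp add: ennreal_mult_less_top)
  finally show ?thesis .
qed

text \<open>The weight is nonzero only if s <= s0 <= t for the sign change s0 of the ray. Integrands
  against the moved mass thus need to agree only on pairs ordered along the ray.\<close>

lemma ray_weight_cong:
  assumes "0 \<le> b \<and> b < 1 / 2 \<or> (\<forall>s. (b, s) \<notin> ray_domain)"
    and "(b, s) \<in> ray_domain \<Longrightarrow> (b, t) \<in> ray_domain \<Longrightarrow> s \<le> t \<Longrightarrow> X = Y"
  shows "ennreal (ray_source b s) * ennreal (ray_target b t) / ray_mass b * X =
      ennreal (ray_source b s) * ennreal (ray_target b t) / ray_mass b * Y"
  using assms(1)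
proof
  assume "0 \<le> b \<and> b < 1 / 2"
  then obtain s0 where "\<And>s. ray_source b s \<noteq> 0 \<Longrightarrow> s \<le> s0" "\<And>t. ray_target b t \<noteq> 0 \<Longrightarrow> s0 \<le> t"
    using ray_rearrangement[of b] by metis
  then have "s \<le> t" if "ray_source b s \<noteq> 0" "ray_target b t \<noteq> 0"
    using that by (meson order_trans)
  moreover have "(b, s) \<in> ray_domain" if "ray_source b s \<noteq> 0"
    using that by (auto simp: ray_source_def split: if_splits)
  moreover have "(b, t) \<in> ray_domain" if "ray_target b t \<noteq> 0"
    using that by (auto simp: ray_target_def split: if_splits)
  ultimately show ?thesis
    using assms(2) by (cases "ray_source b s = 0 \<or> ray_target b t = 0") auto
qed (simp add: ray_source_def)

lemma nn_integral_plan_cong: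
  assumes [measurable]: "H \<in> borel_measurable (ROm \<Otimes>\<^sub>M ROm)" "K \<in> borel_measurable (ROm \<Otimes>\<^sub>M ROm)"
    and diag: "\<And>b s. H (ray_pt b s, ray_pt b s) = K (ray_pt b s, ray_pt b s)"
    and ray: "\<And>b s t. (b, s) \<in> ray_domain \<Longrightarrow> (b, t) \<in> ray_domain \<Longrightarrow> s \<le> t \<Longrightarrow>
      H (ray_pt b s, ray_pt b t) = K (ray_pt b s, ray_pt b t)"
  shows "(\<integral>\<^sup>+z. H z \<partial>plan) = (\<integral>\<^sup>+z. K z \<partial>plan)"
  unfolding nn_integral_plan[OF assms(1)] nn_integral_plan[OF assms(2)] diag
proof (rule nn_integral_cong_AE, use AE_ray_slope in eventually_elim)
  fix b :: real
  assume "0 \<le> b \<and> b < 1 / 2 \<or> (\<forall>s. (b, s) \<notin> ray_domain)"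
  from ray_weight_cong[OF this ray]
  show "(\<integral>\<^sup>+s. \<integral>\<^sup>+t. ennreal (ray_source b s) * ennreal (ray_target b t) / ray_mass b * H (ray_pt b s, ray_pt b t) \<partial>lborel \<partial>lborel)
      + (\<integral>\<^sup>+s. ennreal (ray_common b s) * K (ray_pt b s, ray_pt b s) \<partial>lborel) =
    (\<integral>\<^sup>+s. \<integral>\<^sup>+t. ennreal (ray_source b s) * ennreal (ray_target b t) / ray_mass b * K (ray_pt b s, ray_pt b t) \<partial>lborel \<partial>lborel)
      + (\<integral>\<^sup>+s. ennreal (ray_common b s) * K (ray_pt b s, ray_pt b s) \<partial>lborel)"
    by simp
qed

text \<open>Kantorovich duality with u the shifted potential: for any plan, the integral of u over
  the target is at most cost plus the integral of u over the source, with equality for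
  \<open>plan\<close>. As u is nonnegative, everything stays in the extended reals, and the finite
  source integral can be cancelled.\<close>

lemma optimal_plan_plan: "optimal_plan 2 Omega source target plan"
  unfolding optimal_plan_def
proof (intro conjI allI impI)
  show "transport_plan 2 Omega source target plan" by (rule transport_plan_plan)
  fix \<gamma> assume \<gamma>: "transport_plan 2 Omega source target \<gamma>"
  then have s: "sets \<gamma> = sets (ROm \<Otimes>\<^sub>M ROm)" by (simp add: transport_plan_def)
  then have space: "space \<gamma> = Omega \<times> Omega"
    using sets_eq_imp_space_eq[OF s] by (simp add: space_pair_measure)
  let ?u = "\<lambda>x. ennreal (shifted_potential x)"
  let ?I = "\<integral>\<^sup>+x. ennreal (source x) * ?u x \<partial>ROm"
  let ?J = "\<integral>\<^sup>+x. ennreal (target x) * ?u x \<partial>ROm"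
  have cost: "transport_cost 2 \<gamma>' = (\<integral>\<^sup>+z. ennreal (edist 2 (fst z) (snd z)) \<partial>\<gamma>')" for \<gamma>'
    by (simp add: transport_cost_def case_prod_unfold)
  have "?J = (\<integral>\<^sup>+z. ?u (snd z) \<partial>\<gamma>)"
    by (rule transport_plan_integrals(2)[OF \<gamma>, symmetric]) simp
  also have "\<dots> \<le> (\<integral>\<^sup>+z. ennreal (edist 2 (fst z) (snd z)) + ?u (fst z) \<partial>\<gamma>)"
  proof (rule nn_integral_mono)
    fix z assume "z \<in> space \<gamma>"
    then have z: "fst z \<in> Omega" "snd z \<in> Omega" by (auto simp: space)
    have "?u (snd z) \<le> ennreal (edist 2 (fst z) (snd z) + shifted_potential (fst z))"
      using shifted_potential_lipschitz[OF z] by (intro ennreal_leI) linarith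
    then show "?u (snd z) \<le> ennreal (edist 2 (fst z) (snd z)) + ?u (fst z)"
      using shifted_potential_bounds[OF z(1)] edist_nonneg by (simp add: ennreal_plus)
  qed
  also have "\<dots> = transport_cost 2 \<gamma> + (\<integral>\<^sup>+z. ?u (fst z) \<partial>\<gamma>)"
    unfolding cost by (rule nn_integral_add) (simp_all add: measurable_cong_sets[OF s refl])
  also have "(\<integral>\<^sup>+z. ?u (fst z) \<partial>\<gamma>) = ?I"
    by (rule transport_plan_integrals(1)[OF \<gamma>]) simp
  finally have 1: "?J \<le> transport_cost 2 \<gamma> + ?I" .
  have "transport_cost 2 plan + ?I = (\<integral>\<^sup>+z. ennreal (edist 2 (fst z) (snd z)) \<partial>plan) + (\<integral>\<^sup>+z. ?u (fst z) \<partial>plan)"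
    unfolding cost by (subst nn_integral_plan_fst) simp_all
  also have "\<dots> = (\<integral>\<^sup>+z. ennreal (edist 2 (fst z) (snd z)) + ?u (fst z) \<partial>plan)"
    by (rule nn_integral_add[symmetric]) (simp_all add: measurable_cong_sets[OF sets_plan refl])
  also have "\<dots> = (\<integral>\<^sup>+z. ?u (snd z) \<partial>plan)"
  proof (rule nn_integral_plan_cong)
    fix b s t assume D: "(b, s) \<in> ray_domain" "(b, t) \<in> ray_domain" "s \<le> t"
    then have b: "0 \<le> b" "0 \<le> s" "0 \<le> t" by (auto simp: ray_domain_def)
    have "shifted_potential (ray_pt b t) = edist 2 (ray_pt b s) (ray_pt b t) + shifted_potential (ray_pt b s)"
      using potential_ray_diff[OF b] D by (simp add: ray_pt_def edist_ray shifted_potential_def)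
    then show "ennreal (edist 2 (fst (ray_pt b s, ray_pt b t)) (snd (ray_pt b s, ray_pt b t))) +
        ?u (fst (ray_pt b s, ray_pt b t)) = ?u (snd (ray_pt b s, ray_pt b t))"
      using shifted_potential_bounds(1)[OF ray_pt_in_Omega] edist_nonneg by simp
  qed (simp_all add: edist_self)
  also have "\<dots> = ?J"
    by (rule nn_integral_plan_snd) simp
  finally have "transport_cost 2 plan + ?I \<le> transport_cost 2 \<gamma> + ?I"
    using 1 by simp
  moreover have "?I \<noteq> top"
    using nn_integral_source_potential_finite by (simp only: less_top)
  ultimately show "transport_cost 2 plan \<le> transport_cost 2 \<gamma>"
    unfolding add.commute[of _ ?I] ennreal_add_left_cancel_le by simp
qed

section \<open>The transport density\<close>

definition sigma_density :: "point \<Rightarrow> real" where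
  "sigma_density x = density_fun (x 0) (x (Suc 0))"

text \<open>Multiplying by the Jacobian turns the planar density into the flux along the ray times
  its length element; at the origin, where the Jacobian is 0, both sides vanish.\<close>

lemma density_fun_ray:
  assumes "(b, s) \<in> ray_domain"
  shows "density_fun s (b * s + b\<^sup>2) * (2 * b + s) = sqrt (1 + b\<^sup>2) * flux b s"
proof -
  have b: "0 \<le> b" "0 \<le> s" using assms by (auto simp: ray_domain_def)
  show ?thesis
  proof (cases "2 * b + s = 0")
    case True
    with b have "s = 0" by linarith
    with b show ?thesis by (simp add: density_fun_def)
  next
    case False
    then show ?thesis
      unfolding density_fun_def slope_ray[OF b] sqrt_ray[OF b] by simp
  qed
qed

lemma region_slope:
  assumes "(x, y) \<in> region"
  shows "(slope x y, x) \<in> ray_domain"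
proof -
  have "x \<le> sqrt (x\<^sup>2 + 4 * y)" "sqrt (x\<^sup>2 + 4 * y) \<le> 1"
    using assms by (auto simp: region_def intro: real_le_rsqrt)
  moreover have "2 * slope x y = sqrt (x\<^sup>2 + 4 * y) - x" by (simp add: slope_def)
  ultimately show ?thesis
    using assms by (simp add: ray_domain_def region_def)
qed

lemma sigma_nonneg: "x \<in> Omega \<Longrightarrow> 0 \<le> sigma_density x"
  using region_slope[of "x 0" "x (Suc 0)"] flux_nonneg
  by (auto simp: Omega_iff sigma_density_def density_fun_def region_def)

lemma measurable_flux [measurable (raw)]:
  assumes [measurable]: "f \<in> borel_measurable M" "g \<in> borel_measurable M"
  shows "(\<lambda>x. flux (f x) (g x)) \<in> borel_measurable M"
  unfolding flux_def by measurable

lemma measurable_density_fun [measurable (raw)]: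
  assumes [measurable]: "f \<in> borel_measurable M" "g \<in> borel_measurable M"
  shows "(\<lambda>x. density_fun (f x) (g x)) \<in> borel_measurable M"
  unfolding density_fun_def by measurable

lemma measurable_sigma [measurable]: "sigma_density \<in> borel_measurable ROm"
  unfolding sigma_density_def using measurable_coord_ROm by measurable

section \<open>Integrals along transported segments\<close>

definition seg :: "point \<times> point \<Rightarrow> real \<Rightarrow> real \<times> real" where
  "seg z t = ((1 - t) * fst z 0 + t * snd z 0, (1 - t) * fst z (Suc 0) + t * snd z (Suc 0))"

lemma measurable_seg:
  "(\<lambda>(z, t). seg z t) \<in> borel_measurable ((ROm \<Otimes>\<^sub>M ROm) \<Otimes>\<^sub>M lborel)"
proof -
  have "(\<lambda>p. fst (fst p) 0) \<in> borel_measurable ((ROm \<Otimes>\<^sub>M ROm) \<Otimes>\<^sub>M lborel)"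
    "(\<lambda>p. fst (fst p) (Suc 0)) \<in> borel_measurable ((ROm \<Otimes>\<^sub>M ROm) \<Otimes>\<^sub>M lborel)"
    "(\<lambda>p. snd (fst p) 0) \<in> borel_measurable ((ROm \<Otimes>\<^sub>M ROm) \<Otimes>\<^sub>M lborel)"
    "(\<lambda>p. snd (fst p) (Suc 0)) \<in> borel_measurable ((ROm \<Otimes>\<^sub>M ROm) \<Otimes>\<^sub>M lborel)"
    by (rule measurable_compose[OF measurable_fst], rule measurable_pair_coord)+
  then show ?thesis
    unfolding seg_def split_beta by measurable
qed

definition segment_integral :: "(real \<times> real \<Rightarrow> ennreal) \<Rightarrow> point \<times> point \<Rightarrow> ennreal" where
  "segment_integral G z =
     (\<integral>\<^sup>+t. G (seg z t) * ennreal (edist 2 (fst z) (snd z)) * indicator {0..1} t \<partial>lborel)"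

lemma measurable_segment_integral:
  assumes [measurable]: "G \<in> borel_measurable borel"
  shows "segment_integral G \<in> borel_measurable (ROm \<Otimes>\<^sub>M ROm)"
proof -
  note measurable_compose[OF measurable_seg assms, measurable]
  have "(\<lambda>p. edist 2 (fst (fst p)) (snd (fst p))) \<in> borel_measurable ((ROm \<Otimes>\<^sub>M ROm) \<Otimes>\<^sub>M lborel)"
    by (rule measurable_compose[OF measurable_fst]) measurable
  note this [measurable]
  have "(\<lambda>p. G (seg (fst p) (snd p))) \<in> borel_measurable ((ROm \<Otimes>\<^sub>M ROm) \<Otimes>\<^sub>M lborel)"
    using measurable_compose[OF measurable_seg assms] by (simp add: split_beta)
  note this [measurable]
  show ?thesis
    unfolding segment_integral_def by measurable
qed

lemma measurable_ray [measurable (raw)]: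
  assumes [measurable]: "f \<in> borel_measurable M" "g \<in> borel_measurable M"
  shows "(\<lambda>x. ray (f x) (g x)) \<in> borel_measurable M"
  unfolding ray_def by (intro borel_measurable_Pair) measurable

text \<open>The substitution z = (1 - r) s + r t absorbs the factor t - s of the distance. Writing s
  <= z <= t as a product of an indicator in s and one in t prepares the factorisation of the
  coupling.\<close>

lemma segment_integral_ray:
  assumes [measurable]: "G \<in> borel_measurable borel" and D: "(b, s) \<in> ray_domain" "(b, t) \<in> ray_domain" "s \<le> t"
  shows "segment_integral G (ray_pt b s, ray_pt b t) =
    ennreal (sqrt (1 + b\<^sup>2)) * (\<integral>\<^sup>+z. G (ray b z) * (indicator {..z} s * indicator {z..} t) \<partial>lborel)"
proof -
  have "seg (ray_pt b s, ray_pt b t) r = ray b ((1 - r) * s + r * t)" for r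
    using D by (simp add: seg_def ray_pt_def ray_def algebra_simps)
  then have "segment_integral G (ray_pt b s, ray_pt b t) =
      (\<integral>\<^sup>+r. ennreal (sqrt (1 + b\<^sup>2)) * (G (ray b ((1 - r) * s + r * t)) * ennreal (t - s) * indicator {0..1} r) \<partial>lborel)"
    unfolding segment_integral_def
    using D by (intro nn_integral_cong) (simp add: ray_pt_def edist_ray ennreal_mult mult_ac)
  also have "\<dots> = ennreal (sqrt (1 + b\<^sup>2)) *
      (\<integral>\<^sup>+r. G (ray b ((1 - r) * s + r * t)) * ennreal (t - s) * indicator {0..1} r \<partial>lborel)"
  proof (rule nn_integral_cmult)
    have "(\<lambda>r. ray b ((1 - r) * s + r * t)) \<in> borel_measurable borel"
      by measurable
    then have "(\<lambda>r. G (ray b ((1 - r) * s + r * t))) \<in> borel_measurable borel"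
      by (rule measurable_compose) fact
    then show "(\<lambda>r. G (ray b ((1 - r) * s + r * t)) * ennreal (t - s) * indicator {0..1} r) \<in> borel_measurable lborel"
      by measurable
  qed
  also have "(\<integral>\<^sup>+r. G (ray b ((1 - r) * s + r * t)) * ennreal (t - s) * indicator {0..1} r \<partial>lborel) =
      (\<integral>\<^sup>+z. G (ray b z) * indicator {(1 - 0) * s + 0 * t..(1 - 1) * s + 1 * t} z \<partial>lborel)"
    using D(3) unfolding ray_def
    by (intro nn_integral_substitution_aux[symmetric]) (auto intro!: derivative_eq_intros)
  also have "\<dots> = (\<integral>\<^sup>+z. G (ray b z) * (indicator {..z} s * indicator {z..} t) \<partial>lborel)"
    by (intro nn_integral_cong) (auto simp: indicator_def)
  finally show ?thesis .
qed

lemma segment_integral_diag: "segment_integral G (x, x) = 0"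
  by (simp add: segment_integral_def edist_2)

text \<open>Tonelli: for fixed z the product weight separates into the mass starting before z and
  the mass ending after z.\<close>

lemma ray_coupling_integral:
  assumes [measurable]: "K \<in> borel_measurable (borel :: real measure)"
  shows "(\<integral>\<^sup>+s. \<integral>\<^sup>+t. ennreal (ray_source b s) * ennreal (ray_target b t) / ray_mass b *
      (\<integral>\<^sup>+z. K z * (indicator {..z} s * indicator {z..} t) \<partial>lborel) \<partial>lborel \<partial>lborel) =
    (\<integral>\<^sup>+z. K z * ((\<integral>\<^sup>+s. ennreal (ray_source b s) * indicator {..z} s \<partial>lborel) *
      (\<integral>\<^sup>+t. ennreal (ray_target b t) * indicator {z..} t \<partial>lborel) / ray_mass b) \<partial>lborel)"
    (is "?L = ?R")
proof -
  let ?S = "\<lambda>s. ennreal (ray_source b s)" and ?T = "\<lambda>t. ennreal (ray_target b t)" and ?m = "ray_mass b"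
  have ind [measurable]: "(\<lambda>p. indicator {..f p} (g p) :: ennreal) \<in> borel_measurable M"
    "(\<lambda>p. indicator {f p..} (g p) :: ennreal) \<in> borel_measurable M"
    if [measurable]: "f \<in> borel_measurable M" "g \<in> borel_measurable M" for f g :: "'b \<Rightarrow> real" and M
  proof -
    have "(\<lambda>p. indicator {..f p} (g p) :: ennreal) = (\<lambda>p. if g p \<le> f p then 1 else 0)"
      "(\<lambda>p. indicator {f p..} (g p) :: ennreal) = (\<lambda>p. if f p \<le> g p then 1 else 0)"
      by (auto simp: fun_eq_iff indicator_def)
    then show "(\<lambda>p. indicator {..f p} (g p) :: ennreal) \<in> borel_measurable M"
      "(\<lambda>p. indicator {f p..} (g p) :: ennreal) \<in> borel_measurable M"
      by (simp_all only:) measurable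
  qed
  have "?L = (\<integral>\<^sup>+s. \<integral>\<^sup>+t. \<integral>\<^sup>+z. ?S s * ?T t / ?m * (K z * (indicator {..z} s * indicator {z..} t)) \<partial>lborel \<partial>lborel \<partial>lborel)"
    by (intro nn_integral_cong nn_integral_cmult[symmetric]) measurable
  also have "\<dots> = (\<integral>\<^sup>+s. \<integral>\<^sup>+z. \<integral>\<^sup>+t. ?S s * ?T t / ?m * (K z * (indicator {..z} s * indicator {z..} t)) \<partial>lborel \<partial>lborel \<partial>lborel)"
    by (intro nn_integral_cong lborel_pair.Fubini') measurable
  also have "\<dots> = (\<integral>\<^sup>+z. \<integral>\<^sup>+s. \<integral>\<^sup>+t. ?S s * ?T t / ?m * (K z * (indicator {..z} s * indicator {z..} t)) \<partial>lborel \<partial>lborel \<partial>lborel)"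
    by (rule lborel_pair.Fubini') measurable
  also have "\<dots> = (\<integral>\<^sup>+z. \<integral>\<^sup>+s. K z / ?m * (\<integral>\<^sup>+t. ?T t * indicator {z..} t \<partial>lborel) * (?S s * indicator {..z} s) \<partial>lborel \<partial>lborel)"
  proof (rule nn_integral_cong, rule nn_integral_cong)
    fix z s :: real
    have "(\<integral>\<^sup>+t. ?S s * ?T t / ?m * (K z * (indicator {..z} s * indicator {z..} t)) \<partial>lborel) =
      (\<integral>\<^sup>+t. (K z / ?m * (?S s * indicator {..z} s)) * (?T t * indicator {z..} t) \<partial>lborel)"
      by (intro nn_integral_cong) (simp add: divide_ennreal_def mult_ac)
    also have "\<dots> = (K z / ?m * (?S s * indicator {..z} s)) * (\<integral>\<^sup>+t. ?T t * indicator {z..} t \<partial>lborel)"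
      by (rule nn_integral_cmult) measurable
    finally show "(\<integral>\<^sup>+t. ?S s * ?T t / ?m * (K z * (indicator {..z} s * indicator {z..} t)) \<partial>lborel) =
      K z / ?m * (\<integral>\<^sup>+t. ?T t * indicator {z..} t \<partial>lborel) * (?S s * indicator {..z} s)"
      by (simp add: mult_ac)
  qed
  also have "\<dots> = (\<integral>\<^sup>+z. K z / ?m * (\<integral>\<^sup>+t. ?T t * indicator {z..} t \<partial>lborel) * (\<integral>\<^sup>+s. ?S s * indicator {..z} s \<partial>lborel) \<partial>lborel)"
    by (intro nn_integral_cong nn_integral_cmult) measurable
  also have "\<dots> = ?R"
    by (intro nn_integral_cong) (simp add: divide_ennreal_def mult_ac)
  finally show ?thesis .
qed

text \<open>In ray coordinates both sides integrate \<open>G\<close> along each ray against the mass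
  crossing z, which \<open>ray_rearrangement\<close> identifies with the flux.\<close>

lemma sigma_eq_segment_integral:
  assumes [measurable]: "G \<in> borel_measurable borel"
  shows "(\<integral>\<^sup>+x. ennreal (sigma_density x) * G (x 0, x (Suc 0)) \<partial>ROm) = (\<integral>\<^sup>+z. segment_integral G z \<partial>plan)"
proof -
  have "(\<integral>\<^sup>+x. ennreal (sigma_density x) * G (x 0, x (Suc 0)) \<partial>ROm) =
      (\<integral>\<^sup>+x. (\<lambda>z. ennreal (density_fun (fst z) (snd z)) * G z) (x 0, x (Suc 0)) \<partial>ROm)"
    by (simp add: sigma_density_def)
  also have "\<dots> = (\<integral>\<^sup>+b. \<integral>\<^sup>+s. (\<lambda>z. ennreal (density_fun (fst z) (snd z)) * G z) (ray b s) * indicator ray_domain (b, s)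
      * ennreal (2 * b + s) \<partial>lborel \<partial>lborel)"
  proof (rule nn_integral_ROm)
    have [measurable]: "fst \<in> borel_measurable (borel :: (real \<times> real) measure)"
      "snd \<in> borel_measurable (borel :: (real \<times> real) measure)"
      by (intro borel_measurable_continuous_onI continuous_intros)+
    show "(\<lambda>z. ennreal (density_fun (fst z) (snd z)) * G z) \<in> borel_measurable borel"
      by measurable
  qed
  also have "\<dots> = (\<integral>\<^sup>+b. \<integral>\<^sup>+z. ennreal (sqrt (1 + b\<^sup>2) * flux b z) * indicator ray_domain (b, z) * G (ray b z) \<partial>lborel \<partial>lborel)"
  proof (rule nn_integral_cong, rule nn_integral_cong)
    fix b s :: real
    show "(\<lambda>z. ennreal (density_fun (fst z) (snd z)) * G z) (ray b s) * indicator ray_domain (b, s) * ennreal (2 * b + s) =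
      ennreal (sqrt (1 + b\<^sup>2) * flux b s) * indicator ray_domain (b, s) * G (ray b s)"
    proof (cases "(b, s) \<in> ray_domain")
      case True
      then have "0 \<le> 2 * b + s" by (auto simp: ray_domain_def)
      then have "ennreal (density_fun s (b * s + b\<^sup>2)) * ennreal (2 * b + s) = ennreal (sqrt (1 + b\<^sup>2) * flux b s)"
        using density_fun_ray[OF True] by (metis ennreal_mult'')
      moreover have "ennreal (density_fun s (b * s + b\<^sup>2)) * G (ray b s) * ennreal (2 * b + s) =
          ennreal (density_fun s (b * s + b\<^sup>2)) * ennreal (2 * b + s) * G (ray b s)"
        by (simp add: mult_ac)
      ultimately show ?thesis
        using True by (simp add: ray_def)
    qed simp
  qed
  also have "\<dots> = (\<integral>\<^sup>+z. segment_integral G z \<partial>plan)"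
    unfolding nn_integral_plan[OF measurable_segment_integral[OF assms]] segment_integral_diag
  proof (rule nn_integral_cong_AE, use AE_ray_slope in eventually_elim)
    fix b :: real
    assume good: "0 \<le> b \<and> b < 1 / 2 \<or> (\<forall>s. (b, s) \<notin> ray_domain)"
    have "(\<integral>\<^sup>+z. ennreal (sqrt (1 + b\<^sup>2) * flux b z) * indicator ray_domain (b, z) * G (ray b z) \<partial>lborel) =
      (\<integral>\<^sup>+z. ennreal (sqrt (1 + b\<^sup>2)) * G (ray b z) * ((\<integral>\<^sup>+s. ennreal (ray_source b s) * indicator {..z} s \<partial>lborel) *
      (\<integral>\<^sup>+t. ennreal (ray_target b t) * indicator {z..} t \<partial>lborel) / ray_mass b) \<partial>lborel)"
    proof (rule nn_integral_cong)
      fix z :: real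
      let ?X = "(\<integral>\<^sup>+s. ennreal (ray_source b s) * indicator {..z} s \<partial>lborel) *
        (\<integral>\<^sup>+t. ennreal (ray_target b t) * indicator {z..} t \<partial>lborel) / ray_mass b"
      have "?X = ennreal (flux b z) * indicator ray_domain (b, z)"
      proof (cases "(b, z) \<in> ray_domain")
        case True
        with good have "0 \<le> b" "b < 1 / 2" "0 \<le> z" "z \<le> 1 - 2 * b" by (auto simp: ray_domain_def)
        then have "?X = ennreal (flux b z)"
          by (rule_tac ray_rearrangement[of b]) simp_all
        with True show ?thesis by simp
      next
        case False
        \<comment> \<open>Before the start of a ray nothing has been emitted, beyond its end nothing
          is received, and rays with b < 0 are empty.\<close>
        have "(\<lambda>s. ennreal (ray_source b s) * indicator {..z} s) = (\<lambda>_. 0) \<or>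
          (\<lambda>t. ennreal (ray_target b t) * indicator {z..} t) = (\<lambda>_. 0)"
          using False by (auto simp: ray_source_def ray_target_def ray_domain_def indicator_def fun_eq_iff)
        with False show ?thesis by auto
      qed
      moreover have "ennreal (sqrt (1 + b\<^sup>2) * flux b z) = ennreal (sqrt (1 + b\<^sup>2)) * ennreal (flux b z)"
        by (simp add: ennreal_mult')
      ultimately show "ennreal (sqrt (1 + b\<^sup>2) * flux b z) * indicator ray_domain (b, z) * G (ray b z) =
        ennreal (sqrt (1 + b\<^sup>2)) * G (ray b z) * ?X"
        by (simp add: mult_ac)
    qed
    also have "\<dots> = (\<integral>\<^sup>+s. \<integral>\<^sup>+t. ennreal (ray_source b s) * ennreal (ray_target b t) / ray_mass b *
      (\<integral>\<^sup>+z. ennreal (sqrt (1 + b\<^sup>2)) * G (ray b z) * (indicator {..z} s * indicator {z..} t) \<partial>lborel) \<partial>lborel \<partial>lborel)"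
      unfolding ray_def by (rule ray_coupling_integral[symmetric]) measurable
    also have "\<dots> = (\<integral>\<^sup>+s. \<integral>\<^sup>+t. ennreal (ray_source b s) * ennreal (ray_target b t) / ray_mass b *
      segment_integral G (ray_pt b s, ray_pt b t) \<partial>lborel \<partial>lborel)"
    proof (rule nn_integral_cong, rule nn_integral_cong, rule ray_weight_cong[OF good])
      fix s t assume "(b, s) \<in> ray_domain" "(b, t) \<in> ray_domain" "s \<le> t"
      then show "(\<integral>\<^sup>+z. ennreal (sqrt (1 + b\<^sup>2)) * G (ray b z) * (indicator {..z} s * indicator {z..} t) \<partial>lborel) =
        segment_integral G (ray_pt b s, ray_pt b t)"
        unfolding ray_def
        by (subst segment_integral_ray) (auto simp: mult.assoc ray_def indicator_def intro!: nn_integral_cmult)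
    qed
    finally show "(\<integral>\<^sup>+z. ennreal (sqrt (1 + b\<^sup>2) * flux b z) * indicator ray_domain (b, z) * G (ray b z) \<partial>lborel) =
      (\<integral>\<^sup>+s. \<integral>\<^sup>+t. ennreal (ray_source b s) * ennreal (ray_target b t) / ray_mass b *
        segment_integral G (ray_pt b s, ray_pt b t) \<partial>lborel \<partial>lborel) + (\<integral>\<^sup>+s. ennreal (ray_common b s) * 0 \<partial>lborel)"
      by simp
  qed
  finally show ?thesis .
qed

section \<open>From nonnegative integrands to continuous test functions\<close>

lemma finite_measure_plan: "finite_measure plan"
proof (rule finite_measureI)
  have "emeasure plan (space plan) = (\<integral>\<^sup>+x. ennreal (source x) \<partial>ROm)"
    using nn_integral_plan_fst[of "\<lambda>_. 1"] by simp
  also have "\<dots> \<le> (\<integral>\<^sup>+x. ennreal 22 \<partial>ROm)"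
    using source_le by (intro nn_integral_mono ennreal_leI) auto
  also have "\<dots> < top"
    using emeasure_ROm_finite by (simp add: ennreal_mult_less_top)
  finally show "emeasure plan (space plan) \<noteq> \<infinity>" by simp
qed

lemma space_plan: "space plan = Omega \<times> Omega"
  using sets_eq_imp_space_eq[OF sets_plan] by (simp add: space_pair_measure)

definition sigma_measure :: "point measure" where
  "sigma_measure = density ROm (\<lambda>x. ennreal (sigma_density x))"

text \<open>For the constant 1 the segment integral is the distance, so the total mass of sigma is
  the transport cost, at most twice the mass of \<open>plan\<close>.\<close>

lemma finite_sigma_measure: "finite_measure sigma_measure"
proof (rule finite_measureI)
  interpret P: finite_measure plan by (rule finite_measure_plan)
  have "emeasure sigma_measure (space sigma_measure) = (\<integral>\<^sup>+x. ennreal (sigma_density x) * 1 \<partial>ROm)"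
    unfolding sigma_measure_def using sets.top[of ROm]
    by (subst emeasure_density) (auto intro!: nn_integral_cong)
  also have "\<dots> = (\<integral>\<^sup>+z. segment_integral (\<lambda>_. 1) z \<partial>plan)"
    using sigma_eq_segment_integral[of "\<lambda>_. 1"] by simp
  also have "\<dots> \<le> (\<integral>\<^sup>+z. 2 \<partial>plan)"
  proof (rule nn_integral_mono)
    fix z assume "z \<in> space plan"
    then have "ennreal (edist 2 (fst z) (snd z)) \<le> ennreal 2"
      by (intro ennreal_leI edist_le_2) (auto simp: space_plan)
    moreover have "segment_integral (\<lambda>_. 1) z = ennreal (edist 2 (fst z) (snd z))"
      by (simp add: segment_integral_def nn_integral_cmult_indicator)
    ultimately show "segment_integral (\<lambda>_. 1) z \<le> 2" by simp
  qed
  also have "\<dots> < top"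
    using P.emeasure_finite[of "space plan", unfolded less_top] by (simp add: ennreal_mult_less_top)
  finally show "emeasure sigma_measure (space sigma_measure) \<noteq> \<infinity>" by simp
qed

text \<open>The images in the plane of sigma and of the length-weighted measure on
  \<open>plan\<close> times the time interval agree on Borel sets by the previous identity. Bounded
  Borel functions then have equal integrals, and finiteness justifies Fubini.\<close>

lemma integral_sigma_measure:
  fixes \<psi> :: "real \<times> real \<Rightarrow> real"
  assumes \<psi> [measurable]: "\<psi> \<in> borel_measurable borel" and bound: "\<And>z. \<bar>\<psi> z\<bar> \<le> C"
  shows "(LINT x|sigma_measure. \<psi> (x 0, x (Suc 0))) =
    (LINT z|plan. LINT t|lborel. (edist 2 (fst z) (snd z) * indicator {0..1} t) * \<psi> (seg z t))"
proof -
  interpret P: finite_measure plan by (rule finite_measure_plan)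
  interpret S: finite_measure sigma_measure by (rule finite_sigma_measure)
  interpret PL: pair_sigma_finite plan "lborel :: real measure" ..
  define k where "k = (\<lambda>p :: (point \<times> point) \<times> real. edist 2 (fst (fst p)) (snd (fst p)) * indicator {0..1} (snd p))"
  define g where "g = (\<lambda>p :: (point \<times> point) \<times> real. seg (fst p) (snd p))"
  have sets: "sets (plan \<Otimes>\<^sub>M (lborel :: real measure)) = sets ((ROm \<Otimes>\<^sub>M ROm) \<Otimes>\<^sub>M lborel)"
    by (rule sets_pair_measure_cong[OF sets_plan refl])
  have [measurable]: "(\<lambda>p. edist 2 (fst (fst p)) (snd (fst p))) \<in> borel_measurable (plan \<Otimes>\<^sub>M (lborel :: real measure))"
    unfolding measurable_cong_sets[OF sets refl] by (rule measurable_compose[OF measurable_fst]) measurable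
  have [measurable]: "k \<in> borel_measurable (plan \<Otimes>\<^sub>M lborel)"
    unfolding k_def by measurable
  have [measurable]: "g \<in> borel_measurable (plan \<Otimes>\<^sub>M lborel)"
    using measurable_seg unfolding measurable_cong_sets[OF sets refl] g_def by (simp add: split_beta)
  have k0: "0 \<le> k p" for p by (simp add: k_def edist_nonneg)
  have [measurable]: "(\<lambda>x. (x 0, x (Suc 0))) \<in> measurable sigma_measure borel"
    unfolding sigma_measure_def using measurable_coord_ROm by measurable
  have [measurable]: "(\<lambda>x. (x 0, x (Suc 0))) \<in> measurable ROm borel"
    using measurable_coord_ROm by measurable
  define D where "D = density (plan \<Otimes>\<^sub>M lborel) (\<lambda>p. ennreal (k p))"
  have [measurable]: "g \<in> measurable D borel" by (simp add: D_def)
  have eq: "distr sigma_measure borel (\<lambda>x. (x 0, x (Suc 0))) = distr D borel g"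
  proof (rule measure_eqI)
    fix A assume "A \<in> sets (distr sigma_measure borel (\<lambda>x. (x 0, x (Suc 0))))"
    then have [measurable]: "A \<in> sets borel" by simp
    have "emeasure (distr sigma_measure borel (\<lambda>x. (x 0, x (Suc 0)))) A =
        (\<integral>\<^sup>+x. indicator A x \<partial>distr sigma_measure borel (\<lambda>x. (x 0, x (Suc 0))))" by simp
    also have "\<dots> = (\<integral>\<^sup>+x. indicator A (x 0, x (Suc 0)) \<partial>sigma_measure)"
      by (subst nn_integral_distr) simp_all
    also have "\<dots> = (\<integral>\<^sup>+x. ennreal (sigma_density x) * indicator A (x 0, x (Suc 0)) \<partial>ROm)"
      unfolding sigma_measure_def by (subst nn_integral_density) simp_all
    also have "\<dots> = (\<integral>\<^sup>+z. segment_integral (indicator A) z \<partial>plan)"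
      by (rule sigma_eq_segment_integral) measurable
    also have "\<dots> = (\<integral>\<^sup>+z. \<integral>\<^sup>+t. ennreal (k (z, t)) * indicator A (g (z, t)) \<partial>lborel \<partial>plan)"
      unfolding segment_integral_def k_def g_def
      by (intro nn_integral_cong) (auto simp: indicator_def)
    also have "\<dots> = (\<integral>\<^sup>+p. ennreal (k p) * indicator A (g p) \<partial>(plan \<Otimes>\<^sub>M lborel))"
      by (rule lborel.nn_integral_fst) measurable
    also have "\<dots> = (\<integral>\<^sup>+p. indicator A (g p) \<partial>D)"
      unfolding D_def by (subst nn_integral_density) measurable
    also have "\<dots> = (\<integral>\<^sup>+x. indicator A x \<partial>distr D borel g)"
      by (subst nn_integral_distr) simp_all
    also have "\<dots> = emeasure (distr D borel g) A" by simp
    finally show "emeasure (distr sigma_measure borel (\<lambda>x. (x 0, x (Suc 0)))) A = emeasure (distr D borel g) A" .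
  qed simp
  have "integrable sigma_measure (\<lambda>x. \<psi> (x 0, x (Suc 0)))"
    using bound by (intro S.integrable_const_bound[of _ C]) auto
  then have "integrable (distr D borel g) \<psi>"
    unfolding eq[symmetric] by (subst integrable_distr_eq) simp_all
  then have "integrable D (\<lambda>p. \<psi> (g p))"
    by (subst (asm) integrable_distr_eq) simp_all
  then have int: "integrable (plan \<Otimes>\<^sub>M lborel) (\<lambda>p. k p * \<psi> (g p))"
    unfolding D_def using k0 by (subst (asm) integrable_real_density) simp_all
  have "(LINT x|sigma_measure. \<psi> (x 0, x (Suc 0))) = (LINT z|distr sigma_measure borel (\<lambda>x. (x 0, x (Suc 0))). \<psi> z)"
    by (subst integral_distr) simp_all
  also have "\<dots> = (LINT p|D. \<psi> (g p))"
    unfolding eq by (subst integral_distr) simp_all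
  also have "\<dots> = (LINT p|(plan \<Otimes>\<^sub>M lborel). k p * \<psi> (g p))"
    unfolding D_def using k0 by (subst integral_real_density) simp_all
  also have "\<dots> = (LINT z|plan. LINT t|lborel. k (z, t) * \<psi> (g (z, t)))"
    by (rule PL.integral_fst'[OF int, symmetric])
  finally show ?thesis by (simp add: k_def g_def)
qed

text \<open>A continuous function on \<open>Omega\<close> is extended by zero to a bounded Borel
  function of the plane; the segments stay in the convex region, so the extension is invisible to
  both integrals.\<close>

lemma is_transport_density_sigma: "is_transport_density 2 Omega source target sigma_density"
  unfolding is_transport_density_def transport_density_measure_def
proof (intro conjI exI[of _ plan] allI impI ballI)
  show "sigma_density \<in> borel_measurable ROm" by measurable
  show "sets (density ROm (\<lambda>x. ennreal (sigma_density x))) = sets ROm" by simp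
  show "finite_measure (density ROm (\<lambda>x. ennreal (sigma_density x)))"
    using finite_sigma_measure by (simp add: sigma_measure_def)
  show "optimal_plan 2 Omega source target plan" by (rule optimal_plan_plan)
  fix \<phi> assume \<phi>: "continuous_in 2 Omega \<phi>"
  let ?f = "\<lambda>z. \<phi> (pt (fst z) (snd z))"
  have "continuous_map (top_of_set region) (subtopology (Rtop 2) Omega) (\<lambda>z. pt (fst z) (snd z))"
    unfolding continuous_map_in_subtopology
    by (auto intro: continuous_map_from_subtopology continuous_map_pt)
  from continuous_map_compose[OF this \<phi>[unfolded continuous_in_def]]
  have cont: "continuous_on region ?f" by (simp add: o_def)
  then have "bounded (?f ` region)"
    by (intro compact_imp_bounded compact_continuous_image compact_region)
  then obtain C where C: "\<And>z. z \<in> region \<Longrightarrow> \<bar>?f z\<bar> \<le> C"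
    by (auto simp: bounded_iff)
  define \<psi> where "\<psi> z = indicator region z *\<^sub>R ?f z" for z
  have "\<psi> \<in> borel_measurable borel"
    unfolding \<psi>_def by (rule borel_measurable_continuous_on_indicator[OF region_sets cont])
  moreover have "\<bar>\<psi> z\<bar> \<le> max 0 C" for z
    using C[of z] by (auto simp: \<psi>_def indicator_def)
  ultimately have main: "(LINT x|sigma_measure. \<psi> (x 0, x (Suc 0))) =
    (LINT z|plan. LINT t|lborel. (edist 2 (fst z) (snd z) * indicator {0..1} t) * \<psi> (seg z t))"
    by (rule integral_sigma_measure)
  have "(LINT x|density ROm (\<lambda>x. ennreal (sigma_density x)). \<phi> x) = (LINT x|sigma_measure. \<psi> (x 0, x (Suc 0)))"
    unfolding sigma_measure_def[symmetric]
    by (intro Bochner_Integration.integral_cong) (auto simp: sigma_measure_def \<psi>_def Omega_iff pt_surj)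
  also note main
  also have "(LINT z|plan. LINT t|lborel. (edist 2 (fst z) (snd z) * indicator {0..1} t) * \<psi> (seg z t)) =
      (LINT (x, y)|plan. (LINT t:{0..1}|lborel. \<phi> (segment_point 2 x y t) * edist 2 x y))"
    unfolding set_lebesgue_integral_def case_prod_unfold
  proof (intro Bochner_Integration.integral_cong refl)
    fix z t assume "z \<in> space plan"
    then have z: "fst z \<in> Omega" "snd z \<in> Omega" by (auto simp: space_plan)
    show "(edist 2 (fst z) (snd z) * indicator {0..1} t) * \<psi> (seg z t) =
      indicator {0..1} t *\<^sub>R (\<phi> (segment_point 2 (fst z) (snd z) t) * edist 2 (fst z) (snd z))"
      using z region_segment[of "fst z 0" "fst z (Suc 0)" "snd z 0" "snd z (Suc 0)" t]
      by (auto simp: indicator_def \<psi>_def seg_def segment_point_pt Omega_iff)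
  qed
  finally show "(LINT x|density ROm (\<lambda>x. ennreal (sigma_density x)). \<phi> x) =
      (LINT (x, y)|plan. (LINT t:{0..1}|lborel. \<phi> (segment_point 2 x y t) * edist 2 x y))" .
qed (auto intro: sigma_nonneg)

text \<open>Both sides are the total mass of \<open>plan\<close>.\<close>

lemma source_target_same_mass: "(LINT x:Omega|Rleb 2. source x) = (LINT x:Omega|Rleb 2. target x)"
proof -
  have "(LINT x:Omega|Rleb 2. f x) = enn2real (\<integral>\<^sup>+x. ennreal (f x) * 1 \<partial>ROm)"
    if [measurable]: "f \<in> borel_measurable ROm" and "\<And>x. x \<in> Omega \<Longrightarrow> 0 \<le> f x" for f
  proof -
    have "(LINT x:Omega|Rleb 2. f x) = (LINT x|ROm. f x)"
      using Omega_subset_space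
      by (subst integral_restrict_space) (auto simp: set_lebesgue_integral_def Int_absorb2)
    also have "\<dots> = enn2real (\<integral>\<^sup>+x. ennreal (f x) \<partial>ROm)"
      using that by (intro integral_eq_nn_integral) auto
    finally show ?thesis by simp
  qed
  then show ?thesis
    using nn_integral_plan_fst[of "\<lambda>_. 1"] nn_integral_plan_snd[of "\<lambda>_. 1"] source_nonneg
    by (simp add: target_def)
qed

section \<open>Failure of the Sobolev bound at the origin\<close>

definition bump :: "real \<Rightarrow> real" where
  "bump t = flat_exp 0 (t - 1) * flat_exp 0 (2 - t)"

definition bump' :: "real \<Rightarrow> real" where
  "bump' t = flat_exp 2 (t - 1) * flat_exp 0 (2 - t) - flat_exp 0 (t - 1) * flat_exp 2 (2 - t)"

lemma bump_has_derivative: "(bump has_real_derivative bump' t) (at t)"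
proof -
  have "((\<lambda>t. flat_exp 0 (t - 1)) has_real_derivative (flat_exp (0 + 2) (t - 1) - real 0 * flat_exp (0 + 1) (t - 1)) * 1) (at t)"
    by (rule DERIV_chain2[OF flat_exp_has_derivative]) (auto intro!: derivative_eq_intros)
  moreover have "((\<lambda>t. flat_exp 0 (2 - t)) has_real_derivative (flat_exp (0 + 2) (2 - t) - real 0 * flat_exp (0 + 1) (2 - t)) * (-1)) (at t)"
    by (rule DERIV_chain2[OF flat_exp_has_derivative]) (auto intro!: derivative_eq_intros)
  ultimately have "((\<lambda>t. flat_exp 0 (t - 1) * flat_exp 0 (2 - t)) has_real_derivative
      (flat_exp (0 + 2) (t - 1) - real 0 * flat_exp (0 + 1) (t - 1)) * 1 * flat_exp 0 (2 - t) +
      (flat_exp (0 + 2) (2 - t) - real 0 * flat_exp (0 + 1) (2 - t)) * (-1) * flat_exp 0 (t - 1)) (at t)"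
    by (rule DERIV_mult)
  then show ?thesis
    by (simp add: bump_def[abs_def] bump'_def mult.commute numeral_2_eq_2)
qed

lemma continuous_bump: "continuous_on A bump"
  by (meson DERIV_isCont continuous_at_imp_continuous_on bump_has_derivative)

lemma continuous_bump': "continuous_on A bump'"
  unfolding bump'_def
  by (intro continuous_intros continuous_on_compose2[OF continuous_on_flat_exp[of UNIV]]) auto

lemma measurable_bump [measurable]: "bump \<in> borel_measurable borel" "bump' \<in> borel_measurable borel"
  by (intro borel_measurable_continuous_onI continuous_bump continuous_bump')+

lemma bump_support: "t \<notin> {1..2} \<Longrightarrow> bump t = 0" "t \<notin> {1..2} \<Longrightarrow> bump' t = 0"
  by (auto simp: bump_def bump'_def flat_exp_def)

lemma bump_bounds: "0 \<le> bump t" "bump t \<le> 1"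
  by (auto simp: bump_def flat_exp_def intro!: mult_le_one)

lemma bump'_bound: obtains C where "0 \<le> C" "\<And>t. \<bar>bump' t\<bar> \<le> C"
proof -
  have "bounded (bump' ` {1..2})"
    by (intro compact_imp_bounded compact_continuous_image continuous_bump') auto
  then obtain C where "\<forall>y\<in>bump' ` {1..2}. norm y \<le> C"
    unfolding bounded_iff by blast
  then have C: "\<And>t. t \<in> {1..2} \<Longrightarrow> \<bar>bump' t\<bar> \<le> C" by simp
  have "\<bar>bump' t\<bar> \<le> max 0 C" for t
    using C[of t] bump_support(2)[of t] by (cases "t \<in> {1..2}") auto
  then show ?thesis using that[of "max 0 C"] by simp
qed

lemma integrable_bump: "integrable lborel bump"
proof -
  have "integrable lborel (\<lambda>t. indicator {1..2} t *\<^sub>R bump t)"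
    using borel_integrable_atLeastAtMost'[OF continuous_bump] by (simp add: set_integrable_def)
  also have "(\<lambda>t. indicator {1..2} t *\<^sub>R bump t) = bump"
    using bump_support(1) by (auto simp: fun_eq_iff indicator_def)
  finally show ?thesis .
qed

lemma integral_bump_pos: "0 < (LINT t|lborel. bump t)"
proof -
  \<comment> \<open>On this interval t - 1 and 2 - t are at least 1/4, so each factor is at least
    exp(-4).\<close>
  have ge: "indicator {5 / 4..7 / 4} t * exp (- 8) \<le> bump t" for t :: real
  proof (cases "t \<in> {5 / 4..7 / 4}")
    case True
    then have "- 4 \<le> - (1 / (t - 1))" "- 4 \<le> - (1 / (2 - t))"
      by (auto simp: field_simps)
    then have "exp (- 4) * exp (- 4) \<le> exp (- (1 / (t - 1))) * exp (- (1 / (2 - t)))"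
      by (intro mult_mono) auto
    then show ?thesis
      using True by (simp add: bump_def flat_exp_def flip: exp_add)
  qed (simp add: bump_bounds)
  have int: "integrable lborel (\<lambda>t. indicator {5 / 4..7 / 4 :: real} t * exp (- 8 :: real))"
    using borel_integrable_atLeastAtMost'[OF continuous_on_const, of "5 / 4" "7 / 4" "exp (- 8 :: real)"]
    by (simp add: set_integrable_def)
  have "0 < 1 / 2 * exp (- 8 :: real)" by simp
  also have "\<dots> = (LINT t|lborel. indicator {5 / 4..7 / 4 :: real} t * exp (- 8))"
    by simp
  also have "\<dots> \<le> (LINT t|lborel. bump t)"
    by (rule integral_mono[OF _ integrable_bump ge]) (use int in simp)
  finally show ?thesis .
qed

section \<open>Parabolic rescaling at the origin\<close>

definition scaled_density :: "real \<Rightarrow> real \<Rightarrow> real \<Rightarrow> real" where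
  "scaled_density h a b = (let W = sqrt (a\<^sup>2 + 4 * b) in
     sqrt (1 + (h * (W - a) / 2)\<^sup>2) * (a * (1 - (h * W)\<^sup>2) *
       ((1 - (h * W)\<^sup>2) * (2 * W - a) + 4 * a * (h * W)\<^sup>2)) / W)"

text \<open>Under (a, b) -> (h a, h^2 b) the slope and w scale by h and the flux by h^2. The
  quotient left over is continuous up to h = 0, where it equals 2a - a^2 / W.\<close>

lemma density_fun_scale:
  assumes "0 < h" "0 < a" "0 < b"
  shows "density_fun (h * a) (h\<^sup>2 * b) = h * scaled_density h a b"
proof -
  define W where "W = sqrt (a\<^sup>2 + 4 * b)"
  have W: "0 < W" using assms by (simp add: W_def add_pos_pos)
  have "(h * a)\<^sup>2 + 4 * (h\<^sup>2 * b) = h\<^sup>2 * (a\<^sup>2 + 4 * b)"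
    by (simp add: algebra_simps power2_eq_square)
  then have w: "sqrt ((h * a)\<^sup>2 + 4 * (h\<^sup>2 * b)) = h * W"
    using assms by (simp add: real_sqrt_mult W_def)
  have sl: "slope (h * a) (h\<^sup>2 * b) = h * (W - a) / 2"
    unfolding slope_def w by (simp add: algebra_simps)
  have *: "2 * (h * (W - a) / 2) + h * a = h * W" by (simp add: field_simps)
  define K where "K = a * (1 - (h * W)\<^sup>2) * ((1 - (h * W)\<^sup>2) * (2 * W - a) + 4 * a * (h * W)\<^sup>2)"
  have "flux (h * (W - a) / 2) (h * a) = h * (h * K)"
    unfolding flux_def * K_def by (simp add: algebra_simps)
  then show ?thesis
    unfolding density_fun_def sl w scaled_density_def Let_def W_def[symmetric] K_def[symmetric]
    using assms W by simp
qed

lemma measurable_scaled_density [measurable]: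
  "(\<lambda>z. scaled_density h (fst z) (snd z)) \<in> borel_measurable (lborel \<Otimes>\<^sub>M lborel)"
  unfolding scaled_density_def Let_def by measurable

text \<open>W stays away from 0 on the unit box [1, 2] x [1, 2], so compactness gives a bound
  uniform down to h = 0.\<close>

lemma scaled_density_bound:
  obtains C where "0 \<le> C"
    "\<And>h a b. 0 \<le> h \<Longrightarrow> h \<le> 1 / 4 \<Longrightarrow> a \<in> {1..2} \<Longrightarrow> b \<in> {1..2} \<Longrightarrow> \<bar>scaled_density h a b\<bar> \<le> C"
proof -
  let ?K = "{0..1 / 4} \<times> {1..2} \<times> {1..2 :: real} :: (real \<times> real \<times> real) set"
  let ?f = "\<lambda>p :: real \<times> real \<times> real. scaled_density (fst p) (fst (snd p)) (snd (snd p))"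
  have "continuous_on ?K ?f"
    unfolding scaled_density_def Let_def
    by (intro continuous_intros) (auto simp: add_nonneg_pos less_imp_neq[symmetric])
  then have "bounded (?f ` ?K)"
    by (intro compact_imp_bounded compact_continuous_image compact_Times) auto
  then obtain C where "\<forall>y\<in>?f ` ?K. norm y \<le> C"
    unfolding bounded_iff by blast
  then have C: "\<bar>?f p\<bar> \<le> C" if "p \<in> ?K" for p
    using imageI[OF that, of ?f] by (simp only: real_norm_def)
  have "\<bar>scaled_density h a b\<bar> \<le> max 0 C"
    if "0 \<le> h" "h \<le> 1 / 4" "a \<in> {1..2}" "b \<in> {1..2}" for h a b
    using C[of "(h, a, b)"] that by auto
  then show ?thesis using that[of "max 0 C"] by simp
qed

text \<open>The rescaled form of the integral of sigma against the y-derivative of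
  \<open>test_bump h\<close>; unlike that integral it also makes sense at h = 0.\<close>

definition pairing :: "real \<Rightarrow> real" where
  "pairing h = (LINT z|(lborel \<Otimes>\<^sub>M lborel). scaled_density h (fst z) (snd z) * bump (fst z) * bump' (snd z))"

lemma integrable_square_indicator:
  "integrable (lborel \<Otimes>\<^sub>M lborel) (\<lambda>z :: real \<times> real. C * indicator ({a..b} \<times> {c..d}) z :: real)"
proof -
  have "emeasure (lborel \<Otimes>\<^sub>M lborel) ({a..b} \<times> {c..d}) = emeasure lborel {a..b} * emeasure lborel {c..d :: real}"
    by (rule lborel.emeasure_pair_measure_Times) auto
  also have "\<dots> < \<infinity>"
    by (auto simp: emeasure_lborel_Icc_eq ennreal_mult_less_top)
  finally show ?thesis
    by (intro integrable_mult_right integrable_real_indicator) auto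
qed

lemma pairing_integrand_bound:
  obtains C where "\<And>h z. 0 \<le> h \<Longrightarrow> h \<le> 1 / 4 \<Longrightarrow>
    \<bar>scaled_density h (fst z) (snd z) * bump (fst z) * bump' (snd z)\<bar> \<le> C * indicator ({1..2} \<times> {1..2}) z"
proof -
  obtain C1 where C1: "0 \<le> C1"
    "\<And>h a b. 0 \<le> h \<Longrightarrow> h \<le> 1 / 4 \<Longrightarrow> a \<in> {1..2} \<Longrightarrow> b \<in> {1..2} \<Longrightarrow> \<bar>scaled_density h a b\<bar> \<le> C1"
    using scaled_density_bound by blast
  obtain C2 where C2: "0 \<le> C2" "\<And>t. \<bar>bump' t\<bar> \<le> C2"
    using bump'_bound by blast
  have "\<bar>scaled_density h (fst z) (snd z) * bump (fst z) * bump' (snd z)\<bar> \<le> (C1 * 1 * C2) * indicator ({1..2} \<times> {1..2}) z"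
    if h: "0 \<le> h" "h \<le> 1 / 4" for h z
  proof (cases "z \<in> {1..2} \<times> {1..2}")
    case True
    then have "\<bar>scaled_density h (fst z) (snd z)\<bar> * \<bar>bump (fst z)\<bar> * \<bar>bump' (snd z)\<bar> \<le> C1 * 1 * C2"
      using C1(1) C2 h bump_bounds by (intro mult_mono C1(2) C2(2)) auto
    with True show ?thesis by (simp add: abs_mult)
  next
    case False
    then have "bump (fst z) = 0 \<or> bump' (snd z) = 0"
      using bump_support by (cases z) fastforce
    with False show ?thesis by auto
  qed
  then show ?thesis using that by blast
qed

lemma integrable_pairing:
  assumes "0 \<le> h" "h \<le> 1 / 4"
  shows "integrable (lborel \<Otimes>\<^sub>M lborel) (\<lambda>z. scaled_density h (fst z) (snd z) * bump (fst z) * bump' (snd z))"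
proof -
  obtain C where C: "\<And>h z. 0 \<le> h \<Longrightarrow> h \<le> 1 / 4 \<Longrightarrow>
    \<bar>scaled_density h (fst z) (snd z) * bump (fst z) * bump' (snd z)\<bar> \<le> C * indicator ({1..2} \<times> {1..2}) z"
    using pairing_integrand_bound by blast
  have "norm (scaled_density h (fst z) (snd z) * bump (fst z) * bump' (snd z)) \<le> norm (C * indicator ({1..2} \<times> {1..2}) z)" for z
    using C[OF assms, of z] unfolding real_norm_def by linarith
  then show ?thesis
    by (intro Bochner_Integration.integrable_bound[OF integrable_square_indicator[of C 1 2 1 2]] AE_I2) (simp, blast)
qed

text \<open>Dominated convergence; pointwise convergence is needed only on the unit box, where W is
  nonzero.\<close>

lemma pairing_tendsto:
  assumes "\<And>n. 0 \<le> h n" "\<And>n. h n \<le> 1 / 4" "h \<longlonglongrightarrow> 0"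
  shows "(\<lambda>n. pairing (h n)) \<longlonglongrightarrow> pairing 0"
proof -
  obtain C where C: "\<And>h z. 0 \<le> h \<Longrightarrow> h \<le> 1 / 4 \<Longrightarrow>
    \<bar>scaled_density h (fst z) (snd z) * bump (fst z) * bump' (snd z)\<bar> \<le> C * indicator ({1..2} \<times> {1..2}) z"
    using pairing_integrand_bound by blast
  show ?thesis
    unfolding pairing_def
  proof (rule integral_dominated_convergence[where w = "\<lambda>z. C * indicator ({1..2} \<times> {1..2}) z"])
    show "AE z in lborel \<Otimes>\<^sub>M lborel. (\<lambda>n. scaled_density (h n) (fst z) (snd z) * bump (fst z) * bump' (snd z))
        \<longlonglongrightarrow> scaled_density 0 (fst z) (snd z) * bump (fst z) * bump' (snd z)"
    proof (rule AE_I2)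
      fix z :: "real \<times> real"
      show "(\<lambda>n. scaled_density (h n) (fst z) (snd z) * bump (fst z) * bump' (snd z))
        \<longlonglongrightarrow> scaled_density 0 (fst z) (snd z) * bump (fst z) * bump' (snd z)"
      proof (cases "z \<in> {1..2} \<times> {1..2}")
        case True
        then have "sqrt ((fst z)\<^sup>2 + 4 * snd z) \<noteq> 0"
          by (auto simp: add_nonneg_pos less_imp_neq[symmetric])
        then have "continuous_on UNIV (\<lambda>h. scaled_density h (fst z) (snd z))"
          unfolding scaled_density_def Let_def by (intro continuous_intros) auto
        then have "isCont (\<lambda>h. scaled_density h (fst z) (snd z)) 0"
          by (simp add: continuous_on_eq_continuous_at)
        then show ?thesis
          by (intro tendsto_mult tendsto_const isCont_tendsto_compose[OF _ assms(3)])
      next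
        case False
        then have "bump (fst z) = 0 \<or> bump' (snd z) = 0"
          using bump_support by (cases z) fastforce
        then show ?thesis by auto
      qed
    qed
    show "AE z in lborel \<Otimes>\<^sub>M lborel. norm (scaled_density (h n) (fst z) (snd z) * bump (fst z) * bump' (snd z))
        \<le> C * indicator ({1..2} \<times> {1..2}) z" for n
      using C[OF assms(1,2)] by (intro AE_I2) simp
  qed (rule integrable_square_indicator | simp)+
qed

text \<open>Integration by parts in b: the derivative of 2a - a^2 / W is 2 a^2 / W^3, and the
  boundary terms vanish with the bump. A positive lower bound for this derivative is what makes the
  limit nonzero.\<close>

lemma inner_pairing_le:
  assumes a: "a \<in> {1..2}"
  shows "(LINT b|lborel. scaled_density 0 a b * bump' b) \<le> - (1 / 30) * (LINT b|lborel. bump b)"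
proof -
  define W where "W b = sqrt (a\<^sup>2 + 4 * b)" for b
  have W: "0 < W b" if "b \<in> {1..2}" for b
    using that a by (auto simp: W_def intro!: add_nonneg_pos)
  have sd: "scaled_density 0 a b = 2 * a - a\<^sup>2 / W b" if "b \<in> {1..2}" for b
    using W[OF that] unfolding scaled_density_def Let_def W_def[symmetric]
    by (simp add: field_simps power2_eq_square)
  define k where "k b = (2 * a - a\<^sup>2 / W b) * bump b" for b
  define m where "m b = 2 * a\<^sup>2 / W b ^ 3" for b
  define k' where "k' b = m b * bump b + (2 * a - a\<^sup>2 / W b) * bump' b" for b
  have dW: "(W has_real_derivative 2 / W b) (at b)" if b: "b \<in> {1..2}" for b
  proof -
    have "0 < a\<^sup>2 + 4 * b" using W[OF b] by (simp add: W_def)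
    moreover have "((\<lambda>b. a\<^sup>2 + 4 * b) has_real_derivative 4) (at b)"
      by (auto intro!: derivative_eq_intros)
    ultimately have "((\<lambda>b. sqrt (a\<^sup>2 + 4 * b)) has_real_derivative inverse (sqrt (a\<^sup>2 + 4 * b)) / 2 * 4) (at b)"
      by (intro DERIV_chain2[OF DERIV_real_sqrt])
    moreover have "inverse (sqrt (a\<^sup>2 + 4 * b)) / 2 * 4 = 2 / sqrt (a\<^sup>2 + 4 * b)"
      by (simp add: inverse_eq_divide)
    ultimately show ?thesis by (simp only: W_def[abs_def])
  qed
  have dk: "(k has_real_derivative k' b) (at b)" if b: "b \<in> {1..2}" for b
  proof -
    have "((\<lambda>b. 2 * a - a\<^sup>2 / W b) has_real_derivative m b) (at b)"
      using W[OF b] unfolding m_def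
      by (auto intro!: derivative_eq_intros dW[OF b] simp: field_simps power2_eq_square power3_eq_cube)
    from DERIV_mult[OF this bump_has_derivative] show ?thesis
      by (simp add: k_def[abs_def] k'_def algebra_simps)
  qed
  have contW: "continuous_on {1..2} W" unfolding W_def by (intro continuous_intros)
  have Wne: "\<forall>b\<in>{1..2}. W b \<noteq> 0" using W by force
  have cont: "continuous_on {1..2} (\<lambda>b. m b * bump b)" "continuous_on {1..2} (\<lambda>b. (2 * a - a\<^sup>2 / W b) * bump' b)"
    unfolding m_def using contW Wne by (auto intro!: continuous_intros continuous_bump continuous_bump')
  have int: "set_integrable lborel {1..2} (\<lambda>b. m b * bump b)" "set_integrable lborel {1..2} (\<lambda>b. (2 * a - a\<^sup>2 / W b) * bump' b)"
    by (intro borel_integrable_atLeastAtMost' cont)+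
  have "(LBINT b:{1..2}. k' b) = k 2 - k 1"
    unfolding set_lebesgue_integral_def
  proof (rule integral_FTC_Icc)
    show "(k has_vector_derivative k' b) (at b within {1..2})" if "1 \<le> b" "b \<le> 2" for b
      using dk[of b] that by (simp add: has_real_derivative_iff_has_vector_derivative has_vector_derivative_at_within)
    show "continuous_on {1..2} k'" unfolding k'_def by (intro continuous_on_add cont)
  qed simp
  also have "\<dots> = 0" by (simp add: k_def bump_def flat_exp_def)
  finally have "(LBINT b:{1..2}. m b * bump b) + (LBINT b:{1..2}. (2 * a - a\<^sup>2 / W b) * bump' b) = 0"
    unfolding k'_def using int by (subst (asm) set_integral_add) auto
  moreover have "(LBINT b:{1..2}. (2 * a - a\<^sup>2 / W b) * bump' b) = (LINT b|lborel. scaled_density 0 a b * bump' b)"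
    unfolding set_lebesgue_integral_def
    using sd bump_support(2) by (intro Bochner_Integration.integral_cong) (auto simp: indicator_def)
  moreover have "1 / 30 * (LINT b|lborel. bump b) \<le> (LBINT b:{1..2}. m b * bump b)"
  proof -
    have "1 / 30 * (LINT b|lborel. bump b) = (LINT b|lborel. 1 / 30 * bump b)" by simp
    also have "\<dots> \<le> (LINT b|lborel. indicator {1..2} b *\<^sub>R (m b * bump b))"
    proof (rule integral_mono)
      show "integrable lborel (\<lambda>b. 1 / 30 * bump b)" using integrable_bump by simp
      show "integrable lborel (\<lambda>b. indicator {1..2} b *\<^sub>R (m b * bump b))"
        using int(1) by (simp add: set_integrable_def)
      fix b :: real
      show "1 / 30 * bump b \<le> indicator {1..2} b *\<^sub>R (m b * bump b)"
      proof (cases "b \<in> {1..2}")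
        case True
        \<comment> \<open>W^2 <= 12 < (15/4)^2 gives W^3 <= 60, and 2 a^2 / 60 >= 1/30 since a >=
          1.\<close>
        have "a\<^sup>2 + 4 * b \<le> 2\<^sup>2 + 4 * 2"
          using a True by (intro add_mono power_mono) auto
        also have "\<dots> \<le> (15 / 4)\<^sup>2" by (simp add: power2_eq_square)
        finally have "W b \<le> 15 / 4" unfolding W_def by (intro real_le_lsqrt) auto
        then have "W b ^ 3 \<le> (15 / 4) ^ 3" using W[OF True] by (intro power_mono) auto
        also have "\<dots> \<le> 60" by (simp add: power3_eq_cube)
        finally have "W b ^ 3 \<le> 60 * 1\<^sup>2" by simp
        also have "\<dots> \<le> 60 * a\<^sup>2" using a by (intro mult_left_mono power_mono) auto
        finally have "1 / 30 \<le> m b" using W[OF True] by (simp add: m_def field_simps)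
        then have "1 / 30 * bump b \<le> m b * bump b" using bump_bounds by (intro mult_right_mono)
        with True show ?thesis by simp
      qed (simp add: bump_support)
    qed
    finally show ?thesis by (simp add: set_lebesgue_integral_def)
  qed
  ultimately show ?thesis by linarith
qed

lemma pairing_0_neg: "pairing 0 < 0"
proof -
  define B where "B = (LINT b|lborel. bump b)"
  have B: "0 < B" using integral_bump_pos by (simp add: B_def)
  let ?f = "\<lambda>z. scaled_density 0 (fst z) (snd z) * bump (fst z) * bump' (snd z)"
  have int: "integrable (lborel \<Otimes>\<^sub>M lborel) ?f" by (rule integrable_pairing) auto
  have inner: "(LINT b|lborel. ?f (a, b)) = bump a * (LINT b|lborel. scaled_density 0 a b * bump' b)" for a
  proof -
    have "(LINT b|lborel. ?f (a, b)) = (LINT b|lborel. bump a * (scaled_density 0 a b * bump' b))"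
      by (intro Bochner_Integration.integral_cong) auto
    then show ?thesis by simp
  qed
  have "pairing 0 = (LINT a|lborel. LINT b|lborel. ?f (a, b))"
    unfolding pairing_def by (rule lborel_pair.integral_fst'[OF int, symmetric])
  also have "\<dots> \<le> (LINT a|lborel. bump a * (- (1 / 30) * B))"
  proof (rule integral_mono)
    show "integrable lborel (\<lambda>a. LINT b|lborel. ?f (a, b))" by (rule lborel_pair.integrable_fst'[OF int])
    show "integrable lborel (\<lambda>a. bump a * (- (1 / 30) * B))" using integrable_bump by simp
    show "(LINT b|lborel. ?f (a, b)) \<le> bump a * (- (1 / 30) * B)" for a
    proof (cases "a \<in> {1..2}")
      case True
      show ?thesis
        unfolding inner B_def by (intro mult_left_mono inner_pairing_le True bump_bounds)
    qed (simp add: bump_support)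
  qed
  also have "\<dots> = - (1 / 30) * B * B" by (simp add: B_def)
  also have "\<dots> < 0" using B by simp
  finally show ?thesis .
qed

text \<open>The factor h^(-2) keeps the L^(3/2) norm independent of h, as the box has volume h^3. It
  also balances the pairing: h from sigma, h^(-4) from the differentiated bump and h^3 from the
  volume.\<close>

definition test_bump :: "real \<Rightarrow> point \<Rightarrow> real" where
  "test_bump h x = 1 / h\<^sup>2 * bump (x 0 / h) * bump (x (Suc 0) / h\<^sup>2)"

definition support_box :: "real \<Rightarrow> point set" where
  "support_box h = (\<lambda>z. pt (fst z) (snd z)) ` ({h..2 * h} \<times> {h\<^sup>2..2 * h\<^sup>2})"

lemma support_box_iff:
  assumes "x \<in> extensional {..<2}"
  shows "x \<in> support_box h \<longleftrightarrow> x 0 \<in> {h..2 * h} \<and> x (Suc 0) \<in> {h\<^sup>2..2 * h\<^sup>2}"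
proof
  assume "x 0 \<in> {h..2 * h} \<and> x (Suc 0) \<in> {h\<^sup>2..2 * h\<^sup>2}"
  then show "x \<in> support_box h"
    unfolding support_box_def using pt_surj[OF assms]
    by (intro image_eqI[of _ _ "(x 0, x (Suc 0))"]) auto
qed (auto simp: support_box_def)

lemma bump_scaled_support:
  fixes h x :: real
  assumes "0 < h" "x / h \<in> {1..2}"
  shows "x \<in> {h..2 * h}"
  using assms by (simp add: field_simps)

lemma support_box_subset:
  assumes "0 < h" "h \<le> 1 / 4"
  shows "support_box h \<subseteq> Rtop 2 interior_of Omega"
proof -
  have "(a, b) \<in> inner_region" if "a \<in> {h..2 * h}" "b \<in> {h\<^sup>2..2 * h\<^sup>2}" for a b
  proof -
    have "0 < a" using that assms by simp
    moreover have "0 < h\<^sup>2" using assms by simp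
    then have "0 < b" using that(2) by (meson atLeastAtMost_iff less_le_trans)
    \<comment> \<open>On the box a^2 + 4b <= 12 h^2 <= 3/4, which explains the restriction h <=
      1/4.\<close>
    moreover have "a\<^sup>2 \<le> (2 * h)\<^sup>2" using that assms by (intro power_mono) auto
    moreover have "h\<^sup>2 \<le> (1 / 4)\<^sup>2" using assms by (intro power_mono) auto
    ultimately show ?thesis
      using that by (simp add: inner_region_def power2_eq_square)
  qed
  then show ?thesis
    unfolding support_box_def using pt_in_interior by fastforce
qed

lemma test_function_test_bump:
  assumes h: "0 < h" "h \<le> 1 / 4"
  shows "test_function 2 (Rtop 2 interior_of Omega) (test_bump h)"
    and "partial_deriv 1 (test_bump h) x = 1 / h ^ 4 * bump (x 0 / h) * bump' (x (Suc 0) / h\<^sup>2)"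
proof -
  have "(\<lambda>x. 1 / h\<^sup>2 * ((flat_exp 0 (1 / h * x 0 + (- 1)) * flat_exp 0 ((- 1 / h) * x 0 + 2)) *
      (flat_exp 0 (1 / h\<^sup>2 * x (Suc 0) + (- 1)) * flat_exp 0 ((- 1 / h\<^sup>2) * x (Suc 0) + 2)))) \<in> smooth_algebra 2"
    by (intro smooth_algebra.mult smooth_algebra.const smooth_algebra.flat) auto
  also have "(\<lambda>x. 1 / h\<^sup>2 * ((flat_exp 0 (1 / h * x 0 + (- 1)) * flat_exp 0 ((- 1 / h) * x 0 + 2)) *
      (flat_exp 0 (1 / h\<^sup>2 * x (Suc 0) + (- 1)) * flat_exp 0 ((- 1 / h\<^sup>2) * x (Suc 0) + 2)))) = test_bump h"
    by (auto simp: fun_eq_iff test_bump_def bump_def)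
  finally have sm: "test_bump h \<in> smooth_algebra 2" .
  show "test_function 2 (Rtop 2 interior_of Omega) (test_bump h)"
    unfolding test_function_def
  proof (intro conjI exI[of _ "support_box h"] ballI)
    show "smooth_in 2 (topspace (Rtop 2)) (test_bump h)" by (rule smooth_algebra_smooth_in[OF sm])
    show "compactin (Rtop 2) (support_box h)"
      unfolding support_box_def
      by (rule image_compactin[OF _ continuous_map_pt]) (simp add: compactin_euclidean_iff compact_Times)
    show "support_box h \<subseteq> Rtop 2 interior_of Omega" by (rule support_box_subset[OF h])
    fix x assume x: "x \<in> topspace (Rtop 2) - support_box h"
    then have "x \<in> extensional {..<2}" by (simp add: PiE_def)
    with x have "x 0 / h \<notin> {1..2} \<or> x (Suc 0) / h\<^sup>2 \<notin> {1..2}"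
      using support_box_iff bump_scaled_support[of h "x 0"] bump_scaled_support[of "h\<^sup>2" "x (Suc 0)"] h by auto
    then show "test_bump h x = 0" by (auto simp: test_bump_def bump_support)
  qed
  have "((\<lambda>t. bump (t / h\<^sup>2)) has_real_derivative bump' (x (Suc 0) / h\<^sup>2) * (1 / h\<^sup>2)) (at (x (Suc 0)))"
    by (rule DERIV_chain2[OF bump_has_derivative DERIV_cdivide[OF DERIV_ident]])
  then have "((\<lambda>t. 1 / h\<^sup>2 * bump (x 0 / h) * bump (t / h\<^sup>2)) has_real_derivative
      1 / h\<^sup>2 * bump (x 0 / h) * (bump' (x (Suc 0) / h\<^sup>2) * (1 / h\<^sup>2))) (at (x (Suc 0)))"
    by (rule DERIV_cmult)
  then have "partial_deriv 1 (test_bump h) x = 1 / h\<^sup>2 * bump (x 0 / h) * (bump' (x (Suc 0) / h\<^sup>2) * (1 / h\<^sup>2))"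
    unfolding partial_deriv_def by (intro DERIV_imp_deriv) (simp add: test_bump_def)
  moreover have "1 / h ^ 4 = 1 / h\<^sup>2 * (1 / h\<^sup>2)"
    by (simp flip: power_add)
  ultimately show "partial_deriv 1 (test_bump h) x = 1 / h ^ 4 * bump (x 0 / h) * bump' (x (Suc 0) / h\<^sup>2)"
    by simp
qed

text \<open>Substituting (h a, h^2 b), one variable at a time, produces the Jacobian h^3 against the
  factor h^(-3) in the scaling law of the integrand.\<close>

lemma pairing_eq:
  assumes h: "0 < h" "h \<le> 1 / 4"
  shows "(LINT x:Rtop 2 interior_of Omega|Rleb 2. sigma_density x * partial_deriv 1 (test_bump h) x) = pairing h"
proof -
  let ?p = "\<lambda>z. scaled_density h (fst z) (snd z) * bump (fst z) * bump' (snd z)"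
  define f where "f z = density_fun (fst z) (snd z) * (1 / h ^ 4 * bump (fst z / h) * bump' (snd z / h\<^sup>2))" for z
  have [measurable]: "f \<in> borel_measurable (lborel \<Otimes>\<^sub>M lborel)"
    unfolding f_def by measurable
  have cp: "(\<lambda>x. (x 0, x (Suc 0))) \<in> measurable (Rleb 2) (lborel \<Otimes>\<^sub>M lborel)"
    by (intro measurable_Pair) (simp_all add: measurable_coord)
  have [measurable]: "(\<lambda>x. f (x 0, x (Suc 0))) \<in> borel_measurable (Rleb 2)"
    by (rule measurable_compose[OF cp]) simp
  have scale: "f (h * a, h\<^sup>2 * b) = 1 / h ^ 3 * ?p (a, b)" for a b
  proof (cases "0 < a \<and> 0 < b")
    case True
    with h have "density_fun (h * a) (h\<^sup>2 * b) = h * scaled_density h a b"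
      by (intro density_fun_scale) auto
    with h show ?thesis by (simp add: f_def power_numeral_reduce)
  next
    case False
    then have "bump a = 0 \<or> bump' b = 0" using bump_support[of a] bump_support[of b] by auto
    with h show ?thesis by (auto simp: f_def)
  qed
  obtain C where C: "\<And>h z. 0 \<le> h \<Longrightarrow> h \<le> 1 / 4 \<Longrightarrow>
    \<bar>scaled_density h (fst z) (snd z) * bump (fst z) * bump' (snd z)\<bar> \<le> C * indicator ({1..2} \<times> {1..2}) z"
    using pairing_integrand_bound by blast
  have "norm (f z) \<le> norm (1 / h ^ 3 * C * indicator ({h..2 * h} \<times> {h\<^sup>2..2 * h\<^sup>2}) z)" for z
  proof -
    have "f z = 1 / h ^ 3 * ?p (fst z / h, snd z / h\<^sup>2)"
      using scale[of "fst z / h" "snd z / h\<^sup>2"] h by simp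
    also have "\<bar>\<dots>\<bar> \<le> 1 / h ^ 3 * (C * indicator ({1..2} \<times> {1..2}) (fst z / h, snd z / h\<^sup>2))"
      using C[of h "(fst z / h, snd z / h\<^sup>2)"] h by (simp add: abs_mult divide_right_mono)
    also have "indicator ({1..2} \<times> {1..2}) (fst z / h, snd z / h\<^sup>2) = (indicator ({h..2 * h} \<times> {h\<^sup>2..2 * h\<^sup>2}) z :: real)"
      using h by (cases z) (auto simp: indicator_def field_simps)
    finally have "\<bar>f z\<bar> \<le> 1 / h ^ 3 * C * indicator ({h..2 * h} \<times> {h\<^sup>2..2 * h\<^sup>2}) z"
      by (simp only: mult.assoc)
    then show ?thesis unfolding real_norm_def by linarith
  qed
  then have int: "integrable (lborel \<Otimes>\<^sub>M lborel) f"
    by (intro Bochner_Integration.integrable_bound[OF integrable_square_indicator[of "1 / h ^ 3 * C" h "2 * h" "h\<^sup>2" "2 * h\<^sup>2"]] AE_I2)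
      (simp, blast)
  have "(LINT x:Rtop 2 interior_of Omega|Rleb 2. sigma_density x * partial_deriv 1 (test_bump h) x) =
      (LINT x|Rleb 2. f (x 0, x (Suc 0)))"
    unfolding set_lebesgue_integral_def
  proof (rule Bochner_Integration.integral_cong[OF refl])
    fix x assume "x \<in> space (Rleb 2)"
    then have x: "x \<in> extensional {..<2}" by (simp add: space_PiM PiE_def)
    show "indicator (Rtop 2 interior_of Omega) x *\<^sub>R (sigma_density x * partial_deriv 1 (test_bump h) x) = f (x 0, x (Suc 0))"
    proof (cases "x \<in> support_box h")
      case True
      with support_box_subset[OF h] have "x \<in> Rtop 2 interior_of Omega" by blast
      then show ?thesis
        by (simp add: test_function_test_bump(2)[OF h, simplified] sigma_density_def f_def)
    next
      case False
      then have "x 0 / h \<notin> {1..2} \<or> x (Suc 0) / h\<^sup>2 \<notin> {1..2}"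
        using support_box_iff[OF x] bump_scaled_support[of h "x 0"] bump_scaled_support[of "h\<^sup>2" "x (Suc 0)"] h by auto
      then show ?thesis
        by (auto simp: test_function_test_bump(2)[OF h, simplified] f_def bump_support)
    qed
  qed
  also have "\<dots> = (LINT z|(lborel \<Otimes>\<^sub>M lborel). f z)"
    by (subst distr_pt[symmetric]) (simp add: integral_distr split_beta)
  also have "\<dots> = (LINT a|lborel. LINT b|lborel. f (a, b))"
    by (rule lborel_pair.integral_fst'[OF int, symmetric])
  also have "\<dots> = (LINT a|lborel. h\<^sup>2 * (LINT b|lborel. f (a, h\<^sup>2 * b)))"
    using h lborel_integral_real_affine[of "h\<^sup>2" "\<lambda>b. f (_, b)" 0] by simp
  also have "\<dots> = h * (LINT a|lborel. h\<^sup>2 * (LINT b|lborel. f (h * a, h\<^sup>2 * b)))"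
    using h lborel_integral_real_affine[of h "\<lambda>a. h\<^sup>2 * (LINT b|lborel. f (a, h\<^sup>2 * b))" 0] by simp
  also have "\<dots> = (LINT a|lborel. LINT b|lborel. ?p (a, b))"
    using h by (simp only: scale) (simp add: power_numeral_reduce)
  also have "\<dots> = pairing h"
    unfolding pairing_def using h by (intro lborel_pair.integral_fst' integrable_pairing) auto
  finally show ?thesis .
qed

lemma support_box_emeasure:
  assumes h: "0 < h"
  shows "support_box h \<in> sets (Rleb 2)" "emeasure (Rleb 2) (support_box h) = ennreal (h ^ 3)"
proof -
  interpret finite_product_sigma_finite "\<lambda>_::nat. lborel :: real measure" "{..<2::nat}"
    by standard auto
  define A where "A i = (if i = 0 then {h..2 * h} else {h\<^sup>2..2 * h\<^sup>2})" for i :: nat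
  have "x \<in> support_box h \<longleftrightarrow> x \<in> Pi\<^sub>E {..<2} A" for x
  proof (cases "x \<in> extensional {..<2}")
    case True
    then show ?thesis by (simp add: support_box_iff PiE_iff lessThan_2 A_def)
  next
    case False
    then show ?thesis by (auto simp: support_box_def PiE_iff pt_def)
  qed
  then have eq: "support_box h = Pi\<^sub>E {..<2} A" by blast
  show "support_box h \<in> sets (Rleb 2)" unfolding eq by (rule sets_PiM_I_finite) (auto simp: A_def)
  have "emeasure (Rleb 2) (support_box h) = (\<Prod>i<2. emeasure lborel (A i))"
    unfolding eq by (rule measure_times) (auto simp: A_def)
  also have "\<dots> = ennreal h * ennreal (h\<^sup>2)"
    using h by (simp add: lessThan_2 A_def)
  also have "\<dots> = ennreal (h ^ 3)"
    using h by (simp add: power_numeral_reduce flip: ennreal_mult)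
  finally show "emeasure (Rleb 2) (support_box h) = ennreal (h ^ 3)" .
qed

text \<open>A Young-type splitting in place of Hoelder: where |g| <= e/h the bump contributes at
  most e / h^3 per unit volume, in total e; where |g| is larger, the cube of |g| dominates.\<close>

lemma integral_test_bump_le:
  fixes g :: "point \<Rightarrow> real"
  defines "U \<equiv> Rtop 2 interior_of Omega"
  assumes g: "set_integrable (Rleb 2) U (\<lambda>x. \<bar>g x\<bar> powr 3)" and h: "0 < h" and e: "0 < e"
  shows "\<bar>LINT x:U|Rleb 2. g x * test_bump h x\<bar> \<le>
    e + (LINT x|Rleb 2. indicator (support_box h) x * (indicator U x * \<bar>g x\<bar> powr 3)) / e\<^sup>2"
proof -
  let ?q = "\<lambda>x. indicator (support_box h) x * (indicator U x * \<bar>g x\<bar> powr 3)"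
  note box = support_box_emeasure[OF h]
  have gi: "integrable (Rleb 2) (\<lambda>x. indicator U x * \<bar>g x\<bar> powr 3)"
    using g by (simp add: set_integrable_def)
  have i1: "integrable (Rleb 2) ?q"
    using integrable_real_mult_indicator[OF box(1) gi] by (simp add: mult_ac)
  have i2: "integrable (Rleb 2) (\<lambda>x. e / h ^ 3 * indicator (support_box h) x)"
    using box by (intro integrable_mult_right integrable_real_indicator) auto
  have bound: "norm (indicator U x *\<^sub>R (g x * test_bump h x)) \<le> e / h ^ 3 * indicator (support_box h) x + ?q x / e\<^sup>2"
    if "x \<in> space (Rleb 2)" for x
  proof (cases "x \<in> support_box h \<and> x \<in> U")
    case False
    have "x \<in> extensional {..<2}" using that by (simp add: space_PiM PiE_def)
    then have "test_bump h x = 0" if "x \<notin> support_box h"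
      using that support_box_iff bump_scaled_support[of h "x 0"] bump_scaled_support[of "h\<^sup>2" "x (Suc 0)"] h bump_support
      by (metis mult_eq_0_iff test_bump_def zero_less_power)
    with False h e show ?thesis by (auto simp: indicator_def)
  next
    case True
    have t: "0 \<le> test_bump h x" "test_bump h x \<le> 1 / h\<^sup>2"
      using bump_bounds h by (auto simp: test_bump_def divide_right_mono mult_le_one)
    \<comment> \<open>If |g| > e/h then |g|^2 h^2 / e^2 > 1, so multiplying by it only enlarges
      |g|.\<close>
    have "\<bar>g x\<bar> \<le> e / h + \<bar>g x\<bar> powr 3 * h\<^sup>2 / e\<^sup>2"
    proof (cases "\<bar>g x\<bar> \<le> e / h")
      case False
      then have pos: "0 < \<bar>g x\<bar>" and "e < \<bar>g x\<bar> * h" using h e by (auto simp: field_simps intro: less_trans[OF divide_pos_pos[OF e h]])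
      then have "e\<^sup>2 \<le> (\<bar>g x\<bar> * h)\<^sup>2" using e by (intro power_mono) auto
      then have "\<bar>g x\<bar> * e\<^sup>2 \<le> \<bar>g x\<bar> * (\<bar>g x\<bar> * h)\<^sup>2" by (intro mult_left_mono) auto
      also have "\<dots> = \<bar>g x\<bar> powr 3 * h\<^sup>2"
        using pos by (simp add: power_mult_distrib power_numeral_reduce)
      finally have "\<bar>g x\<bar> \<le> \<bar>g x\<bar> powr 3 * h\<^sup>2 / e\<^sup>2" using e by (simp add: field_simps)
      then show ?thesis using h e by (simp add: add_nonneg_nonneg add_increasing)
    qed (use h e in \<open>simp add: add_increasing2\<close>)
    then have "\<bar>g x\<bar> * test_bump h x \<le> (e / h + \<bar>g x\<bar> powr 3 * h\<^sup>2 / e\<^sup>2) * (1 / h\<^sup>2)"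
      using t h e by (intro mult_mono) auto
    also have "\<dots> = e / h ^ 3 + \<bar>g x\<bar> powr 3 / e\<^sup>2"
      using h e by (simp add: field_simps power_numeral_reduce)
    finally show ?thesis using True t by (simp add: abs_mult)
  qed
  have "\<bar>LINT x:U|Rleb 2. g x * test_bump h x\<bar> \<le> (LINT x|Rleb 2. e / h ^ 3 * indicator (support_box h) x + ?q x / e\<^sup>2)"
  proof (cases "integrable (Rleb 2) (\<lambda>x. indicator U x *\<^sub>R (g x * test_bump h x))")
    case True
    have "\<bar>LINT x:U|Rleb 2. g x * test_bump h x\<bar> \<le> (LINT x|Rleb 2. norm (indicator U x *\<^sub>R (g x * test_bump h x)))"
      unfolding set_lebesgue_integral_def using integral_norm_bound[of "Rleb 2" "\<lambda>x. indicator U x *\<^sub>R (g x * test_bump h x)"]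
      by simp
    also have "\<dots> \<le> (LINT x|Rleb 2. e / h ^ 3 * indicator (support_box h) x + ?q x / e\<^sup>2)"
      using True i1 i2 bound by (intro integral_mono Bochner_Integration.integrable_add integrable_divide) auto
    finally show ?thesis .
  next
    \<comment> \<open>The Bochner integral defaults to 0 here, and the bound is nonnegative.\<close>
    case False
    then have "(LINT x:U|Rleb 2. g x * test_bump h x) = 0"
      unfolding set_lebesgue_integral_def by (rule not_integrable_integral_eq)
    moreover have "0 \<le> (LINT x|Rleb 2. e / h ^ 3 * indicator (support_box h) x + ?q x / e\<^sup>2)"
      using bound norm_ge_zero order_trans by (intro integral_nonneg_AE AE_I2) blast
    ultimately show ?thesis by simp
  qed
  also have "\<dots> = e / h ^ 3 * measure (Rleb 2) (support_box h) + (LINT x|Rleb 2. ?q x) / e\<^sup>2"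
    using i1 i2 box by (subst Bochner_Integration.integral_add) auto
  also have "e / h ^ 3 * measure (Rleb 2) (support_box h) = e"
    using h by (simp add: measure_def box)
  finally show ?thesis .
qed

text \<open>For a weak derivative g in L^3, the integral of |g|^3 over the shrinking boxes tends to
  0. Passing to the limit at fixed e leaves |pairing 0| <= e for every e > 0, contradicting
  \<open>pairing_0_neg\<close>.\<close>

lemma sigma_not_in_W13: "\<not> in_W1p 2 3 (Rtop 2 interior_of Omega) sigma_density"
proof
  define U where "U = Rtop 2 interior_of Omega"
  assume "in_W1p 2 3 (Rtop 2 interior_of Omega) sigma_density"
  then obtain g where "in_Lp 2 3 U g" and weak: "weak_partial 2 U 1 sigma_density g"
    unfolding in_W1p_def U_def by (metis one_less_numeral_iff semiring_norm(76))
  then have g: "set_integrable (Rleb 2) U (\<lambda>x. \<bar>g x\<bar> powr 3)"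
    by (simp add: in_Lp_def)
  let ?r = "\<lambda>h. LINT x|Rleb 2. indicator (support_box h) x * (indicator U x * \<bar>g x\<bar> powr 3)"
  have le: "\<bar>pairing h\<bar> \<le> e + ?r h / e\<^sup>2" if h: "0 < h" "h \<le> 1 / 4" and e: "0 < e" for h e
  proof -
    have "pairing h = - (LINT x:U|Rleb 2. g x * test_bump h x)"
      using weak[unfolded weak_partial_def U_def, rule_format, OF test_function_test_bump(1)[OF h]]
        pairing_eq[OF h] by (simp only: U_def)
    then show ?thesis
      using integral_test_bump_le[OF g[unfolded U_def] h(1) e] by (simp add: U_def)
  qed
  define h where "h n = 1 / (4 * real (Suc n))" for n
  have h: "0 < h n" "h n \<le> 1 / 4" for n by (auto simp: h_def field_simps)
  have h0: "h \<longlonglongrightarrow> 0"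
    using tendsto_mult_right[OF LIMSEQ_inverse_real_of_nat, of "1 / 4"] by (simp add: h_def[abs_def] inverse_eq_divide mult.commute)
  have "(\<lambda>n. ?r (h n)) \<longlonglongrightarrow> (LINT x|Rleb 2. 0)"
  proof (rule integral_dominated_convergence[where w = "\<lambda>x. indicator U x * \<bar>g x\<bar> powr 3"])
    show gi: "integrable (Rleb 2) (\<lambda>x. indicator U x * \<bar>g x\<bar> powr 3)"
      using g by (simp add: set_integrable_def)
    show "(\<lambda>x. indicator (support_box (h n)) x * (indicator U x * \<bar>g x\<bar> powr 3)) \<in> borel_measurable (Rleb 2)" for n
      by (rule borel_measurable_times[OF borel_measurable_indicator[OF support_box_emeasure(1)[OF h(1)]] borel_measurable_integrable[OF gi]])
    show "AE x in Rleb 2. (\<lambda>n. indicator (support_box (h n)) x * (indicator U x * \<bar>g x\<bar> powr 3)) \<longlonglongrightarrow> 0"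
    proof (rule AE_I2)
      fix x assume "x \<in> space (Rleb 2)"
      then have x: "x \<in> extensional {..<2}" by (simp add: space_PiM PiE_def)
      \<comment> \<open>The boxes shrink to the origin without containing it, so each point leaves
        them: to the right of the axis once 2 h < x 0, elsewhere from the start.\<close>
      have "\<forall>\<^sub>F n in sequentially. x \<notin> support_box (h n)"
      proof (cases "x 0 > 0")
        case True
        then have "\<forall>\<^sub>F n in sequentially. h n < x 0 / 2" using h0 by (intro order_tendstoD) auto
        then show ?thesis by eventually_elim (auto simp: support_box_iff[OF x])
      next
        case False
        have "x \<notin> support_box (h n)" for n
          using False h(1)[of n] by (auto simp: support_box_iff[OF x])
        then show ?thesis by simp
      qed
      then show "(\<lambda>n. indicator (support_box (h n)) x * (indicator U x * \<bar>g x\<bar> powr 3)) \<longlonglongrightarrow> 0"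
        by (rule tendsto_eventually[OF eventually_mono]) simp
    qed
    show "AE x in Rleb 2. norm (indicator (support_box (h n)) x * (indicator U x * \<bar>g x\<bar> powr 3)) \<le> indicator U x * \<bar>g x\<bar> powr 3" for n
      by (intro AE_I2) (auto simp: indicator_def)
  qed simp
  then have r0: "(\<lambda>n. ?r (h n)) \<longlonglongrightarrow> 0" by simp
  have "\<bar>pairing 0\<bar> \<le> e" if e: "0 < e" for e
  proof (rule LIMSEQ_le)
    show "(\<lambda>n. \<bar>pairing (h n)\<bar>) \<longlonglongrightarrow> \<bar>pairing 0\<bar>"
      using h h0 by (intro tendsto_rabs pairing_tendsto) (auto simp: less_imp_le)
    have "(\<lambda>n. e + ?r (h n) / e\<^sup>2) \<longlonglongrightarrow> e + 0 / e\<^sup>2"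
      using e by (intro tendsto_intros r0) auto
    then show "(\<lambda>n. e + ?r (h n) / e\<^sup>2) \<longlonglongrightarrow> e" by simp
    show "\<exists>N. \<forall>n\<ge>N. \<bar>pairing (h n)\<bar> \<le> e + ?r (h n) / e\<^sup>2"
      using le[OF h e] by blast
  qed
  from this[of "- pairing 0 / 2"] pairing_0_neg show False by simp
qed

lemma source_target_smooth: "source \<in> smooth_algebra 2" "target \<in> smooth_algebra 2"
  unfolding source_def[abs_def] target_def[abs_def] excess_def
  by (intro smooth_algebra.intros smooth_algebra_power smooth_algebra_diff; simp)+

theorem mainTheorem3:
  shows "\<exists>(d::nat) (\<Omega> :: point set) (fp :: point \<Rightarrow> real) (fm :: point \<Rightarrow> real) (\<sigma> :: point \<Rightarrow> real).
    1 \<le> d \<and>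
    compactin (Rtop d) \<Omega> \<and> convex_Rd d \<Omega> \<and> Rtop d interior_of \<Omega> \<noteq> {} \<and>
    smooth_up_to_boundary d \<Omega> fp \<and> smooth_up_to_boundary d \<Omega> fm \<and>
    (\<forall>x\<in>\<Omega>. 0 \<le> fp x) \<and> (\<forall>x\<in>\<Omega>. 0 \<le> fm x) \<and>
    (LINT x:\<Omega>|Rleb d. fp x) = (LINT x:\<Omega>|Rleb d. fm x) \<and>
    is_transport_density d \<Omega> fp fm \<sigma> \<and>
    \<not> in_W1p d 3 (Rtop d interior_of \<Omega>) \<sigma>"
proof (intro exI conjI)
  show "1 \<le> (2 :: nat)" by simp
  show "compactin (Rtop 2) Omega" by (rule compactin_Omega)
  show "convex_Rd 2 Omega" by (rule convex_Omega)
  show "Rtop 2 interior_of Omega \<noteq> {}"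
    using pt_in_interior[of "1 / 4" "1 / 8"] by (auto simp: inner_region_def power2_eq_square)
  show "smooth_up_to_boundary 2 Omega source" "smooth_up_to_boundary 2 Omega target"
    by (intro smooth_algebra_smooth_up_to_boundary source_target_smooth)+
  show "\<forall>x\<in>Omega. 0 \<le> source x" "\<forall>x\<in>Omega. 0 \<le> target x"
    using source_nonneg by (auto simp: target_def)
qed (rule source_target_same_mass is_transport_density_sigma sigma_not_in_W13)+

end
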